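(* Let $(\mathrm M,\mathsf d,\mathfrak m)$ be a complete separable metric space equipped with a non-negative Radon measure. Then: (1) $\mathrm d(fg)=g\,\mathrm df+f\,\mathrm dg$ $\mathfrak m$-a.e., for every $f,g\in S^2(\mathrm M)\cap L^\infty(\mathfrak m)$; (2) $\mathrm df=0$ $\mathfrak m$-a.e. on $f^{-1}(\mathcal N)$, for every $f\in S^2(\mathrm M)$ and every $\mathcal L^1$-negligible Borel set $\mathcal N\subset\mathbb R$; (3) $\mathrm d(\varphi\circ f)=\varphi'\circ f\,\mathrm df$ $\mathfrak m$-a.e., for every $f\in S^2(\mathrm M)$ and every Lipschitz $\varphi:\mathbb R\to\mathbb R$, where $\varphi'\circ f$ is defined arbitrarily on $f^{-1}(\{\text{non-differentiability points of }\varphi\})$.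
   Context: Functions and Borel sets are identified up to $\mathfrak m$-a.e. equality; $L^0(\mathfrak m)$ is the space of (classes of) real valued Borel functions. Sobolev class. For an absolutely continuous curve $\gamma\in C([0,1],\mathrm M)$, $|\dot\gamma_t|$ is its metric speed (the a.e. minimal $f\in L^1(0,1)$ with $\mathsf d(\gamma_t,\gamma_s)\le\int_t^sf(r)\,dr$ for $t<s$); $\int_0^1|\dot\gamma_t|^2dt:=+\infty$ if $\gamma$ is not absolutely continuous; $\mathrm e_t(\gamma):=\gamma_t$. A test plan is a Borel probability measure $\pi$ on $C([0,1],\mathrm M)$ such that for some $C$ one has $(\mathrm e_t)_*\pi\le C\mathfrak m$ for all $t\in[0,1]$, and $\iint_0^1|\dot\gamma_t|^2\,dt\,d\pi(\gamma)<\infty$. $S^2(\mathrm M)$ is the set of $f\in L^0(\mathfrak m)$ for which there is a non-negative $G\in L^2(\mathfrak m)$ with $\int|f(\gamma_1)-f(\gamma_0)|\,d\pi\le\iint_0^1G(\gamma_t)|\dot\gamma_t|\,dt\,d\pi$ for every test plan $\pi$; $|\mathrm Df|$ denotes the $\mathfrak m$-a.e. minimal such $G$. It is known that $S^2(\mathrm M)$ is a vector space, $S^2\cap L^\infty(\mathrm M)$ is an algebra, and $\varphi\circ f\in S^2(\mathrm M)$ for $f\in S^2(\mathrm M)$, $\varphi$ Lipschitz. Modules. An $L^2(\mathfrak m)$-normed module is a Banach space $\mathscr M$ with a bilinear multiplication $L^\infty(\mathfrak m)\times\mathscr M\to\mathscr M$ with $(fg)v=f(gv)$, $\mathbf 1v=v$,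 and a pointwise norm $|\cdot|:\mathscr M\to L^2(\mathfrak m)$ with non-negative values such that $\||v|\|_{L^2(\mathfrak m)}=\|v\|_{\mathscr M}$ and $|fv|=|f||v|$ $\mathfrak m$-a.e. For $v\in\mathscr M$ and a Borel set $A$, "$v=0$ $\mathfrak m$-a.e. on $A$" means $\chi_Av=0$. Cotangent module. Consider countable families $\{(f_i,A_i)\}_i$ with $(A_i)$ a Borel partition of $\mathrm M$, $f_i\in S^2(\mathrm M)$, $\sum_i\int_{A_i}|\mathrm Df_i|^2d\mathfrak m<\infty$, modulo the relation $\{(f_i,A_i)\}\sim\{(g_j,B_j)\}$ iff $|\mathrm D(f_i-g_j)|=0$ $\mathfrak m$-a.e. on $A_i\cap B_j$ for all $i,j$. On classes set $[(f_i,A_i)]+[(g_j,B_j)]:=[(f_i+g_j,A_i\cap B_j)]$, $\lambda[(f_i,A_i)]:=[(\lambda f_i,A_i)]$, $(\sum_ja_j\chi_{B_j})[(f_i,A_i)]:=[(a_jf_i,A_i\cap B_j)]$ for finite Borel partitions $(B_j)$, pointwise norm $|[(f_i,A_i)]|:=|\mathrm Df_i|$ on $A_i$, and norm equal to the $L^2(\mathfrak m)$-norm of the pointwise norm. The completion, with operations extended by continuity, is the $L^2(\mathfrak m)$-normed module $L^2(T^*\mathrm M)$. The differential of $f\in S^2(\mathrm M)$ is $\mathrm df:=[(f,\mathrm M)]\in L^2(T^*\mathrm M)$; thus $|\mathrm df|=|\mathrm Df|$. *)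

theory Defs
  imports "HOL-Probability.Probability"
begin

text \<open>
  Functions and Borel sets are represented by Borel representatives; every notion below is
  invariant under modification on \<^term>\<open>m\<close>-null sets.
\<close>

definition radon_measure :: "'a::metric_space measure \<Rightarrow> bool" where
  "radon_measure m \<longleftrightarrow>
     sets m = sets borel \<and>
     (\<forall>x. \<exists>U. open U \<and> x \<in> U \<and> emeasure m U < \<infinity>) \<and>
     (\<forall>B\<in>sets borel. emeasure m B = (SUP K\<in>{K. compact K \<and> K \<subseteq> B}. emeasure m K))"

definition Linf :: "'a measure \<Rightarrow> ('a \<Rightarrow> real) set" where
  "Linf m = {f \<in> borel_measurable m. \<exists>C. AE x in m. \<bar>f x\<bar> \<le> C}"


section \<open>Curves and test plans\<close>

text \<open>The space of continuous curves with the supremum distance; its elements are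
  \<^term>\<open>undefined\<close> outside \<open>[0,1]\<close>.\<close>

definition curves :: "(real \<Rightarrow> 'a::metric_space) metric" where
  "curves = cfunspace (top_of_set {0..1}) euclidean_metric"

definition curves_borel :: "(real \<Rightarrow> 'a::metric_space) measure" where
  "curves_borel = sigma (mspace curves) {U. openin (mtopology_of curves) U}"

definition speed_bound :: "(real \<Rightarrow> 'a::metric_space) \<Rightarrow> (real \<Rightarrow> real) \<Rightarrow> bool" where
  "speed_bound \<gamma> f \<longleftrightarrow>
     set_integrable lborel {0..1} f \<and>
     (\<forall>t s. 0 \<le> t \<and> t < s \<and> s \<le> 1 \<longrightarrow> dist (\<gamma> t) (\<gamma> s) \<le> (LINT r:{t..s}|lborel. f r))"

definition abs_cont_curve :: "(real \<Rightarrow> 'a::metric_space) \<Rightarrow> bool" where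
  "abs_cont_curve \<gamma> \<longleftrightarrow> (\<exists>f. speed_bound \<gamma> f)"

text \<open>A representative of the a.e. minimal bound; it is determined a.e. on \<open>[0,1]\<close>, and
  meaningful for absolutely continuous curves only.\<close>

definition metric_speed :: "(real \<Rightarrow> 'a::metric_space) \<Rightarrow> real \<Rightarrow> real" where
  "metric_speed \<gamma> = (SOME f. speed_bound \<gamma> f \<and>
     (\<forall>g. speed_bound \<gamma> g \<longrightarrow> (AE t in lborel. t \<in> {0..1} \<longrightarrow> f t \<le> g t)))"

definition kinetic_energy :: "(real \<Rightarrow> 'a::metric_space) \<Rightarrow> ennreal" where
  "kinetic_energy \<gamma> =
     (if abs_cont_curve \<gamma> then \<integral>\<^sup>+t\<in>{0..1}. ennreal ((metric_speed \<gamma> t)\<^sup>2) \<partial>lborel else \<infinity>)"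

definition test_plan :: "'a::metric_space measure \<Rightarrow> (real \<Rightarrow> 'a) measure \<Rightarrow> bool" where
  "test_plan m \<pi> \<longleftrightarrow>
     sets \<pi> = sets curves_borel \<and> prob_space \<pi> \<and>
     (\<exists>C::real. \<forall>t\<in>{0..1}. \<forall>B\<in>sets borel.
        emeasure (distr \<pi> borel (\<lambda>\<gamma>. \<gamma> t)) B \<le> ennreal C * emeasure m B) \<and>
     (\<integral>\<^sup>+\<gamma>. kinetic_energy \<gamma> \<partial>\<pi>) < \<infinity>"


section \<open>The Sobolev class\<close>

text \<open>The double integral is iterated, so only the a.e. class of the metric speed of each
  single curve enters. Curves that are not absolutely continuous are negligible for a test
  plan.\<close>

definition weak_upper_gradient :: "'a::metric_space measure \<Rightarrow> ('a \<Rightarrow> real) \<Rightarrow> ('a \<Rightarrow> real) \<Rightarrow> bool" where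
  "weak_upper_gradient m f G \<longleftrightarrow>
     G \<in> borel_measurable m \<and> (\<forall>x. 0 \<le> G x) \<and> (\<integral>\<^sup>+x. ennreal ((G x)\<^sup>2) \<partial>m) < \<infinity> \<and>
     (\<forall>\<pi>. test_plan m \<pi> \<longrightarrow>
        (\<integral>\<^sup>+\<gamma>. ennreal \<bar>f (\<gamma> 1) - f (\<gamma> 0)\<bar> \<partial>\<pi>)
          \<le> (\<integral>\<^sup>+\<gamma>. (\<integral>\<^sup>+t\<in>{0..1}. ennreal (G (\<gamma> t) * metric_speed \<gamma> t) \<partial>lborel) \<partial>\<pi>))"

definition S2 :: "'a::metric_space measure \<Rightarrow> ('a \<Rightarrow> real) set" where
  "S2 m = {f \<in> borel_measurable m. \<exists>G. weak_upper_gradient m f G}"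

text \<open>A representative of \<open>|Df|\<close>.\<close>

definition min_wug :: "'a::metric_space measure \<Rightarrow> ('a \<Rightarrow> real) \<Rightarrow> 'a \<Rightarrow> real" where
  "min_wug m f = (SOME G. weak_upper_gradient m f G \<and>
     (\<forall>H. weak_upper_gradient m f H \<longrightarrow> (AE x in m. G x \<le> H x)))"


section \<open>The pre-cotangent module\<close>

text \<open>A countable family \<open>{(f\<^sub>i, A\<^sub>i)}\<close> is the set of its members. Repetitions in an
  indexed family can only occur for \<open>A\<^sub>i = {}\<close>, so nothing is lost.\<close>

type_synonym 'a family = "(('a \<Rightarrow> real) \<times> 'a set) set"

definition families :: "'a::metric_space measure \<Rightarrow> 'a family set" where
  "families m = {F. countable F \<and>
     (\<forall>(f, A)\<in>F. f \<in> S2 m \<and> A \<in> sets borel) \<and>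
     disjoint_family_on snd F \<and> (\<Union>p\<in>F. snd p) = UNIV \<and>
     (\<Sum>\<^sub>\<infinity>(f, A)\<in>F. \<integral>\<^sup>+x\<in>A. ennreal ((min_wug m f x)\<^sup>2) \<partial>m) < \<infinity>}"

definition family_rel :: "'a::metric_space measure \<Rightarrow> 'a family rel" where
  "family_rel m = {(F, G). F \<in> families m \<and> G \<in> families m \<and>
     (\<forall>(f, A)\<in>F. \<forall>(g, B)\<in>G. AE x in m. x \<in> A \<inter> B \<longrightarrow> min_wug m (\<lambda>y. f y - g y) x = 0)}"

definition family_add :: "'a family \<Rightarrow> 'a family \<Rightarrow> 'a family" where
  "family_add F G = (\<lambda>((f, A), (g, B)). (\<lambda>x. f x + g x, A \<inter> B)) ` (F \<times> G)"

definition family_scale :: "real \<Rightarrow> 'a family \<Rightarrow> 'a family" where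
  "family_scale c F = (\<lambda>(f, A). (\<lambda>x. c * f x, A)) ` F"

text \<open>A simple function \<open>h\<close> is \<open>\<Sum>\<^sub>j a\<^sub>j \<chi>\<^bsub>B\<^sub>j\<^esub>\<close> with \<open>a\<^sub>j\<close> ranging over its values and
  \<open>B\<^sub>j = h -` {a\<^sub>j}\<close>.\<close>

definition family_mult :: "('a \<Rightarrow> real) \<Rightarrow> 'a family \<Rightarrow> 'a family" where
  "family_mult h F = (\<lambda>(a, (f, A)). (\<lambda>x. a * f x, A \<inter> h -` {a})) ` (range h \<times> F)"

definition family_pnorm :: "'a::metric_space measure \<Rightarrow> 'a family \<Rightarrow> 'a \<Rightarrow> real" where
  "family_pnorm m F x = min_wug m (fst (THE p. p \<in> F \<and> x \<in> snd p)) x"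

text \<open>The operations on classes follow the pattern of \<^theory>\<open>HOL.Equiv_Relations\<close>: the
  unions below are unions of copies of one and the same class.\<close>

definition precot :: "'a::metric_space measure \<Rightarrow> 'a family set set" where
  "precot m = families m // family_rel m"

definition precot_class :: "'a::metric_space measure \<Rightarrow> 'a family \<Rightarrow> 'a family set" where
  "precot_class m F = family_rel m `` {F}"

definition precot_add :: "'a::metric_space measure \<Rightarrow> 'a family set \<Rightarrow> 'a family set \<Rightarrow> 'a family set" where
  "precot_add m X Y = (\<Union>F\<in>X. \<Union>G\<in>Y. precot_class m (family_add F G))"

definition precot_scale :: "'a::metric_space measure \<Rightarrow> real \<Rightarrow> 'a family set \<Rightarrow> 'a family set" where
  "precot_scale m c X = (\<Union>F\<in>X. precot_class m (family_scale c F))"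

definition precot_mult :: "'a::metric_space measure \<Rightarrow> ('a \<Rightarrow> real) \<Rightarrow> 'a family set \<Rightarrow> 'a family set" where
  "precot_mult m h X = (\<Union>F\<in>X. precot_class m (family_mult h F))"

definition precot_norm :: "'a::metric_space measure \<Rightarrow> 'a family set \<Rightarrow> real" where
  "precot_norm m X = the_elem ((\<lambda>F. sqrt (\<integral>x. (family_pnorm m F x)\<^sup>2 \<partial>m)) ` X)"

definition precot_dist :: "'a::metric_space measure \<Rightarrow> 'a family set \<Rightarrow> 'a family set \<Rightarrow> real" where
  "precot_dist m X Y = precot_norm m (precot_add m X (precot_scale m (-1) Y))"


section \<open>The cotangent module\<close>

text \<open>The completion, realised as Cauchy sequences modulo sequences at vanishing distance.\<close>

type_synonym 'a covector = "(nat \<Rightarrow> 'a family set) set"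

definition cot_cauchy :: "'a::metric_space measure \<Rightarrow> (nat \<Rightarrow> 'a family set) set" where
  "cot_cauchy m = {X. (\<forall>n. X n \<in> precot m) \<and>
     (\<forall>e>0. \<exists>N. \<forall>i\<ge>N. \<forall>j\<ge>N. precot_dist m (X i) (X j) < e)}"

definition cot_rel :: "'a::metric_space measure \<Rightarrow> (nat \<Rightarrow> 'a family set) rel" where
  "cot_rel m = {(X, Y). X \<in> cot_cauchy m \<and> Y \<in> cot_cauchy m \<and>
     (\<lambda>n. precot_dist m (X n) (Y n)) \<longlonglongrightarrow> 0}"

definition cotangent :: "'a::metric_space measure \<Rightarrow> 'a covector set" where
  "cotangent m = cot_cauchy m // cot_rel m"

definition cot_embed :: "'a::metric_space measure \<Rightarrow> 'a family set \<Rightarrow> 'a covector" where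
  "cot_embed m X = cot_rel m `` {\<lambda>n. X}"

definition cot_zero :: "'a::metric_space measure \<Rightarrow> 'a covector" where
  "cot_zero m = cot_embed m (precot_class m {(\<lambda>x. 0, UNIV)})"

definition cot_add :: "'a::metric_space measure \<Rightarrow> 'a covector \<Rightarrow> 'a covector \<Rightarrow> 'a covector" where
  "cot_add m v w = (\<Union>X\<in>v. \<Union>Y\<in>w. cot_rel m `` {\<lambda>n. precot_add m (X n) (Y n)})"

text \<open>Continuous extension of the multiplication by simple functions: \<open>h n\<close> ranges over the
  sequences of simple functions converging to \<open>g\<close> in \<open>L\<^sup>\<infinity>(m)\<close>. They exist exactly for
  \<^prop>\<open>g \<in> Linf m\<close>.\<close>

definition cot_mult :: "'a::metric_space measure \<Rightarrow> ('a \<Rightarrow> real) \<Rightarrow> 'a covector \<Rightarrow> 'a covector" where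
  "cot_mult m g v =
     (\<Union>X\<in>v. \<Union>h\<in>{h. (\<forall>n. simple_function m (h n)) \<and>
                      (\<forall>e>0. \<forall>\<^sub>F n in sequentially. AE x in m. \<bar>h n x - g x\<bar> < e)}.
        cot_rel m `` {\<lambda>n. precot_mult m (h n) (X n)})"

definition cot_zero_on :: "'a::metric_space measure \<Rightarrow> 'a covector \<Rightarrow> 'a set \<Rightarrow> bool" where
  "cot_zero_on m v A \<longleftrightarrow> cot_mult m (indicator A) v = cot_zero m"

text \<open>For \<^prop>\<open>f \<notin> S2 m\<close> this is the empty set, which is no element of
  \<^term>\<open>cotangent m\<close>; so an equation with an element of \<^term>\<open>cotangent m\<close> contains
  \<^prop>\<open>f \<in> S2 m\<close>.\<close>

definition differential :: "'a::metric_space measure \<Rightarrow> ('a \<Rightarrow> real) \<Rightarrow> 'a covector" where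
  "differential m f = cot_embed m (precot_class m {(f, UNIV)})"

end

theory Submission
  imports Defs
begin

text \<open>
  Let \<open>\<pi>\<close> be a test plan and \<open>G\<close> a weak upper gradient of \<open>f\<close>. Conditioning \<open>\<pi>\<close> on sets of curves
  and stopping the curves at two given times turns the integrated inequality into a pointwise one:
  for \<open>\<pi>\<close>-almost every \<open>\<gamma>\<close> the function \<open>f \<circ> \<gamma>\<close> agrees almost everywhere, and at both
  endpoints, with an absolutely continuous \<open>F\<close> such that \<open>\<bar>F'(t)\<bar> \<le> G(\<gamma>\<^sub>t) \<bar>\<gamma>'\<^sub>t\<bar>\<close>. The product rule,
  the chain rule and the locality principle for \<open>\<bar>D f\<bar>\<close> are thereby reduced to one-dimensional
  calculus, where \<open>F' = 0\<close> almost everywhere on \<open>F\<^sup>-\<^sup>1(N)\<close> for negligible \<open>N\<close>; the latter takes care of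
  the points at which \<open>\<phi>\<close> is not differentiable. In the module, multiplication by \<open>g\<close> is the limit
  of multiplications by simple functions \<open>h\<^sub>n\<close>, so the calculus rules for differentials amount to
  estimates such as \<open>\<bar>D(f g - a f - b g)\<bar> \<le> \<bar>f - b\<bar> \<bar>D g\<bar> + \<bar>g - a\<bar> \<bar>D f\<bar>\<close>, used with the
  constants \<open>a = h\<^sub>n(x)\<close> and \<open>b = k\<^sub>n(x)\<close> close to \<open>g(x)\<close> and \<open>f(x)\<close>.
\<close>

text \<open>Two obstacles shape the proof. \<open>metric_speed\<close> is chosen curve by curve,
  with no measurability in the curve; \<open>lower_speed\<close>, a liminf of difference quotients,
  is jointly measurable and agrees with it almost everywhere on [0,1] along absolutely continuous
  curves. Tonelli's theorem and the exchange of "every time, almost every curve" for "almost every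
  curve, almost every time" rest on it. Secondly, \<open>f\<close> is only Borel, so along a curve
  it is controlled at rational times and at almost every time; a McShane extension of these values
  gives \<open>F\<close>, with both endpoints among the rational times, because a weak upper
  gradient tests nothing but endpoints. In the module, a family is read as the map from a point to
  the function active there. A family has countably many members and a simple function finitely many
  values, so estimates for fixed functions and constants may be used with both depending on the
  point. Distances are kept squared in \<open>ennreal\<close>: (a + b)^2 <= 2 a^2 + 2 b^2 replaces
  Minkowski's inequality, since only finiteness, the Cauchy property and limits 0 are
  tested.\<close>

section \<open>Lebesgue differentiation and absolutely continuous functions on the line\<close>

text \<open>A Vitali argument: disjoint short intervals with nonnegative integral cover almost all
  of \<open>B\<close>. In them the negative mass of \<open>h\<close>, at least \<open>c\<close>
  times the measure of the part of \<open>A\<close> they contain, is balanced by positive mass,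
  which lives off \<open>A\<close> and is made small by outer regularity.\<close>

lemma negligible_Vitali_nonneg:
  fixes h :: "real \<Rightarrow> real"
  assumes h: "integrable lborel h" and A: "A \<in> sets borel" and c: "0 < c"
    and hA: "\<And>x. x \<in> A \<Longrightarrow> h x \<le> - c" and BA: "B \<subseteq> A"
    and fine: "\<And>x d. x \<in> B \<Longrightarrow> 0 < d \<Longrightarrow>
      \<exists>a b. a \<le> x \<and> x \<le> b \<and> a < b \<and> b - a < d \<and> 0 \<le> (LINT t:{a..b}|lborel. h t)"
  shows "negligible B"
  unfolding negligible_outer_le
proof (intro allI impI)
  fix e :: real assume e: "0 < e"
  have [measurable]: "h \<in> borel_measurable borel" "A \<in> sets borel"
    using h A by auto
  define Np where "Np = density lborel (\<lambda>x. ennreal (h x))"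
  define Nm where "Nm = density lborel (\<lambda>x. ennreal (- h x))"
  define M where "M = density lborel (\<lambda>x. ennreal \<bar>h x\<bar>)"
  have [simp]: "sets Np = sets borel" "sets Nm = sets borel" "sets M = sets borel"
    by (simp_all add: Np_def Nm_def M_def)
  have finM: "emeasure M (space M) \<noteq> \<infinity>"
    using h unfolding M_def by (simp add: emeasure_density integrable_iff_bounded)
  then have finM': "finite_measure M" by (rule finite_measureI)
  interpret M: finite_measure M by fact
  \<comment> \<open>Outer regularity of the finite measure with density |h|. The slack
    \<open>c * e\<close> becomes \<open>e\<close> after the final division by
    \<open>c\<close>.\<close>
  have "(INF U \<in> {U. A \<subseteq> U \<and> open U}. emeasure M U) = emeasure M A"
    using outer_regular[of M A] finM A by simp
  also have "\<dots> < emeasure M A + ennreal (c * e)"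
    using e c M.emeasure_finite[of A] by (cases "emeasure M A") (auto simp: ennreal_plus[symmetric] ennreal_less_iff simp del: ennreal_plus)
  finally obtain U where U: "A \<subseteq> U" "open U" and MU: "emeasure M U < emeasure M A + ennreal (c * e)"
    by (auto simp: INF_less_iff)
  have [measurable]: "U \<in> sets borel" using U by simp
  have MUA: "emeasure M (U - A) \<le> ennreal (c * e)"
  proof -
    have "emeasure M (U - A) = emeasure M U - emeasure M A"
      using U A by (intro emeasure_Diff) auto
    then show ?thesis
      using MU by (auto simp: ennreal_minus_le_iff less_imp_le)
  qed
  \<comment> \<open>Intervals are indexed as closed balls about their midpoints to suit the covering
    theorem; the point of \<open>B\<close> may lie anywhere in the ball.\<close>
  define K where "K = {(p::real, r). 0 < r \<and> cball p r \<subseteq> U \<and> 0 \<le> (LINT t:cball p r|lborel. h t)}"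
  have cov: "\<exists>i. i \<in> K \<and> x \<in> cball (fst i) (snd i) \<and> snd i < d" if xB: "x \<in> B" and d: "0 < d" for x d
  proof -
    have "x \<in> U" using xB BA U by auto
    then obtain r where r: "0 < r" "ball x r \<subseteq> U" using U(2) open_contains_ball by blast
    obtain a b where ab: "a \<le> x" "x \<le> b" "a < b" "b - a < min d r" "0 \<le> (LINT t:{a..b}|lborel. h t)"
      using fine[OF xB, of "min d r"] d r by auto
    have eq: "cball ((a+b)/2) ((b-a)/2) = {a..b}"
      by (auto simp: cball_eq_atLeastAtMost field_simps)
    have "{a..b} \<subseteq> ball x r" using ab by (auto simp: dist_real_def abs_if)
    then show ?thesis using r ab eq
      by (intro exI[of _ "((a+b)/2, (b-a)/2)"]) (auto simp: K_def)
  qed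
  have pos: "0 < snd i" if "i \<in> K" for i
    using that by (cases i) (simp add: K_def)
  obtain C where C: "countable C" "C \<subseteq> K"
     "pairwise (\<lambda>i j. disjnt (cball (fst i) (snd i)) (cball (fst j) (snd j))) C"
     "negligible (B - (\<Union>i \<in> C. cball (fst i) (snd i)))"
    using Vitali_covering_theorem_cballs[OF pos cov] by blast
  define V where "V = (\<Union>i \<in> C. cball (fst i) (snd i))"
  have disj: "disjoint_family_on (\<lambda>i. cball (fst i) (snd i)) C"
    using C(3) by (auto simp: disjoint_family_on_def pairwise_def disjnt_def)
  have VU: "V \<subseteq> U" unfolding V_def
  proof (rule UN_least)
    fix i assume "i \<in> C"
    then have "i \<in> K" using C(2) by blast
    then show "cball (fst i) (snd i) \<subseteq> U" by (cases i) (simp add: K_def)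
  qed
  have [measurable]: "V \<in> sets borel" unfolding V_def using C(1) by (intro sets.countable_UN') auto
  have le: "emeasure Nm (cball (fst i) (snd i)) \<le> emeasure Np (cball (fst i) (snd i))" if "i \<in> C" for i
  proof -
    let ?I = "cball (fst i) (snd i)"
    let ?k = "\<lambda>t. indicator ?I t * h t"
    have i: "integrable lborel ?k"
      using integrable_mult_indicator[OF _ h, of ?I] by simp
    have "0 \<le> (LINT t|lborel. ?k t)"
      using that C(2) by (auto simp: K_def set_lebesgue_integral_def)
    moreover have "emeasure Np ?I = (\<integral>\<^sup>+t. ennreal (?k t) \<partial>lborel)"
      by (auto simp: Np_def emeasure_density intro!: nn_integral_cong split: split_indicator)
    moreover have "emeasure Nm ?I = (\<integral>\<^sup>+t. ennreal (- ?k t) \<partial>lborel)"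
      by (auto simp: Nm_def emeasure_density intro!: nn_integral_cong split: split_indicator)
    moreover have "(\<integral>\<^sup>+t. ennreal (?k t) \<partial>lborel) < top" "(\<integral>\<^sup>+t. ennreal (- ?k t) \<partial>lborel) < top"
      using i by (auto simp: real_integrable_def less_top)
    ultimately show ?thesis
      using real_lebesgue_integral_def[OF i]
      by (metis diff_ge_0_iff_ge ennreal_enn2real ennreal_leI)
  qed
  have "emeasure Nm V \<le> emeasure Np V"
    unfolding V_def using C(1) disj le
    by (subst (1 2) emeasure_UN_countable)
       (auto intro!: nn_integral_mono)
  also have "\<dots> \<le> emeasure M (U - A)"
  proof -
    have "ennreal (h x) * indicator V x \<le> ennreal \<bar>h x\<bar> * indicator (U - A) x" for x
    proof (cases "x \<in> A")
      case True
      then have "ennreal (h x) = 0" using hA[of x] c by (simp add: ennreal_neg)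
      then show ?thesis by simp
    next
      case False
      then show ?thesis using VU by (auto split: split_indicator intro!: ennreal_leI)
    qed
    then show ?thesis
      unfolding Np_def M_def by (auto simp: emeasure_density intro!: nn_integral_mono)
  qed
  also have "\<dots> \<le> ennreal (c * e)" by (rule MUA)
  finally have 1: "emeasure Nm V \<le> ennreal (c * e)" .
  have "ennreal c * emeasure lborel (A \<inter> V) = (\<integral>\<^sup>+t. ennreal c * indicator (A \<inter> V) t \<partial>lborel)"
    by (simp add: nn_integral_cmult)
  also have "\<dots> \<le> emeasure Nm V"
  proof -
    have "ennreal c * indicator (A \<inter> V) x \<le> ennreal (- h x) * indicator V x" for x
      using hA[of x] by (auto split: split_indicator intro!: ennreal_leI)
    then show ?thesis
      unfolding Nm_def by (auto simp: emeasure_density intro!: nn_integral_mono)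
  qed
  finally have 2: "ennreal c * emeasure lborel (A \<inter> V) \<le> ennreal c * ennreal e"
    using 1 c e by (simp add: ennreal_mult)
  have 3: "emeasure lborel (A \<inter> V) \<le> ennreal e"
    using 2 c by (subst (asm) ennreal_mult_le_mult_iff) auto
  let ?T = "(A \<inter> V) \<union> (B - V)"
  have neg: "negligible (B - V)" using C(4) by (simp add: V_def)
  have fmT: "A \<inter> V \<in> lmeasurable"
    using 3 by (intro fmeasurableI) (auto simp: emeasure_completion less_top[symmetric] top_unique)
  have "measure lebesgue ?T = measure lebesgue (A \<inter> V)"
    using neg fmT by (intro measure_Un_null_set) (auto simp: negligible_iff_null_sets)
  also have "\<dots> \<le> e" using 3 e by (simp add: measure_def enn2real_leI)
  finally show "\<exists>T. B \<subseteq> T \<and> T \<in> lmeasurable \<and> measure lebesgue T \<le> e"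
    using BA fmeasurable.Un[OF fmT negligible_imp_measurable[OF neg]] by (intro exI[of _ ?T]) auto
qed


text \<open>Suppose arbitrarily short intervals through x have averages at least q although g x < q.
  Then g - q satisfies the Vitali lemma near x. Rational q, a bound on |x| and a lower bound on q -
  g x leave countably many cases.\<close>

lemma Lebesgue_density_upper:
  fixes g :: "real \<Rightarrow> real"
  assumes g: "integrable lborel g"
  shows "AE x in lborel. \<forall>\<beta>>g x. \<exists>d>0. \<forall>a b. a \<le> x \<and> x \<le> b \<and> a < b \<and> b - a < d \<longrightarrow>
    (LINT t:{a..b}|lborel. g t) < \<beta> * (b - a)"
proof -
  define bad where "bad q n k = {x. \<bar>x\<bar> \<le> real n \<and> g x \<le> of_rat q - 1 / Suc k \<and>
     (\<forall>d>0. \<exists>a b. a \<le> x \<and> x \<le> b \<and> a < b \<and> b - a < d \<and> of_rat q * (b - a) \<le> (LINT t:{a..b}|lborel. g t))}"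
    for q :: rat and n k :: nat
  have [measurable]: "g \<in> borel_measurable borel" using g by auto
  have "negligible (bad q n k)" for q n k
  proof (rule negligible_Vitali_nonneg)
    \<comment> \<open>One unit of margin contains every interval of length below 1 through a point
      of [-n, n]; cutting off there makes the constant \<open>of_rat q\<close> integrable.\<close>
    let ?J = "{- real n - 1..real n + 1}"
    let ?h = "\<lambda>t. indicator ?J t * g t - of_rat q * indicator ?J t"
    have ig: "integrable lborel (\<lambda>t. indicator ?J t * g t)"
      using integrable_mult_indicator[OF _ g, of ?J] by simp
    then show "integrable lborel ?h" by simp
    show "0 < 1 / real (Suc k)" by simp
    show "{x. \<bar>x\<bar> \<le> real n \<and> g x \<le> of_rat q - 1 / Suc k} \<in> sets borel" by measurable
    show "?h x \<le> - (1 / real (Suc k))" if "x \<in> {x. \<bar>x\<bar> \<le> real n \<and> g x \<le> of_rat q - 1 / Suc k}" for x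
      using that by (auto simp: indicator_def)
    show "bad q n k \<subseteq> {x. \<bar>x\<bar> \<le> real n \<and> g x \<le> of_rat q - 1 / Suc k}" by (auto simp: bad_def)
    fix x d :: real assume x: "x \<in> bad q n k" and d: "0 < d"
    then have "min d 1 > 0" by simp
    then obtain a b where ab: "a \<le> x" "x \<le> b" "a < b" "b - a < min d 1"
      "of_rat q * (b - a) \<le> (LINT t:{a..b}|lborel. g t)"
      using x unfolding bad_def by blast
    have "{a..b} \<subseteq> ?J" using ab x by (auto simp: bad_def)
    then have eq: "indicator {a..b} t * ?h t = indicator {a..b} t * g t - of_rat q * indicator {a..b} t" for t
      by (auto split: split_indicator)
    have "(LINT t:{a..b}|lborel. ?h t) = (LINT t|lborel. indicator {a..b} t * g t - of_rat q * indicator {a..b} t)"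
      unfolding set_lebesgue_integral_def using eq by simp
    also have "\<dots> = (LINT t:{a..b}|lborel. g t) - of_rat q * (b - a)"
      using integrable_mult_indicator[OF _ g, of "{a..b}"] ab
      by (subst Bochner_Integration.integral_diff) (auto simp: set_lebesgue_integral_def)
    finally have "0 \<le> (LINT t:{a..b}|lborel. ?h t)" using ab by simp
    then show "\<exists>a b. a \<le> x \<and> x \<le> b \<and> a < b \<and> b - a < d \<and> 0 \<le> (LINT t:{a..b}|lborel. ?h t)"
      using ab by (intro exI[of _ a] exI[of _ b]) auto
  qed
  then have "negligible (\<Union>(q, n, k)\<in>UNIV. bad q n k)"
    by (intro negligible_countable_Union) auto
  then have "AE x in lebesgue. x \<notin> (\<Union>(q, n, k)\<in>UNIV. bad q n k)"
    unfolding negligible_iff_null_sets by (rule AE_not_in)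
  then have "AE x in lborel. x \<notin> (\<Union>(q, n, k)\<in>UNIV. bad q n k)"
    by (simp add: AE_completion_iff)
  then show ?thesis
  proof (rule eventually_mono, intro allI impI)
    fix x \<beta> assume x: "x \<notin> (\<Union>(q, n, k)\<in>UNIV. bad q n k)" and \<beta>: "g x < \<beta>"
    obtain q where q: "g x < of_rat q" "of_rat q < \<beta>" using of_rat_dense[OF \<beta>] by blast
    obtain k where k: "1 / Suc k < of_rat q - g x" using q(1) nat_approx_posE[of "of_rat q - g x"] by auto
    obtain n where n: "\<bar>x\<bar> \<le> real n" using real_arch_simple by blast
    have "x \<notin> bad q n k" using x by auto
    then have "\<exists>d>0. \<forall>a b. a \<le> x \<and> x \<le> b \<and> a < b \<and> b - a < d \<longrightarrow>
        (LINT t:{a..b}|lborel. g t) < of_rat q * (b - a)"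
      using k n unfolding bad_def by (simp add: not_le) (metis not_le)
    then obtain d where d: "d > 0"
      "\<And>a b. a \<le> x \<Longrightarrow> x \<le> b \<Longrightarrow> a < b \<Longrightarrow> b - a < d \<Longrightarrow> (LINT t:{a..b}|lborel. g t) < of_rat q * (b - a)"
      by blast
    show "\<exists>d>0. \<forall>a b. a \<le> x \<and> x \<le> b \<and> a < b \<and> b - a < d \<longrightarrow> (LINT t:{a..b}|lborel. g t) < \<beta> * (b - a)"
    proof (intro exI[of _ d] conjI allI impI d(1))
      fix a b assume *: "a \<le> x \<and> x \<le> b \<and> a < b \<and> b - a < d"
      then have "(LINT t:{a..b}|lborel. g t) < of_rat q * (b - a)" using d by blast
      also have "\<dots> \<le> \<beta> * (b - a)" using * q by (intro mult_right_mono) auto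
      finally show "(LINT t:{a..b}|lborel. g t) < \<beta> * (b - a)" .
    qed
  qed
qed

theorem Lebesgue_differentiation:
  fixes g F :: "real \<Rightarrow> real"
  assumes g: "integrable lborel g"
    and F: "\<And>x y. x \<le> y \<Longrightarrow> F y - F x = (LINT t:{x..y}|lborel. g t)"
  shows "AE x in lborel. (F has_real_derivative g x) (at x)"
proof -
  have g': "integrable lborel (\<lambda>x. - g x)" using g by simp
  show ?thesis
    using Lebesgue_density_upper[OF g] Lebesgue_density_upper[OF g']
  proof eventually_elim
    case (elim x)
    have "((\<lambda>y. (F y - F x) / (y - x)) \<longlongrightarrow> g x) (at x)"
    proof (rule tendstoI)
      fix e :: real assume e: "0 < e"
      obtain d1 where d1: "d1 > 0" "\<And>a b. a \<le> x \<Longrightarrow> x \<le> b \<Longrightarrow> a < b \<Longrightarrow> b - a < d1 \<Longrightarrow>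
        (LINT t:{a..b}|lborel. g t) < (g x + e) * (b - a)"
        using elim(1)[rule_format, of "g x + e"] e by auto
      obtain d2 where d2: "d2 > 0" "\<And>a b. a \<le> x \<Longrightarrow> x \<le> b \<Longrightarrow> a < b \<Longrightarrow> b - a < d2 \<Longrightarrow>
        (LINT t:{a..b}|lborel. - g t) < (- g x + e) * (b - a)"
        using elim(2)[rule_format, of "- g x + e"] e by auto
      have neg: "(LINT t:{a..b}|lborel. - g t) = - (LINT t:{a..b}|lborel. g t)" for a b
        by (simp add: set_lebesgue_integral_def)
      have *: "dist ((F y - F x) / (y - x)) (g x) < e" if y: "y \<noteq> x" "dist y x < min d1 d2" for y
      proof (cases "x < y")
        case True
        have "F y - F x < (g x + e) * (y - x)" "- (F y - F x) < (- g x + e) * (y - x)"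
          using d1(2)[of x y] d2(2)[of x y] True y F[of x y] neg by (auto simp: dist_real_def)
        then show ?thesis using True by (auto simp: dist_real_def abs_less_iff field_simps)
      next
        case False
        then have "y < x" using y by auto
        then have "F x - F y < (g x + e) * (x - y)" "- (F x - F y) < (- g x + e) * (x - y)"
          using d1(2)[of y x] d2(2)[of y x] y F[of y x] neg by (auto simp: dist_real_def)
        moreover have "(F y - F x) / (y - x) = (F x - F y) / (x - y)"
          by (metis minus_diff_eq minus_divide_divide)
        ultimately show ?thesis using \<open>y < x\<close> by (auto simp: dist_real_def abs_less_iff field_simps)
      qed
      show "\<forall>\<^sub>F y in at x. dist ((F y - F x) / (y - x)) (g x) < e"
        unfolding eventually_at using * d1(1) d2(1) by (intro exI[of _ "min d1 d2"]) auto
    qed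
    then show ?case by (simp add: has_field_derivative_iff)
  qed
qed


text \<open>Absolute continuity on the whole line, carried with an integrable bound for the
  derivative. A bound, unlike a density, is easily produced for compositions and products.\<close>

definition integral_bounded :: "(real \<Rightarrow> real) \<Rightarrow> (real \<Rightarrow> real) \<Rightarrow> bool" where
  "integral_bounded F g \<longleftrightarrow> integrable lborel g \<and> (\<forall>x. 0 \<le> g x) \<and>
     (\<forall>x y. x \<le> y \<longrightarrow> \<bar>F y - F x\<bar> \<le> (LINT t:{x..y}|lborel. g t))"

lemma set_integral_atMost_diff:
  fixes g :: "real \<Rightarrow> real"
  assumes g: "integrable lborel g" and "x \<le> y"
  shows "(LINT t:{..y}|lborel. g t) - (LINT t:{..x}|lborel. g t) = (LINT t:{x..y}|lborel. g t)"
    and "(LINT t:{x<..y}|lborel. g t) = (LINT t:{x..y}|lborel. g t)"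
proof -
  have si: "set_integrable lborel A g" if "A \<in> sets borel" for A
    using integrable_mult_indicator[OF _ g, of A] that by (simp add: set_integrable_def)
  have [measurable]: "g \<in> borel_measurable borel" using g by auto
  show *: "(LINT t:{x<..y}|lborel. g t) = (LINT t:{x..y}|lborel. g t)"
  proof (rule set_integral_cong_set)
    show "AE t in lborel. t \<in> {x..y} \<longleftrightarrow> t \<in> {x<..y}"
      using AE_lborel_singleton[of x] by eventually_elim auto
  qed (auto simp: set_borel_measurable_def)
  have "{..y} = {..x} \<union> {x<..y}" using assms by auto
  then have "(LINT t:{..y}|lborel. g t) = (LINT t:{..x}|lborel. g t) + (LINT t:{x<..y}|lborel. g t)"
    by (metis set_integral_Un[OF _ si si] atMost_borel greaterThanAtMost_borel ivl_disj_int_one(3) inf_commute)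
  with * show "(LINT t:{..y}|lborel. g t) - (LINT t:{..x}|lborel. g t) = (LINT t:{x..y}|lborel. g t)"
    by simp
qed

lemma nn_integral_Icc_eq:
  fixes g :: "real \<Rightarrow> real"
  assumes g: "integrable lborel g" and nn: "\<And>x. 0 \<le> g x"
  shows "(\<integral>\<^sup>+t\<in>{x..y}. ennreal (g t) \<partial>lborel) = ennreal (LINT t:{x..y}|lborel. g t)"
proof -
  have "(\<integral>\<^sup>+t\<in>{x..y}. ennreal (g t) \<partial>lborel) = (\<integral>\<^sup>+t. ennreal (indicator {x..y} t * g t) \<partial>lborel)"
    by (intro nn_integral_cong) (auto split: split_indicator)
  also have "\<dots> = ennreal (LINT t:{x..y}|lborel. g t)"
    using integrable_mult_indicator[OF _ g, of "{x..y}"] nn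
    by (subst nn_integral_eq_integral) (auto simp: set_lebesgue_integral_def)
  finally show ?thesis .
qed

lemma isCont_set_integral_atMost:
  fixes g :: "real \<Rightarrow> real"
  assumes g: "integrable lborel g" and nn: "\<And>x. 0 \<le> g x"
  shows "isCont (\<lambda>s. LINT t:{..s}|lborel. g t) a"
proof -
  define N where "N = density lborel (\<lambda>x. ennreal (g x))"
  have [measurable]: "g \<in> borel_measurable borel" using g by auto
  have "emeasure N (space N) \<noteq> \<infinity>"
    using g nn unfolding N_def by (simp add: emeasure_density integrable_iff_bounded less_top)
  then have "finite_measure N" by (rule finite_measureI)
  then interpret N: finite_borel_measure N
    by (simp add: finite_borel_measure_def finite_borel_measure_axioms_def N_def)
  have "(LINT t:{..s}|lborel. g t) = cdf N s" for s
  proof -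
    have "emeasure N {..s} = (\<integral>\<^sup>+t. ennreal (indicator {..s} t * g t) \<partial>lborel)"
      by (auto simp: N_def emeasure_density intro!: nn_integral_cong split: split_indicator)
    also have "\<dots> = ennreal (LINT t:{..s}|lborel. g t)"
      using integrable_mult_indicator[OF _ g, of "{..s}"] nn
      by (subst nn_integral_eq_integral) (auto simp: set_lebesgue_integral_def)
    finally show ?thesis
      using nn by (simp add: cdf_def measure_def set_lebesgue_integral_def)
  qed
  moreover have "measure N {a} = 0"
  proof -
    have "AE x in lborel. ennreal (g x) * indicator {a} x = 0"
      using AE_lborel_singleton[of a] by eventually_elim auto
    then have "emeasure N {a} = 0"
      by (simp add: N_def emeasure_density nn_integral_0_iff_AE)
    then show ?thesis by (simp add: measure_def)
  qed
  ultimately show ?thesis using N.isCont_cdf[of a] by simp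
qed

lemma integral_primitive:
  fixes g :: "real \<Rightarrow> real"
  assumes g: "integrable lborel g" and nn: "\<And>x. 0 \<le> g x"
  obtains P where "\<And>x. isCont P x" "\<And>x y. x \<le> y \<Longrightarrow> P x \<le> P y"
    "\<And>x y. x \<le> y \<Longrightarrow> P y - P x = (LINT t:{x..y}|lborel. g t)"
proof (rule that[OF isCont_set_integral_atMost[OF g nn] _ set_integral_atMost_diff(1)[OF g]])
  fix x y :: real assume "x \<le> y"
  moreover have "0 \<le> (LINT t:{x..y}|lborel. g t)" by (simp add: set_lebesgue_integral_def nn)
  ultimately show "(LINT t:{..x}|lborel. g t) \<le> (LINT t:{..y}|lborel. g t)"
    using set_integral_atMost_diff(1)[OF g, of x y] by linarith
qed

text \<open>The fundamental theorem of calculus for absolutely continuous functions. With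
  \<open>P\<close> a primitive of \<open>g\<close>, both P + F and P - F increase, and their
  Stieltjes measures add up to 2 g dx. So the measure of P + F is absolutely continuous, and its
  Radon-Nikodym density minus \<open>g\<close> is the density of \<open>F\<close>.\<close>

theorem integral_bounded_derivative:
  assumes Fg: "integral_bounded F g"
  obtains f where "integrable lborel f"
    and "\<And>x y. x \<le> y \<Longrightarrow> F y - F x = (LINT t:{x..y}|lborel. f t)"
    and "AE x in lborel. (F has_real_derivative f x) (at x)"
proof -
  have g: "integrable lborel g" and nn: "\<And>x. 0 \<le> g x"
    and bnd: "\<And>x y. x \<le> y \<Longrightarrow> \<bar>F y - F x\<bar> \<le> (LINT t:{x..y}|lborel. g t)"
    using Fg by (auto simp: integral_bounded_def)
  have [measurable]: "g \<in> borel_measurable borel" using g by auto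
  obtain P where Pc: "\<And>x. isCont P x" and Pmono: "\<And>x y. x \<le> y \<Longrightarrow> P x \<le> P y"
    and P: "\<And>x y. x \<le> y \<Longrightarrow> P y - P x = (LINT t:{x..y}|lborel. g t)"
    by (rule integral_primitive[OF g nn]) (rule that)
  have Pr: "continuous (at_right a) P" for a
    by (rule continuous_at_imp_continuous_at_within[OF Pc])
  have Fc: "continuous (at_right a) F" for a
    unfolding continuous_within
  proof (rule Lim_null[THEN iffD2, OF Lim_null_comparison])
    show "\<forall>\<^sub>F x in at_right a. norm (F x - F a) \<le> P x - P a"
      using bnd[of a] P[of a] by (auto simp: eventually_at_right_less eventually_at intro!: exI[of _ 1])
    show "((\<lambda>x. P x - P a) \<longlongrightarrow> 0) (at_right a)"
      using Pr unfolding continuous_within by (rule LIM_zero)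
  qed
  define M1 where "M1 = interval_measure (\<lambda>s. P s + F s)"
  define M2 where "M2 = interval_measure (\<lambda>s. P s - F s)"
  define N where "N = density lborel (\<lambda>x. ennreal (2 * g x))"
  have [simp]: "sets M1 = sets borel" "sets M2 = sets borel" "sets N = sets borel"
    by (simp_all add: M1_def M2_def N_def)
  have [simp]: "space M1 = UNIV" "space M2 = UNIV" "space N = UNIV"
    by (simp_all add: M1_def M2_def N_def)
  have mono: "P x + F x \<le> P y + F y" "P x - F x \<le> P y - F y" if "x \<le> y" for x y
    using bnd[OF that] P[OF that] by linarith+
  have M1: "emeasure M1 {a<..b} = ennreal (P b + F b - (P a + F a))" if "a \<le> b" for a b
    unfolding M1_def using mono(1) Pr Fc that by (intro emeasure_interval_measure_Ioc) (auto intro: continuous_add)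
  have M2: "emeasure M2 {a<..b} = ennreal (P b - F b - (P a - F a))" if "a \<le> b" for a b
    unfolding M2_def using mono(2) Pr Fc that by (intro emeasure_interval_measure_Ioc) (auto intro: continuous_diff)
  have N: "emeasure N {a<..b} = ennreal (2 * (P b - P a))" if "a \<le> b" for a b
  proof -
    have "emeasure N {a<..b} = (\<integral>\<^sup>+t. ennreal (2 * (indicator {a<..b} t * g t)) \<partial>lborel)"
      by (auto simp: N_def emeasure_density intro!: nn_integral_cong split: split_indicator)
    also have "\<dots> = ennreal (2 * (LINT t:{a<..b}|lborel. g t))"
      using integrable_mult_indicator[OF _ g, of "{a<..b}"] nn
      by (subst nn_integral_eq_integral) (auto simp: set_lebesgue_integral_def)
    finally show ?thesis using set_integral_atMost_diff(2)[OF g that] P[OF that] by simp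
  qed
  have Ioc: "emeasure M1 {a<..b} + emeasure M2 {a<..b} = emeasure N {a<..b}" for a b
  proof (cases "a \<le> b")
    case True
    then show ?thesis
      using mono[OF True] by (simp add: M1 M2 N ennreal_plus[symmetric] del: ennreal_plus)
  qed simp
  \<comment> \<open>Equality of the measures is checked inside bounded windows, where all masses are
    finite and the complement step can cancel.\<close>
  define W where "W n = {- real n<..real n}" for n
  have [measurable]: "W n \<in> sets borel" for n by (simp add: W_def)
  have sum: "emeasure M1 (A \<inter> W n) + emeasure M2 (A \<inter> W n) = emeasure N (A \<inter> W n)" if A: "A \<in> sets borel" for A n
  proof -
    have "Int_stable (range (\<lambda>(a, b). {a <.. b::real}))"
      by (auto simp: Int_stable_def)
    moreover have "range (\<lambda>(a, b). {a <.. b::real}) \<subseteq> Pow UNIV" by simp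
    moreover have "A \<in> sigma_sets UNIV (range (\<lambda>(a, b). {a <.. b::real}))"
      using A by (simp add: borel_sigma_sets_Ioc)
    ultimately show ?thesis
    proof (induction rule: sigma_sets_induct_disjoint)
      case (basic A)
      then obtain a b where "A \<inter> W n = {max a (- real n)<..min b (real n)}" by (auto simp: W_def)
      then show ?case using Ioc by simp
    next
      case (compl A)
      then have [measurable]: "A \<in> sets borel" by (simp add: borel_sigma_sets_Ioc)
      have eq: "(UNIV - A) \<inter> W n = W n - (A \<inter> W n)" by auto
      have fin: "emeasure M1 (A \<inter> W n) \<noteq> \<infinity>" "emeasure M2 (A \<inter> W n) \<noteq> \<infinity>" "emeasure N (A \<inter> W n) \<noteq> \<infinity>"
        using emeasure_mono[of "A \<inter> W n" "W n" M1] emeasure_mono[of "A \<inter> W n" "W n" M2]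
          emeasure_mono[of "A \<inter> W n" "W n" N]
        by (auto simp: W_def M1 M2 N top_unique)
      have *: "emeasure M (W n - (A \<inter> W n)) + emeasure M (A \<inter> W n) = emeasure M (W n)"
        if "sets M = sets borel" for M
        using that by (subst plus_emeasure) (auto intro!: arg_cong[where f="emeasure M"])
      have "emeasure M1 (W n) + emeasure M2 (W n) = emeasure N (W n)"
        using Ioc by (simp add: W_def)
      then have "emeasure N (A \<inter> W n) + (emeasure M1 (W n - (A \<inter> W n)) + emeasure M2 (W n - (A \<inter> W n)))
         = emeasure N (A \<inter> W n) + emeasure N (W n - (A \<inter> W n))"
        using *[of M1, symmetric] *[of M2, symmetric] *[of N, symmetric] compl.IH[symmetric] by (simp add: ac_simps)
      then show ?case unfolding eq using fin by (simp add: ennreal_add_left_cancel)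
    next
      case (union A)
      then have [measurable]: "A i \<in> sets borel" for i
        unfolding borel_sigma_sets_Ioc by (simp add: image_subset_iff)
      have "emeasure M (\<Union>(range A) \<inter> W n) = (\<Sum>i. emeasure M (A i \<inter> W n))" if "sets M = sets borel" for M
      proof -
        have "(\<Sum>i. emeasure M (A i \<inter> W n)) = emeasure M (\<Union>i. A i \<inter> W n)"
          using that union(1) by (intro suminf_emeasure) (auto simp: disjoint_family_on_def)
        then show ?thesis by simp
      qed
      then show ?case using union(3) by (simp add: suminf_add)
    qed auto
  qed
  have le: "emeasure M1 A \<le> emeasure N A" if A[measurable]: "A \<in> sets borel" for A
  proof -
    have W: "(\<Union>n. A \<inter> W n) = A"
    proof -
      have "\<exists>n. x \<in> W n" for x
        using reals_Archimedean2[of "\<bar>x\<bar>"] by (auto simp: W_def abs_less_iff intro: less_imp_le)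
          (meson less_imp_le minus_less_iff)
      then show ?thesis by auto
    qed
    have "incseq (\<lambda>n. A \<inter> W n)" by (auto simp: incseq_def W_def)
    then have *: "(SUP n. emeasure M (A \<inter> W n)) = emeasure M A" if "sets M = sets borel" for M
      using that W by (subst SUP_emeasure_incseq) auto
    have "emeasure M1 (A \<inter> W n) \<le> emeasure N (A \<inter> W n)" for n
      unfolding sum[OF A, symmetric] by simp
    then have "(SUP n. emeasure M1 (A \<inter> W n)) \<le> (SUP n. emeasure N (A \<inter> W n))"
      by (intro SUP_mono) auto
    then show ?thesis using * by simp
  qed
  have "absolutely_continuous lborel M1"
    unfolding absolutely_continuous_def
  proof
    fix A :: "real set" assume A: "A \<in> null_sets lborel"
    then have "emeasure N A = 0"
      by (auto simp: N_def emeasure_density null_sets_def nn_integral_null_set nn_integral_0_iff_AE intro: AE_I'[OF A])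
    then show "A \<in> null_sets M1" using le[of A] A by (auto simp: null_sets_def)
  qed
  then obtain \<rho> where \<rho>: "\<rho> \<in> borel_measurable lborel" "density lborel \<rho> = M1"
    using sigma_finite_measure.Radon_Nikodym[OF sigma_finite_lborel, of M1] by auto
  have [measurable]: "\<rho> \<in> borel_measurable borel" using \<rho> by simp
  have "(\<integral>\<^sup>+x. \<rho> x \<partial>lborel) = emeasure M1 UNIV"
    unfolding \<rho>(2)[symmetric] by (simp add: emeasure_density)
  also have "\<dots> \<le> emeasure N UNIV" by (rule le) simp
  also have "\<dots> < \<infinity>"
  proof -
    have "integrable lborel (\<lambda>x. 2 * g x)" using g by simp
    then have "(\<integral>\<^sup>+x. ennreal (norm (2 * g x)) \<partial>lborel) < \<infinity>"
      unfolding integrable_iff_bounded by blast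
    then show ?thesis using nn by (simp add: N_def emeasure_density abs_mult)
  qed
  finally have fin: "(\<integral>\<^sup>+x. \<rho> x \<partial>lborel) \<noteq> \<infinity>" by simp
  then have ae: "AE x in lborel. \<rho> x \<noteq> \<infinity>" by (intro nn_integral_PInf_AE) auto
  define r where "r x = enn2real (\<rho> x)" for x
  have r_ae: "AE x in lborel. ennreal (r x) = \<rho> x"
    using ae by eventually_elim (auto simp: r_def less_top)
  have r: "integrable lborel r"
  proof (rule integrableI_nonneg)
    have "(\<integral>\<^sup>+x. ennreal (r x) \<partial>lborel) = (\<integral>\<^sup>+x. \<rho> x \<partial>lborel)"
      using r_ae by (rule nn_integral_cong_AE)
    then show "(\<integral>\<^sup>+x. ennreal (r x) \<partial>lborel) < \<infinity>" using fin by (simp add: less_top)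
  qed (auto simp: r_def[abs_def])
  have rnn: "0 \<le> r x" for x by (simp add: r_def)
  have rint: "(LINT t:{a..b}|lborel. r t) = P b + F b - (P a + F a)" if "a \<le> b" for a b
  proof -
    have "ennreal (LINT t:{a<..b}|lborel. r t) = (\<integral>\<^sup>+t. ennreal (indicator {a<..b} t * r t) \<partial>lborel)"
      using integrable_mult_indicator[OF _ r, of "{a<..b}"] rnn
      by (subst nn_integral_eq_integral) (auto simp: set_lebesgue_integral_def)
    also have "\<dots> = (\<integral>\<^sup>+t. \<rho> t * indicator {a<..b} t \<partial>lborel)"
      using r_ae by (intro nn_integral_cong_AE, eventually_elim) (auto split: split_indicator)
    also have "\<dots> = emeasure M1 {a<..b}" unfolding \<rho>(2)[symmetric] by (simp add: emeasure_density)
    finally have "ennreal (LINT t:{a<..b}|lborel. r t) = ennreal (P b + F b - (P a + F a))"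
      using M1[OF that] by simp
    moreover have "0 \<le> (LINT t:{a<..b}|lborel. r t)"
      using rnn by (simp add: set_lebesgue_integral_def)
    ultimately have "(LINT t:{a<..b}|lborel. r t) = P b + F b - (P a + F a)"
      using mono(1)[OF that] by simp
    then show ?thesis using set_integral_atMost_diff(2)[OF r that] by simp
  qed
  define f where "f x = r x - g x" for x
  have f: "integrable lborel f" using r g unfolding f_def by simp
  have fint: "F y - F x = (LINT t:{x..y}|lborel. f t)" if "x \<le> y" for x y
  proof -
    have "(LINT t:{x..y}|lborel. f t) = (LINT t:{x..y}|lborel. r t) - (LINT t:{x..y}|lborel. g t)"
      unfolding f_def
      using integrable_mult_indicator[OF _ r, of "{x..y}"] integrable_mult_indicator[OF _ g, of "{x..y}"]
      by (intro set_integral_diff) (auto simp: set_integrable_def)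
    then show ?thesis using rint[OF that] P[OF that] by simp
  qed
  show ?thesis
    using that[OF f fint Lebesgue_differentiation[OF f fint]] by blast
qed

text \<open>\<open>F\<close> is the integral of its derivative, so bounding the derivatives that
  exist is enough. \<open>k\<close> takes values in \<open>ennreal\<close> so that
  \<open>lower_speed\<close> can be inserted directly.\<close>

lemma integral_bounded_le_nn_integral:
  assumes Fg: "integral_bounded F g" and "x \<le> y"
    and k: "AE t in lborel. t \<in> {x..y} \<longrightarrow> (\<forall>D. (F has_real_derivative D) (at t) \<longrightarrow> ennreal \<bar>D\<bar> \<le> k t)"
  shows "ennreal \<bar>F y - F x\<bar> \<le> (\<integral>\<^sup>+t\<in>{x..y}. k t \<partial>lborel)"
proof -
  obtain f where f: "integrable lborel f"
    "\<And>x y. x \<le> y \<Longrightarrow> F y - F x = (LINT t:{x..y}|lborel. f t)"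
    "AE x in lborel. (F has_real_derivative f x) (at x)"
    using integral_bounded_derivative[OF Fg] by blast
  have "\<bar>F y - F x\<bar> \<le> (LINT t:{x..y}|lborel. \<bar>f t\<bar>)"
    using set_integral_norm_bound[of lborel "{x..y}" f] integrable_mult_indicator[OF _ f(1), of "{x..y}"] f(2)[OF \<open>x \<le> y\<close>]
    by (simp add: set_integrable_def)
  then have "ennreal \<bar>F y - F x\<bar> \<le> ennreal (LINT t:{x..y}|lborel. \<bar>f t\<bar>)" by (rule ennreal_leI)
  also have "\<dots> = (\<integral>\<^sup>+t\<in>{x..y}. ennreal \<bar>f t\<bar> \<partial>lborel)"
    using f(1) by (intro nn_integral_Icc_eq[symmetric]) auto
  also have "\<dots> \<le> (\<integral>\<^sup>+t\<in>{x..y}. k t \<partial>lborel)"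
    using f(3) k by (intro nn_integral_mono_AE, eventually_elim) (auto split: split_indicator)
  finally show ?thesis .
qed

text \<open>The difference quotients of \<open>F\<close> are dominated by those of a primitive of
  \<open>g\<close>, which converge to \<open>g\<close> almost everywhere.\<close>

lemma integral_bounded_derivative_le:
  assumes Fg: "integral_bounded F g"
  shows "AE t in lborel. \<forall>D. (F has_real_derivative D) (at t) \<longrightarrow> \<bar>D\<bar> \<le> g t"
proof -
  have g: "integrable lborel g" and nn: "\<And>x. 0 \<le> g x"
    and bnd: "\<And>x y. x \<le> y \<Longrightarrow> \<bar>F y - F x\<bar> \<le> (LINT t:{x..y}|lborel. g t)"
    using Fg by (auto simp: integral_bounded_def)
  obtain P where Pc: "\<And>x. isCont P x" and Pmono: "\<And>x y. x \<le> y \<Longrightarrow> P x \<le> P y"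
    and P: "\<And>x y. x \<le> y \<Longrightarrow> P y - P x = (LINT t:{x..y}|lborel. g t)"
    by (rule integral_primitive[OF g nn]) (rule that)
  have "AE t in lborel. (P has_real_derivative g t) (at t)"
    by (rule Lebesgue_differentiation[OF g P])
  then show ?thesis
  proof (eventually_elim, intro allI impI)
    fix t D assume P': "(P has_real_derivative g t) (at t)" and D: "(F has_real_derivative D) (at t)"
    have "((\<lambda>y. \<bar>(F y - F t) / (y - t)\<bar>) \<longlongrightarrow> \<bar>D\<bar>) (at_right t)"
      using D by (intro tendsto_rabs) (auto simp: has_field_derivative_iff intro: tendsto_mono[OF at_le])
    moreover have "((\<lambda>y. (P y - P t) / (y - t)) \<longlongrightarrow> g t) (at_right t)"
      using P' by (auto simp: has_field_derivative_iff intro: tendsto_mono[OF at_le])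
    moreover have "\<forall>\<^sub>F y in at_right t. \<bar>(F y - F t) / (y - t)\<bar> \<le> (P y - P t) / (y - t)"
      using bnd[of t] P[of t]
      by (auto simp: eventually_at abs_divide intro!: exI[of _ 1] divide_right_mono)
    ultimately show "\<bar>D\<bar> \<le> g t"
      by (intro tendsto_le[of "at_right t"]) auto
  qed
qed

text \<open>Near a point with nonzero derivative, \<open>F\<close> shrinks distances to that point
  by at most a fixed factor. On a short piece of such points \<open>F\<close> therefore has a
  Lipschitz inverse, and the piece is a Lipschitz image of a subset of \<open>N\<close>.\<close>

lemma derivative_eq_0_on_preimage_negligible:
  fixes F :: "real \<Rightarrow> real"
  assumes N: "negligible N"
  shows "AE t in lborel. F t \<in> N \<longrightarrow> (\<forall>D. (F has_real_derivative D) (at t) \<longrightarrow> D = 0)"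
proof -
  define E where "E n = {t. F t \<in> N \<and> (\<forall>s. \<bar>s - t\<bar> < 1 / Suc n \<longrightarrow> \<bar>s - t\<bar> \<le> real (Suc n) * \<bar>F s - F t\<bar>)}" for n
  \<comment> \<open>Pieces of length \<open>1 / Suc n\<close>, so that any two points of a piece are
    within the scale at which \<open>E n\<close> gives its estimate; rational centres keep the
    pieces countable.\<close>
  define J where "J n c = {t. \<bar>t - of_rat c\<bar> < 1 / (2 * real (Suc n))}" for n and c :: rat
  have neg: "negligible (E n \<inter> J n c)" for n c
  proof -
    let ?S = "E n \<inter> J n c"
    have lip: "\<bar>s - t\<bar> \<le> real (Suc n) * \<bar>F s - F t\<bar>" if "s \<in> ?S" "t \<in> ?S" for s t
    proof -
      have "\<bar>s - t\<bar> \<le> \<bar>s - of_rat c\<bar> + \<bar>t - of_rat c\<bar>" by linarith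
      also have "\<dots> < 1 / (2 * real (Suc n)) + 1 / (2 * real (Suc n))"
        using that unfolding J_def by (intro add_strict_mono) auto
      also have "\<dots> = 1 / Suc n" by (simp add: field_simps)
      finally show ?thesis using that by (auto simp: E_def)
    qed
    have inj: "inj_on F ?S"
      using lip by (fastforce intro: inj_onI)
    have "negligible (the_inv_into ?S F ` (F ` ?S))"
    proof (rule negligible_locally_Lipschitz_image)
      show "negligible (F ` ?S)" using N by (rule negligible_subset) (auto simp: E_def)
      fix x assume "x \<in> F ` ?S"
      then obtain t where t: "t \<in> ?S" "x = F t" by auto
      have "norm (the_inv_into ?S F y - the_inv_into ?S F x) \<le> real (Suc n) * norm (y - x)"
        if "y \<in> F ` ?S \<inter> UNIV" for y
        using that t lip inj by (auto simp: the_inv_into_f_f)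
      then show "\<exists>T B. open T \<and> x \<in> T \<and> (\<forall>y\<in>F ` ?S \<inter> T. norm (the_inv_into ?S F y - the_inv_into ?S F x) \<le> B * norm (y - x))"
        by (intro exI[of _ UNIV]) blast
    qed simp
    moreover have "the_inv_into ?S F ` (F ` ?S) = ?S"
      using inj by (force simp: image_image the_inv_into_f_f)
    ultimately show ?thesis by simp
  qed
  then have "negligible (\<Union>(n, c)\<in>UNIV. E n \<inter> J n c)"
    by (intro negligible_countable_Union) auto
  then have "AE t in lebesgue. t \<notin> (\<Union>(n, c)\<in>UNIV. E n \<inter> J n c)"
    unfolding negligible_iff_null_sets by (rule AE_not_in)
  then have "AE t in lborel. t \<notin> (\<Union>(n, c)\<in>UNIV. E n \<inter> J n c)"
    by (simp add: AE_completion_iff)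
  then show ?thesis
  proof (eventually_elim, intro impI allI)
    fix t D assume t: "t \<notin> (\<Union>(n, c)\<in>UNIV. E n \<inter> J n c)" and "F t \<in> N" and D: "(F has_real_derivative D) (at t)"
    have nE: "t \<notin> E n" for n
    proof -
      have "t < t + 1 / (2 * real (Suc n))" by simp
      then obtain c where c: "t < of_rat c" "of_rat c < t + 1 / (2 * real (Suc n))"
        using of_rat_dense by blast
      then have "t \<in> J n c" by (auto simp: J_def)
      then show ?thesis using t by auto
    qed
    show "D = 0"
    proof (rule ccontr)
      assume "D \<noteq> 0"
      then have "0 < \<bar>D\<bar> / 2" by simp
      then have "\<forall>\<^sub>F s in at t. dist ((F s - F t) / (s - t)) D < \<bar>D\<bar> / 2"
        using D unfolding has_field_derivative_iff by (rule tendstoD[rotated])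
      then obtain d where d: "d > 0" "\<And>s. s \<noteq> t \<Longrightarrow> \<bar>s - t\<bar> < d \<Longrightarrow> dist ((F s - F t) / (s - t)) D < \<bar>D\<bar> / 2"
        by (auto simp: eventually_at dist_real_def)
      \<comment> \<open>Half of |D| remains a lower bound for the quotients within distance
        \<open>d\<close> of \<open>t\<close>; \<open>n\<close> has to make both the radius and the
        factor of \<open>E n\<close> fit.\<close>
      have "0 < min d (\<bar>D\<bar> / 2)" using d \<open>D \<noteq> 0\<close> by auto
      then obtain n where n: "1 / Suc n < min d (\<bar>D\<bar> / 2)" using nat_approx_posE by blast
      have "t \<in> E n" unfolding E_def
      proof (intro CollectI conjI allI impI \<open>F t \<in> N\<close>)
        fix s assume s: "\<bar>s - t\<bar> < 1 / Suc n"
        show "\<bar>s - t\<bar> \<le> real (Suc n) * \<bar>F s - F t\<bar>"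
        proof (cases "s = t")
          case False
          have "\<bar>s - t\<bar> < d" using s n by linarith
          then have "dist ((F s - F t) / (s - t)) D < \<bar>D\<bar> / 2" using False d(2) by blast
          then have "\<bar>D\<bar> / 2 < \<bar>(F s - F t) / (s - t)\<bar>" unfolding dist_real_def by linarith
          then have "1 / Suc n < \<bar>(F s - F t) / (s - t)\<bar>" using n by linarith
          then show ?thesis using False by (auto simp: abs_divide field_simps)
        qed simp
      qed
      then show False using nE by blast
    qed
  qed
qed

text \<open>Rademacher's theorem on the line. Clamping the argument to [-n, n] makes \<phi>
  absolutely continuous with the integrable bound \<open>L\<close> times an indicator.\<close>

lemma lipschitz_AE_differentiable:
  fixes \<phi> :: "real \<Rightarrow> real"
  assumes "L-lipschitz_on UNIV \<phi>"
  shows "negligible {x. \<not> \<phi> differentiable (at x)}"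
proof -
  have lip: "\<bar>\<phi> x - \<phi> y\<bar> \<le> L * \<bar>x - y\<bar>" and L: "0 \<le> L" for x y
    using assms by (auto simp: lipschitz_on_def dist_real_def)
  have *: "AE x in lborel. \<bar>x\<bar> < real n \<longrightarrow> \<phi> differentiable (at x)" for n :: nat
  proof -
    let ?c = "\<lambda>x. max (- real n) (min (real n) x)"
    let ?g = "\<lambda>x. L * indicator {- real n..real n} x"
    have "integral_bounded (\<lambda>x. \<phi> (?c x)) ?g"
      unfolding integral_bounded_def
    proof (intro conjI allI impI)
      show "integrable lborel ?g" by simp
      show "0 \<le> ?g x" for x using L by simp
      fix x y :: real assume "x \<le> y"
      let ?I = "{max x (- real n)..min y (real n)}"
      have "indicator {x..y} t *\<^sub>R ?g t = L * indicator ?I t" for t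
        by (auto split: split_indicator)
      then have "(LINT t:{x..y}|lborel. ?g t) = (LINT t|lborel. L * indicator ?I t)"
        unfolding set_lebesgue_integral_def by (rule Bochner_Integration.integral_cong[OF refl])
      also have "\<dots> = L * measure lborel ?I" by simp
      finally have "(LINT t:{x..y}|lborel. ?g t) = L * measure lborel ?I" .
      moreover have "?c y - ?c x \<le> measure lborel ?I"
        using \<open>x \<le> y\<close> by (auto simp: max_def min_def)
      moreover have "\<bar>\<phi> (?c y) - \<phi> (?c x)\<bar> \<le> L * (?c y - ?c x)"
        using lip[of "?c y" "?c x"] \<open>x \<le> y\<close> by (simp add: max_def min_def)
      ultimately show "\<bar>\<phi> (?c y) - \<phi> (?c x)\<bar> \<le> (LINT t:{x..y}|lborel. ?g t)"
        using L by (smt (verit) mult_left_mono)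
    qed
    then obtain f where "AE x in lborel. ((\<lambda>x. \<phi> (?c x)) has_real_derivative f x) (at x)"
      using integral_bounded_derivative by metis
    then show ?thesis
    proof (eventually_elim, intro impI)
      fix x assume d: "((\<lambda>x. \<phi> (?c x)) has_real_derivative f x) (at x)" and x: "\<bar>x\<bar> < real n"
      have "(\<phi> has_real_derivative f x) (at x)"
        using d
      proof (rule has_field_derivative_transform_within_open)
        show "open {- real n<..<real n}" by simp
      qed (use x in \<open>auto simp: max_def min_def\<close>)
      then show "\<phi> differentiable (at x)" using real_differentiable_def by blast
    qed
  qed
  have "AE x in lborel. \<forall>n. \<bar>x\<bar> < real n \<longrightarrow> \<phi> differentiable (at x)"
    using * by (subst AE_all_countable) auto
  then have "AE x in lborel. \<phi> differentiable (at x)"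
    by eventually_elim (use reals_Archimedean2 in blast)
  then have "AE x in lebesgue. \<phi> differentiable (at x)" by (rule AE_completion)
  then obtain N where "{x. \<not> \<phi> differentiable (at x)} \<subseteq> N" "N \<in> null_sets lebesgue"
    by (auto simp: eventually_ae_filter)
  then show ?thesis
    by (meson negligible_iff_null_sets negligible_subset)
qed

section \<open>Metric speed\<close>

definition unit_clamp :: "real \<Rightarrow> real" where
  "unit_clamp t = max 0 (min 1 t)"

text \<open>Curves carry information on [0,1] only. Freezing them at their endpoints gives functions
  on the whole line, to which the results on real functions apply.\<close>

definition eval_clamped :: "(real \<Rightarrow> 'a) \<Rightarrow> real \<Rightarrow> 'a" where
  "eval_clamped \<gamma> t = \<gamma> (unit_clamp t)"

text \<open>A representative of the metric speed that is jointly measurable in the curve and in time.\<close>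

definition lower_speed :: "(real \<Rightarrow> 'a::metric_space) \<Rightarrow> real \<Rightarrow> ennreal" where
  "lower_speed \<gamma> t = liminf (\<lambda>n. ennreal (real (Suc n) *
     dist (eval_clamped \<gamma> (t + 1 / real (Suc n))) (eval_clamped \<gamma> t)))"

lemma unit_clamp_mem [simp]: "unit_clamp t \<in> {0..1}" "0 \<le> unit_clamp t" "unit_clamp t \<le> 1"
  by (auto simp: unit_clamp_def)

lemma unit_clamp_id [simp]: "0 \<le> t \<Longrightarrow> t \<le> 1 \<Longrightarrow> unit_clamp t = t"
  by (simp add: unit_clamp_def)

lemma eval_clamped_id [simp]: "0 \<le> t \<Longrightarrow> t \<le> 1 \<Longrightarrow> eval_clamped \<gamma> t = \<gamma> t"
  by (simp add: eval_clamped_def)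

lemma unit_clamp_mono: "x \<le> y \<Longrightarrow> unit_clamp x \<le> unit_clamp y"
  by (auto simp: unit_clamp_def)

lemma unit_clamp_measurable [measurable]: "unit_clamp \<in> borel_measurable borel"
  unfolding unit_clamp_def[abs_def] by measurable

lemma continuous_on_unit_clamp [continuous_intros]: "continuous_on A unit_clamp"
  unfolding unit_clamp_def[abs_def] by (intro continuous_intros)

text \<open>Passing to \<open>\<bar>f\<bar>\<close> restricted to the unit interval makes a speed bound a global
  integrable non-negative function.\<close>

lemma speed_bound_clamped:
  assumes f: "speed_bound \<gamma> f"
  defines "g \<equiv> (\<lambda>t. indicator {0..1} t * \<bar>f t\<bar>)"
  shows "integrable lborel g" "\<And>t. 0 \<le> g t"
    "\<And>x y. x \<le> y \<Longrightarrow> dist (eval_clamped \<gamma> x) (eval_clamped \<gamma> y) \<le> (LINT t:{x..y}|lborel. g t)"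
proof -
  have i: "set_integrable lborel {0..1} f" using f by (simp add: speed_bound_def)
  then have i': "set_integrable lborel {0..1} (\<lambda>t. \<bar>f t\<bar>)" by (rule set_integrable_abs)
  then show g: "integrable lborel g" by (simp add: g_def set_integrable_def)
  show nn: "0 \<le> g t" for t by (simp add: g_def)
  fix x y :: real assume "x \<le> y"
  let ?x = "unit_clamp x" and ?y = "unit_clamp y"
  show "dist (eval_clamped \<gamma> x) (eval_clamped \<gamma> y) \<le> (LINT t:{x..y}|lborel. g t)"
  proof (cases "?x = ?y")
    case True
    then show ?thesis using nn by (simp add: eval_clamped_def set_lebesgue_integral_def)
  next
    case False
    then have less: "?x < ?y" using unit_clamp_mono[OF \<open>x \<le> y\<close>] by simp
    have "x \<le> ?x" "?y \<le> y"
      using less unfolding unit_clamp_def by linarith+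
    then have sub: "{?x..?y} \<subseteq> {x..y}" "{?x..?y} \<subseteq> {0..1}"
      using unit_clamp_mem(2)[of x] unit_clamp_mem(3)[of y] by (simp_all only: atLeastatMost_subset_iff simp_thms)
    have "dist (eval_clamped \<gamma> x) (eval_clamped \<gamma> y) \<le> (LINT t:{?x..?y}|lborel. f t)"
      using f less unit_clamp_mem(2)[of x] unit_clamp_mem(3)[of y]
      unfolding speed_bound_def eval_clamped_def by blast
    also have "\<dots> \<le> (LINT t:{?x..?y}|lborel. \<bar>f t\<bar>)"
      by (intro set_integral_mono set_integrable_subset[OF i _ sub(2)] set_integrable_subset[OF i' _ sub(2)]) simp_all
    also have "\<dots> = (LINT t:{?x..?y}|lborel. g t)"
    proof (rule set_lebesgue_integral_cong)
      show "\<forall>t. t \<in> {?x..?y} \<longrightarrow> \<bar>f t\<bar> = g t" using sub(2) unfolding g_def by (metis indicator_simps(1) mult_1 subsetD)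
    qed simp
    also have "\<dots> \<le> (LINT t:{x..y}|lborel. g t)"
      unfolding set_lebesgue_integral_def
    proof (intro integral_mono integrable_mult_indicator[OF _ g])
      fix t
      have "indicator {?x..?y} t \<le> (indicator {x..y} t :: real)"
        using subsetD[OF sub(1), of t] by (rule indicator_leI)
      then show "indicator {?x..?y} t *\<^sub>R g t \<le> indicator {x..y} t *\<^sub>R g t"
        using nn[of t] by (simp add: mult_right_mono)
    qed simp_all
    finally show ?thesis .
  qed
qed

text \<open>The difference quotients of the curve are at most those of a primitive of the clamped
  |f|, and these converge at almost every time.\<close>

lemma AE_lower_speed_le:
  assumes f: "speed_bound \<gamma> f"
  shows "AE t in lborel. lower_speed \<gamma> t \<le> ennreal (indicator {0..1} t * \<bar>f t\<bar>)"
proof -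
  define g where "g = (\<lambda>t. indicator {0..1} t * \<bar>f t\<bar>)"
  note g = speed_bound_clamped(1,3)[OF f, folded g_def]
  have g_nn: "0 \<le> g t" for t by (simp add: g_def)
  obtain P where Pc: "\<And>x. isCont P x" and Pmono: "\<And>x y. x \<le> y \<Longrightarrow> P x \<le> P y"
    and P: "\<And>x y. x \<le> y \<Longrightarrow> P y - P x = (LINT t:{x..y}|lborel. g t)"
    by (rule integral_primitive[OF g(1) g_nn]) (rule that)
  have "AE t in lborel. (P has_real_derivative g t) (at t)"
    by (rule Lebesgue_differentiation[OF g(1) P])
  then show ?thesis
  proof eventually_elim
    fix t assume D: "(P has_real_derivative g t) (at t)"
    have "filterlim (\<lambda>n. 1 / real (Suc n)) (at 0) sequentially"
      using LIMSEQ_inverse_real_of_nat by (simp add: filterlim_at inverse_eq_divide)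
    then have "(\<lambda>n. (P (t + 1 / real (Suc n)) - P t) / (1 / real (Suc n))) \<longlonglongrightarrow> g t"
      using D unfolding DERIV_def by (rule filterlim_compose[rotated])
    then have lim: "(\<lambda>n. ennreal ((P (t + 1 / real (Suc n)) - P t) / (1 / real (Suc n)))) \<longlonglongrightarrow> ennreal (g t)"
      by (rule tendsto_ennrealI)
    have "lower_speed \<gamma> t \<le> liminf (\<lambda>n. ennreal ((P (t + 1 / real (Suc n)) - P t) / (1 / real (Suc n))))"
      unfolding lower_speed_def
    proof (intro Liminf_mono always_eventually allI ennreal_leI)
      fix n
      have "dist (eval_clamped \<gamma> (t + 1 / real (Suc n))) (eval_clamped \<gamma> t) \<le> P (t + 1 / real (Suc n)) - P t"
        using g(2)[of t "t + 1 / real (Suc n)"] P[of t "t + 1 / real (Suc n)"] by (simp add: dist_commute)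
      from mult_left_mono[OF this, of "real (Suc n)"]
      show "real (Suc n) * dist (eval_clamped \<gamma> (t + 1 / real (Suc n))) (eval_clamped \<gamma> t)
        \<le> (P (t + 1 / real (Suc n)) - P t) / (1 / real (Suc n))" by (simp add: mult.commute)
    qed
    also have "\<dots> = ennreal (g t)" using lim_imp_Liminf[OF _ lim] by simp
    finally show "lower_speed \<gamma> t \<le> ennreal (indicator {0..1} t * \<bar>f t\<bar>)" by (simp add: g_def)
  qed
qed

text \<open>A single real function suffices: the distance to the point \<gamma> s is absolutely
  continuous along the curve, vanishes at time \<open>s\<close>, and has derivative at most
  \<open>lower_speed\<close> in absolute value wherever it is differentiable.\<close>

lemma dist_le_lower_speed:
  assumes f: "speed_bound \<gamma> f" and ts: "t \<le> s" "0 \<le> t" "s \<le> 1"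
  shows "ennreal (dist (\<gamma> t) (\<gamma> s)) \<le> (\<integral>\<^sup>+r\<in>{t..s}. lower_speed \<gamma> r \<partial>lborel)"
proof -
  define g where "g = (\<lambda>t. indicator {0..1} t * \<bar>f t\<bar>)"
  note g = speed_bound_clamped(1,3)[OF f, folded g_def]
  have g_nn: "0 \<le> g t" for t by (simp add: g_def)
  define H where "H r = dist (eval_clamped \<gamma> r) (\<gamma> s)" for r
  have Hle: "\<bar>H y - H x\<bar> \<le> dist (eval_clamped \<gamma> y) (eval_clamped \<gamma> x)" for x y
    unfolding H_def by (smt (verit) dist_triangle dist_commute)
  have "integral_bounded H g"
    unfolding integral_bounded_def using g g_nn Hle by (fastforce simp: dist_commute intro: order_trans)
  then have "ennreal \<bar>H s - H t\<bar> \<le> (\<integral>\<^sup>+r\<in>{t..s}. lower_speed \<gamma> r \<partial>lborel)"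
  proof (rule integral_bounded_le_nn_integral[OF _ ts(1)])
    have *: "ennreal \<bar>D\<bar> \<le> lower_speed \<gamma> r" if D: "(H has_real_derivative D) (at r)" for r D
    proof -
      have "filterlim (\<lambda>n. 1 / real (Suc n)) (at 0) sequentially"
        using LIMSEQ_inverse_real_of_nat by (simp add: filterlim_at inverse_eq_divide)
      then have "(\<lambda>n. (H (r + 1 / real (Suc n)) - H r) / (1 / real (Suc n))) \<longlonglongrightarrow> D"
        using D unfolding DERIV_def by (rule filterlim_compose[rotated])
      then have lim: "(\<lambda>n. ennreal \<bar>(H (r + 1 / real (Suc n)) - H r) / (1 / real (Suc n))\<bar>) \<longlonglongrightarrow> ennreal \<bar>D\<bar>"
        by (intro tendsto_ennrealI tendsto_rabs)
      have "ennreal \<bar>D\<bar> = liminf (\<lambda>n. ennreal \<bar>(H (r + 1 / real (Suc n)) - H r) / (1 / real (Suc n))\<bar>)"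
        using lim_imp_Liminf[OF _ lim] by simp
      also have "\<dots> \<le> lower_speed \<gamma> r"
        unfolding lower_speed_def
      proof (intro Liminf_mono always_eventually allI ennreal_leI)
        fix n
        show "\<bar>(H (r + 1 / real (Suc n)) - H r) / (1 / real (Suc n))\<bar> \<le>
          real (Suc n) * dist (eval_clamped \<gamma> (r + 1 / real (Suc n))) (eval_clamped \<gamma> r)"
          using mult_left_mono[OF Hle[of "r + 1 / real (Suc n)" r], of "real (Suc n)"]
          by (simp add: abs_mult mult.commute)
      qed
      finally show ?thesis .
    qed
    then show "AE r in lborel. r \<in> {t..s} \<longrightarrow> (\<forall>D. (H has_real_derivative D) (at r) \<longrightarrow> ennreal \<bar>D\<bar> \<le> lower_speed \<gamma> r)"
      by blast
  qed
  then show ?thesis using ts by (simp add: H_def)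
qed

lemma speed_bound_continuous:
  assumes f: "speed_bound \<gamma> f"
  shows "isCont (eval_clamped \<gamma>) t"
proof -
  define g where "g = (\<lambda>t. indicator {0..1} t * \<bar>f t\<bar>)"
  note g = speed_bound_clamped(1,3)[OF f, folded g_def]
  have g_nn: "0 \<le> g t" for t by (simp add: g_def)
  obtain P where Pc: "\<And>x. isCont P x" and Pmono: "\<And>x y. x \<le> y \<Longrightarrow> P x \<le> P y"
    and P: "\<And>x y. x \<le> y \<Longrightarrow> P y - P x = (LINT t:{x..y}|lborel. g t)"
    by (rule integral_primitive[OF g(1) g_nn]) (rule that)
  have le: "dist (eval_clamped \<gamma> s) (eval_clamped \<gamma> t) \<le> \<bar>P s - P t\<bar>" for s
    using g(2)[of s t] g(2)[of t s] P[of s t] P[of t s] by (cases "s \<le> t") (auto simp: dist_commute)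
  have "((\<lambda>s. P s - P t) \<longlongrightarrow> 0) (at t)" using Pc[of t] unfolding isCont_def by (rule LIM_zero)
  then have "((\<lambda>s. \<bar>P s - P t\<bar>) \<longlongrightarrow> 0) (at t)" by (rule tendsto_rabs_zero)
  then have "((\<lambda>s. dist (eval_clamped \<gamma> s) (eval_clamped \<gamma> t)) \<longlongrightarrow> 0) (at t)"
    by (rule Lim_null_comparison[rotated]) (simp add: le)
  then show ?thesis unfolding isCont_def by (rule tendsto_dist_iff[THEN iffD2])
qed

lemma lower_speed_measurable_continuous:
  fixes \<gamma> :: "real \<Rightarrow> 'a::{metric_space, second_countable_topology}"
  assumes "continuous_on UNIV (eval_clamped \<gamma>)"
  shows "lower_speed \<gamma> \<in> borel_measurable borel"
proof -
  have [measurable]: "eval_clamped \<gamma> \<in> borel_measurable borel"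
    using assms by (rule borel_measurable_continuous_onI)
  show ?thesis unfolding lower_speed_def[abs_def] by measurable
qed

text \<open>Existence of the metric derivative: \<open>lower_speed\<close> is itself a speed bound,
  and a minimal one. The choice in \<open>metric_speed\<close> is thus made from a nonempty set, and
  minimality on both sides identifies the two almost everywhere on [0,1].\<close>

lemma abs_cont_lower_speed:
  fixes \<gamma> :: "real \<Rightarrow> 'a::{metric_space, second_countable_topology}"
  assumes "abs_cont_curve \<gamma>"
  shows "lower_speed \<gamma> \<in> borel_measurable borel"
    and "(\<integral>\<^sup>+r\<in>{0..1}. lower_speed \<gamma> r \<partial>lborel) < \<infinity>"
    and "AE t in lborel. lower_speed \<gamma> t < \<infinity>"
    and "speed_bound \<gamma> (\<lambda>t. enn2real (lower_speed \<gamma> t))"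
    and "\<And>g. speed_bound \<gamma> g \<Longrightarrow> AE t in lborel. t \<in> {0..1} \<longrightarrow> enn2real (lower_speed \<gamma> t) \<le> g t"
    and "AE t in lborel. t \<in> {0..1} \<longrightarrow> ennreal (metric_speed \<gamma> t) = lower_speed \<gamma> t"
    and "AE t in lborel. t \<in> {0..1} \<longrightarrow> 0 \<le> metric_speed \<gamma> t"
proof -
  obtain f where f: "speed_bound \<gamma> f" using assms by (auto simp: abs_cont_curve_def)
  define g where "g = (\<lambda>t. indicator {0..1} t * \<bar>f t\<bar>)"
  note g = speed_bound_clamped(1,3)[OF f, folded g_def]
  have g_nn: "0 \<le> g t" for t by (simp add: g_def)
  note le = AE_lower_speed_le[OF f, folded g_def]
  show [measurable]: "lower_speed \<gamma> \<in> borel_measurable borel"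
    using speed_bound_continuous[OF f]
    by (intro lower_speed_measurable_continuous continuous_at_imp_continuous_on) auto
  show fin: "AE t in lborel. lower_speed \<gamma> t < \<infinity>"
    using le by eventually_elim (simp add: le_less_trans[OF _ ennreal_less_top])
  let ?w = "\<lambda>t. enn2real (lower_speed \<gamma> t)"
  have wfin: "AE t in lborel. ennreal (?w t) = lower_speed \<gamma> t"
    using fin by eventually_elim simp
  have "(\<integral>\<^sup>+r. lower_speed \<gamma> r \<partial>lborel) \<le> (\<integral>\<^sup>+r. ennreal (g r) \<partial>lborel)"
    using le by (intro nn_integral_mono_AE) (auto simp: g_def)
  also have "\<dots> < \<infinity>" using g(1) g_nn by (simp add: integrable_iff_bounded)
  finally have int: "(\<integral>\<^sup>+r. lower_speed \<gamma> r \<partial>lborel) < \<infinity>" .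
  show "(\<integral>\<^sup>+r\<in>{0..1}. lower_speed \<gamma> r \<partial>lborel) < \<infinity>"
    by (rule le_less_trans[OF _ int], rule nn_integral_mono) (auto split: split_indicator)
  have iw: "integrable lborel ?w"
  proof (rule integrableI_nonneg)
    have "(\<integral>\<^sup>+r. ennreal (?w r) \<partial>lborel) = (\<integral>\<^sup>+r. lower_speed \<gamma> r \<partial>lborel)"
      using wfin by (rule nn_integral_cong_AE)
    then show "(\<integral>\<^sup>+r. ennreal (?w r) \<partial>lborel) < \<infinity>" using int by simp
  qed auto
  show sb: "speed_bound \<gamma> ?w"
    unfolding speed_bound_def
  proof (intro conjI allI impI)
    show "set_integrable lborel {0..1} ?w"
      using integrable_mult_indicator[OF _ iw, of "{0..1}"] by (simp add: set_integrable_def)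
    fix t s :: real assume ts: "0 \<le> t \<and> t < s \<and> s \<le> 1"
    have "ennreal (dist (\<gamma> t) (\<gamma> s)) \<le> (\<integral>\<^sup>+r\<in>{t..s}. lower_speed \<gamma> r \<partial>lborel)"
      using ts by (intro dist_le_lower_speed[OF f]) auto
    also have "\<dots> = (\<integral>\<^sup>+r\<in>{t..s}. ennreal (?w r) \<partial>lborel)"
      using wfin by (intro nn_integral_cong_AE, eventually_elim) auto
    also have "\<dots> = ennreal (LINT r:{t..s}|lborel. ?w r)"
      by (intro nn_integral_Icc_eq iw) auto
    finally show "dist (\<gamma> t) (\<gamma> s) \<le> (LINT r:{t..s}|lborel. ?w r)"
      by (subst (asm) ennreal_le_iff) (auto simp: set_lebesgue_integral_def)
  qed
  show min: "AE t in lborel. t \<in> {0..1} \<longrightarrow> ?w t \<le> h t" if h: "speed_bound \<gamma> h" for h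
  proof -
    \<comment> \<open>\<open>AE_lower_speed_le\<close> bounds by |h| only. The integrals of
      \<open>h\<close> over subintervals dominate distances and so are nonnegative; differentiating
      them gives the sign of \<open>h\<close> almost everywhere.\<close>
    have h_nn: "AE t in lborel. t \<in> {0..1} \<longrightarrow> 0 \<le> h t"
    proof -
      define k where "k = (\<lambda>t. indicator {0..1} t * h t)"
      have k: "integrable lborel k" using h by (simp add: k_def speed_bound_def set_integrable_def)
      define P where "P = (\<lambda>s. LINT t:{..s}|lborel. k t)"
      have P: "P y - P x = (LINT t:{x..y}|lborel. k t)" if "x \<le> y" for x y
        using set_integral_atMost_diff(1)[OF k that] by (simp add: P_def)
      have mono: "P x \<le> P y" if "0 \<le> x" "x < y" "y \<le> 1" for x y
      proof -
        have "0 \<le> dist (\<gamma> x) (\<gamma> y)" by simp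
        also have "\<dots> \<le> (LINT t:{x..y}|lborel. h t)" using h that by (auto simp: speed_bound_def)
        also have "\<dots> = (LINT t:{x..y}|lborel. k t)"
          using that by (intro set_lebesgue_integral_cong) (auto simp: k_def)
        finally show ?thesis using P[of x y] that by simp
      qed
      have "AE t in lborel. (P has_real_derivative k t) (at t)"
        by (rule Lebesgue_differentiation[OF k P])
      moreover have "AE t in lborel. t \<noteq> (1::real)" by (rule AE_lborel_singleton)
      ultimately show ?thesis
      proof (eventually_elim, intro impI)
        fix t :: real assume D: "(P has_real_derivative k t) (at t)" and t: "t \<noteq> 1" "t \<in> {0..1}"
        have "((\<lambda>y. (P y - P t) / (y - t)) \<longlongrightarrow> k t) (at_right t)"
          using D by (auto simp: has_field_derivative_iff intro: tendsto_mono[OF at_le])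
        moreover have "\<forall>\<^sub>F y in at_right t. 0 \<le> (P y - P t) / (y - t)"
          using mono[of t] t by (auto simp: eventually_at_right[of t 1] intro!: exI[of _ 1])
        ultimately have "0 \<le> k t" by (intro tendsto_lowerbound[of _ _ "at_right t"]) auto
        then show "0 \<le> h t" using t by (simp add: k_def)
      qed
    qed
    show ?thesis using AE_lower_speed_le[OF h] h_nn
    proof (eventually_elim, intro impI)
      fix t :: real assume "lower_speed \<gamma> t \<le> ennreal (indicator {0..1} t * \<bar>h t\<bar>)" "t \<in> {0..1} \<longrightarrow> 0 \<le> h t" "t \<in> {0..1}"
      then show "?w t \<le> h t" by (auto intro: enn2real_leI)
    qed
  qed
  define Q where "Q f \<longleftrightarrow> speed_bound \<gamma> f \<and>
    (\<forall>g. speed_bound \<gamma> g \<longrightarrow> (AE t in lborel. t \<in> {0..1} \<longrightarrow> f t \<le> g t))" for f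
  have "Q ?w" unfolding Q_def using sb min by simp
  then have "Q (metric_speed \<gamma>)"
    unfolding metric_speed_def Q_def[symmetric] by (rule someI[of Q])
  then have ms: "speed_bound \<gamma> (metric_speed \<gamma>)"
    "\<And>g. speed_bound \<gamma> g \<Longrightarrow> (AE t in lborel. t \<in> {0..1} \<longrightarrow> metric_speed \<gamma> t \<le> g t)"
    unfolding Q_def by simp_all
  have eq: "AE t in lborel. t \<in> {0..1} \<longrightarrow> metric_speed \<gamma> t = ?w t"
    using ms(2)[OF sb] min[OF ms(1)] by eventually_elim auto
  show "AE t in lborel. t \<in> {0..1} \<longrightarrow> ennreal (metric_speed \<gamma> t) = lower_speed \<gamma> t"
    using eq wfin by eventually_elim metis
  show "AE t in lborel. t \<in> {0..1} \<longrightarrow> 0 \<le> metric_speed \<gamma> t"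
    using eq by eventually_elim simp
qed

section \<open>The space of curves and its test plans\<close>

lemma mspace_curves:
  "mspace (curves :: (real \<Rightarrow> 'a::metric_space) metric) = {\<gamma>. continuous_on {0..1} \<gamma> \<and> \<gamma> \<in> extensional {0..1}}"
proof -
  have "compactin (top_of_set {0..1::real}) (topspace (top_of_set {0..1}))"
    by (simp add: compactin_subtopology)
  then show ?thesis
    unfolding curves_def by (subst compactin_mspace_cfunspace) auto
qed

lemma opens_curves_subset: "{U. openin (mtopology_of curves) U} \<subseteq> Pow (mspace curves)"
  using openin_subset by fastforce

lemma space_curves_borel [simp]: "space curves_borel = mspace curves"
  unfolding curves_borel_def by (rule space_measure_of[OF opens_curves_subset])

lemma sets_curves_borelI: "openin (mtopology_of curves) U \<Longrightarrow> U \<in> sets curves_borel"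
  unfolding curves_borel_def by (simp add: sets_measure_of[OF opens_curves_subset] sigma_sets.Basic)

lemma dist_le_mdist_curves:
  assumes "\<gamma> \<in> mspace curves" "\<eta> \<in> mspace curves" "t \<in> {0..1}"
  shows "dist (\<gamma> t) (\<eta> t) \<le> mdist curves \<gamma> \<eta>"
  using mdist_cfunspace_imp_mdist_le[of \<gamma> "top_of_set {0..1}" euclidean_metric \<eta> "mdist curves \<gamma> \<eta>" t] assms
  by (simp add: curves_def)

lemma measurable_curves_borelI:
  fixes f :: "(real \<Rightarrow> 'a::metric_space) \<Rightarrow> real \<Rightarrow> 'a"
  assumes f: "continuous_map (mtopology_of curves) (mtopology_of curves) f"
  shows "f \<in> curves_borel \<rightarrow>\<^sub>M curves_borel"
proof -
  have "f \<in> curves_borel \<rightarrow>\<^sub>M sigma (mspace curves) {U. openin (mtopology_of curves) U}"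
  proof (rule measurable_measure_of[OF opens_curves_subset])
    show "f \<in> space curves_borel \<rightarrow> mspace curves"
      using f continuous_map_funspace by fastforce
    fix U :: "(real \<Rightarrow> 'a) set" assume "U \<in> {U. openin (mtopology_of curves) U}"
    then have "openin (mtopology_of curves) {x \<in> topspace (mtopology_of curves). f x \<in> U}"
      using f by (auto simp: continuous_map_def)
    then show "f -` U \<inter> space curves_borel \<in> sets curves_borel"
      by (auto simp: vimage_def Int_def conj_commute dest: sets_curves_borelI)
  qed
  then show ?thesis by (simp add: curves_borel_def)
qed

lemma measurable_eval_curves [measurable]:
  fixes t :: real
  shows "(\<lambda>\<gamma>::real \<Rightarrow> 'a::metric_space. eval_clamped \<gamma> t) \<in> borel_measurable curves_borel"
proof (rule borel_measurableI)
  fix S :: "'a set" assume "open S"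
  have "Lipschitz_continuous_map curves euclidean_metric (\<lambda>\<gamma>::real \<Rightarrow> 'a. eval_clamped \<gamma> t)"
    unfolding Lipschitz_continuous_map_def eval_clamped_def
    by (auto intro!: exI[of _ 1] dist_le_mdist_curves)
  then have "continuous_map (mtopology_of curves) euclidean (\<lambda>\<gamma>::real \<Rightarrow> 'a. eval_clamped \<gamma> t)"
    by (metis Lipschitz_continuous_imp_continuous_map mtopology_of_euclidean)
  then have "openin (mtopology_of curves) {\<gamma> \<in> mspace curves. eval_clamped \<gamma> t \<in> S}"
    using \<open>open S\<close> by (auto simp: continuous_map_def)
  then have "{\<gamma> \<in> mspace curves. eval_clamped \<gamma> t \<in> S} \<in> sets curves_borel"
    by (rule sets_curves_borelI)
  then show "(\<lambda>\<gamma>. eval_clamped \<gamma> t) -` S \<inter> space curves_borel \<in> sets curves_borel"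
    by (simp add: vimage_def Int_def conj_commute)
qed

lemma measurable_eval_curves':
  assumes "t \<in> {0..1}"
  shows "(\<lambda>\<gamma>::real \<Rightarrow> 'a::metric_space. \<gamma> t) \<in> borel_measurable curves_borel"
  using measurable_eval_curves[of t] assms by (simp add: eval_clamped_def[abs_def])

lemma continuous_on_eval_clamped:
  assumes "\<gamma> \<in> mspace curves"
  shows "continuous_on UNIV (eval_clamped \<gamma>)"
  unfolding eval_clamped_def
  by (rule continuous_on_compose2[of "{0..1}" \<gamma>])
     (use assms in \<open>auto simp: mspace_curves intro!: continuous_intros\<close>)

text \<open>Rounding the time down to a multiple of \<open>1 / Suc n\<close> leaves countably many
  evaluations, each measurable in the curve; continuity of the curve gives the limit.\<close>

lemma measurable_eval_curves_pair [measurable]: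
  "(\<lambda>p. eval_clamped (fst p) (snd p) :: 'a::metric_space) \<in> borel_measurable (curves_borel \<Otimes>\<^sub>M borel)"
proof (rule borel_measurable_LIMSEQ_metric)
  define q :: "nat \<Rightarrow> real \<Rightarrow> real" where "q n t = of_int \<lfloor>real (Suc n) * t\<rfloor> / real (Suc n)" for n t
  show "(\<lambda>p. eval_clamped (fst p) (q n (snd p)) :: 'a) \<in> borel_measurable (curves_borel \<Otimes>\<^sub>M borel)" for n
  proof -
    have "(\<lambda>p. eval_clamped (fst p) (of_int i / real (Suc n)) :: 'a) \<in> borel_measurable (curves_borel \<Otimes>\<^sub>M borel)" for i
      by measurable
    moreover have "(\<lambda>p::(real \<Rightarrow> 'a) \<times> real. \<lfloor>real (Suc n) * snd p\<rfloor>) \<in> (curves_borel \<Otimes>\<^sub>M borel) \<rightarrow>\<^sub>M count_space UNIV"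
      by measurable
    ultimately show ?thesis
      unfolding q_def by (rule measurable_compose_countable)
  qed
  fix p :: "(real \<Rightarrow> 'a) \<times> real" assume "p \<in> space (curves_borel \<Otimes>\<^sub>M borel)"
  then have "fst p \<in> mspace curves" by (auto simp: space_pair_measure)
  have "(\<lambda>n. q n t) \<longlonglongrightarrow> t" for t
  proof (rule real_tendsto_sandwich)
    have "t - 1 / real (Suc n) \<le> q n t \<and> q n t \<le> t" for n
    proof -
      have "real (Suc n) * t - 1 \<le> of_int \<lfloor>real (Suc n) * t\<rfloor>" "of_int \<lfloor>real (Suc n) * t\<rfloor> \<le> real (Suc n) * t" by linarith+
      from divide_right_mono[OF this(1), of "real (Suc n)"] divide_right_mono[OF this(2), of "real (Suc n)"]
      show ?thesis by (simp add: q_def diff_divide_distrib del: of_nat_Suc)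
    qed
    then show "\<forall>\<^sub>F n in sequentially. t - 1 / real (Suc n) \<le> q n t" "\<forall>\<^sub>F n in sequentially. q n t \<le> t" by auto
    have "(\<lambda>n. t - 1 / real (Suc n)) \<longlonglongrightarrow> t - 0"
      by (intro tendsto_intros) (rule LIMSEQ_inverse_real_of_nat[unfolded inverse_eq_divide])
    then show "(\<lambda>n. t - 1 / real (Suc n)) \<longlonglongrightarrow> t" by simp
  qed simp
  then show "(\<lambda>n. eval_clamped (fst p) (q n (snd p))) \<longlonglongrightarrow> eval_clamped (fst p) (snd p)"
    using continuous_on_eval_clamped[OF \<open>fst p \<in> mspace curves\<close>]
    by (intro continuous_on_tendsto_compose[of UNIV "eval_clamped (fst p)"]) auto
qed

lemma measurable_lower_speed [measurable]:
  "(\<lambda>p. lower_speed (fst p) (snd p)) \<in>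
     borel_measurable (curves_borel \<Otimes>\<^sub>M borel :: ((real \<Rightarrow> 'a::{metric_space, second_countable_topology}) \<times> real) measure)"
proof -
  have [measurable]: "(\<lambda>p. eval_clamped (fst p) (snd p + c) :: 'a) \<in> borel_measurable (curves_borel \<Otimes>\<^sub>M borel)" for c :: real
  proof -
    have "(\<lambda>p::(real \<Rightarrow> 'a) \<times> real. (fst p, snd p + c)) \<in> curves_borel \<Otimes>\<^sub>M borel \<rightarrow>\<^sub>M curves_borel \<Otimes>\<^sub>M borel"
      by measurable
    from measurable_compose[OF this measurable_eval_curves_pair] show ?thesis by simp
  qed
  show ?thesis unfolding lower_speed_def by measurable
qed

lemma measurable_nn_integral_lower_speed [measurable]:
  fixes F :: "ennreal \<Rightarrow> ennreal" and A :: "real set"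
  assumes [measurable]: "F \<in> borel_measurable borel" "A \<in> sets borel"
  shows "(\<lambda>\<gamma>::real \<Rightarrow> 'a::{metric_space, second_countable_topology}.
     \<integral>\<^sup>+t\<in>A. F (lower_speed \<gamma> t) \<partial>lborel) \<in> borel_measurable curves_borel"
proof -
  have "(\<lambda>(\<gamma>, t). F (lower_speed \<gamma> t) * indicator A t) \<in>
    borel_measurable (curves_borel \<Otimes>\<^sub>M lborel :: ((real \<Rightarrow> 'a) \<times> real) measure)"
    unfolding split_beta' by measurable
  then show ?thesis by (rule lborel.borel_measurable_nn_integral)
qed

text \<open>The right-hand side consists of countably many conditions on integrals of
  \<open>lower_speed\<close>, which makes absolute continuity a measurable property of the curve.
  For the converse, the distance and the primitive of the speed are continuous in both times, so the
  bound extends from rational times, one variable after the other.\<close>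

lemma abs_cont_curve_iff:
  fixes \<gamma> :: "real \<Rightarrow> 'a::{metric_space, second_countable_topology}"
  assumes \<gamma>: "\<gamma> \<in> mspace curves"
  shows "abs_cont_curve \<gamma> \<longleftrightarrow> (\<integral>\<^sup>+t\<in>{0..1}. lower_speed \<gamma> t \<partial>lborel) < \<infinity> \<and>
    (\<forall>x\<in>\<rat>. \<forall>y\<in>\<rat>. 0 \<le> x \<and> x \<le> y \<and> y \<le> 1 \<longrightarrow>
      ennreal (dist (eval_clamped \<gamma> x) (eval_clamped \<gamma> y)) \<le> (\<integral>\<^sup>+t\<in>{x..y}. lower_speed \<gamma> t \<partial>lborel))"
    (is "_ \<longleftrightarrow> ?fin \<and> ?bd")
proof
  assume ac: "abs_cont_curve \<gamma>"
  then obtain f where f: "speed_bound \<gamma> f" by (auto simp: abs_cont_curve_def)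
  show "?fin \<and> ?bd"
    using abs_cont_lower_speed(2)[OF ac] dist_le_lower_speed[OF f] by simp
next
  assume *: "?fin \<and> ?bd"
  have [measurable]: "lower_speed \<gamma> \<in> borel_measurable borel"
    using continuous_on_eval_clamped[OF \<gamma>] by (rule lower_speed_measurable_continuous)
  define g where "g t = indicator {0..1} t * enn2real (lower_speed \<gamma> t)" for t
  have [measurable]: "g \<in> borel_measurable borel" unfolding g_def[abs_def] by measurable
  have fin: "AE t in lborel. lower_speed \<gamma> t * indicator {0..1} t \<noteq> \<infinity>"
    using * by (intro nn_integral_PInf_AE) auto
  then have gae: "AE t in lborel. ennreal (g t) = lower_speed \<gamma> t * indicator {0..1} t"
    by eventually_elim (auto simp: g_def less_top split: split_indicator)
  have nn: "0 \<le> g t" for t by (simp add: g_def)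
  have g: "integrable lborel g"
  proof (rule integrableI_nonneg)
    have "(\<integral>\<^sup>+t. ennreal (g t) \<partial>lborel) = (\<integral>\<^sup>+t\<in>{0..1}. lower_speed \<gamma> t \<partial>lborel)"
      using gae by (rule nn_integral_cong_AE)
    then show "(\<integral>\<^sup>+t. ennreal (g t) \<partial>lborel) < \<infinity>" using * by simp
  qed (use nn in auto)
  obtain P where Pc: "\<And>x. isCont P x" and Pmono: "\<And>x y. x \<le> y \<Longrightarrow> P x \<le> P y"
    and P: "\<And>x y. x \<le> y \<Longrightarrow> P y - P x = (LINT t:{x..y}|lborel. g t)"
    by (rule integral_primitive[OF g nn]) (rule that)
  have rat: "dist (eval_clamped \<gamma> x) (eval_clamped \<gamma> y) \<le> P y - P x"
    if "x \<in> \<rat>" "y \<in> \<rat>" "0 \<le> x" "x \<le> y" "y \<le> 1" for x y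
  proof -
    have "ennreal (dist (eval_clamped \<gamma> x) (eval_clamped \<gamma> y)) \<le> (\<integral>\<^sup>+t\<in>{x..y}. lower_speed \<gamma> t \<partial>lborel)"
      using *[THEN conjunct2, rule_format, OF \<open>x \<in> \<rat>\<close> \<open>y \<in> \<rat>\<close>] that by simp
    also have "\<dots> = (\<integral>\<^sup>+t\<in>{x..y}. ennreal (g t) \<partial>lborel)"
      using gae by (intro nn_integral_cong_AE, eventually_elim) (use that in \<open>auto split: split_indicator\<close>)
    also have "\<dots> = ennreal (P y - P x)"
      using nn_integral_Icc_eq[OF g nn] P[OF \<open>x \<le> y\<close>] by simp
    finally show ?thesis
      using nn P[OF \<open>x \<le> y\<close>] by (subst (asm) ennreal_le_iff) (auto simp: set_lebesgue_integral_def)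
  qed
  have rat': "dist (eval_clamped \<gamma> x) (eval_clamped \<gamma> y) \<le> \<bar>P y - P x\<bar>"
    if "x \<in> \<rat> \<inter> {0..1}" "y \<in> \<rat> \<inter> {0..1}" for x y
    using rat[of x y] rat[of y x] that by (cases "x \<le> y") (auto simp: dist_commute)
  \<comment> \<open>Density of the rationals passes to open sets, hence the open interval; its
    closure contains the endpoints again.\<close>
  have cl: "closure (\<rat> \<inter> {0<..<1}) = {0..1::real}"
    using closure_open_Int_superset[of "{0<..<1::real}" \<rat>] by (simp add: Rats_closure_real Int_commute)
  have cont: "continuous_on A (\<lambda>x. dist (eval_clamped \<gamma> x) (eval_clamped \<gamma> y) - \<bar>P y - P x\<bar>)" for A y
    using continuous_on_subset[OF continuous_on_eval_clamped[OF \<gamma>]] continuous_at_imp_continuous_on[of A P] Pc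
    by (intro continuous_intros) auto
  have 1: "dist (eval_clamped \<gamma> x) (eval_clamped \<gamma> y) - \<bar>P y - P x\<bar> \<le> 0"
    if "x \<in> {0..1}" "y \<in> \<rat> \<inter> {0..1}" for x y
    by (rule continuous_le_on_closure[OF cont, where S = "\<rat> \<inter> {0<..<1}"])
       (use that rat'[of _ y] in \<open>auto simp: cl\<close>)
  have 2: "dist (eval_clamped \<gamma> x) (eval_clamped \<gamma> y) - \<bar>P y - P x\<bar> \<le> 0"
    if "x \<in> {0..1}" "y \<in> {0..1}" for x y
    by (rule continuous_le_on_closure[OF cont, where S = "\<rat> \<inter> {0<..<1}"])
       (use that 1[of y] in \<open>auto simp: cl dist_commute abs_minus_commute\<close>)
  have "speed_bound \<gamma> g" unfolding speed_bound_def
  proof (intro conjI allI impI)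
    show "set_integrable lborel {0..1} g"
      using integrable_mult_indicator[OF _ g, of "{0..1}"] by (simp add: set_integrable_def)
    fix t s :: real assume "0 \<le> t \<and> t < s \<and> s \<le> 1"
    then show "dist (\<gamma> t) (\<gamma> s) \<le> (LINT r:{t..s}|lborel. g r)"
      using 2[of t s] P[of t s] nn by (simp add: set_lebesgue_integral_def)
  qed
  then show "abs_cont_curve \<gamma>" by (auto simp: abs_cont_curve_def)
qed

text \<open>Trades the speed chosen separately for each curve for one that is measurable in the
  curve; measurability of the energy follows from this.\<close>

lemma kinetic_energy_eq:
  fixes \<gamma> :: "real \<Rightarrow> 'a::{metric_space, second_countable_topology}"
  assumes ac: "abs_cont_curve \<gamma>"
  shows "kinetic_energy \<gamma> = (\<integral>\<^sup>+t\<in>{0..1}. (lower_speed \<gamma> t)\<^sup>2 \<partial>lborel)"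
proof -
  have "(\<integral>\<^sup>+t\<in>{0..1}. ennreal ((metric_speed \<gamma> t)\<^sup>2) \<partial>lborel) = (\<integral>\<^sup>+t\<in>{0..1}. (lower_speed \<gamma> t)\<^sup>2 \<partial>lborel)"
    using abs_cont_lower_speed(6,7)[OF ac]
    by (intro nn_integral_cong_AE, eventually_elim) (auto simp: ennreal_power[symmetric] split: split_indicator)
  then show ?thesis using ac by (simp add: kinetic_energy_def)
qed

lemma measurable_abs_cont_curve [measurable]:
  "Measurable.pred curves_borel (abs_cont_curve :: (real \<Rightarrow> 'a::{metric_space, second_countable_topology}) \<Rightarrow> bool)"
proof -
  have int: "(\<lambda>\<gamma>::real \<Rightarrow> 'a. \<integral>\<^sup>+t\<in>A. lower_speed \<gamma> t \<partial>lborel) \<in> borel_measurable curves_borel"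
    if "A \<in> sets borel" for A
    using measurable_nn_integral_lower_speed[OF measurable_ident[of borel] that] by (simp only: id_apply)
  have le: "Measurable.pred M (\<lambda>x. f x \<le> g x)" "Measurable.pred M (\<lambda>x. f x < c)"
    if "f \<in> borel_measurable M" "g \<in> borel_measurable M"
    for f g :: "(real \<Rightarrow> 'a) \<Rightarrow> ennreal" and c M
  proof -
    show "Measurable.pred M (\<lambda>x. f x \<le> g x)"
      unfolding pred_def by (rule borel_measurable_le[OF that])
    show "Measurable.pred M (\<lambda>x. f x < c)"
      unfolding pred_def by (rule borel_measurable_less[OF that(1)]) simp
  qed
  have bd: "Measurable.pred curves_borel (\<lambda>\<gamma>::real \<Rightarrow> 'a. 0 \<le> x \<and> x \<le> y \<and> y \<le> 1 \<longrightarrow>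
      ennreal (dist (eval_clamped \<gamma> x) (eval_clamped \<gamma> y)) \<le> (\<integral>\<^sup>+t\<in>{x..y}. lower_speed \<gamma> t \<partial>lborel))" for x y
  proof -
    have "(\<lambda>\<gamma>::real \<Rightarrow> 'a. ennreal (dist (eval_clamped \<gamma> x) (eval_clamped \<gamma> y))) \<in> borel_measurable curves_borel"
      by measurable
    then show ?thesis by (intro pred_intros_imp' le(1) int) auto
  qed
  have fin: "Measurable.pred curves_borel (\<lambda>\<gamma>::real \<Rightarrow> 'a. (\<integral>\<^sup>+t\<in>{0..1}. lower_speed \<gamma> t \<partial>lborel) < \<infinity>)"
    by (rule le(2)[OF int int]) auto
  have "Measurable.pred curves_borel (\<lambda>\<gamma>::real \<Rightarrow> 'a. (\<integral>\<^sup>+t\<in>{0..1}. lower_speed \<gamma> t \<partial>lborel) < \<infinity> \<and>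
    (\<forall>x\<in>\<rat>. \<forall>y\<in>\<rat>. 0 \<le> x \<and> x \<le> y \<and> y \<le> 1 \<longrightarrow>
      ennreal (dist (eval_clamped \<gamma> x) (eval_clamped \<gamma> y)) \<le> (\<integral>\<^sup>+t\<in>{x..y}. lower_speed \<gamma> t \<partial>lborel)))"
    by (intro pred_intros_logic(3) fin measurable_pred_countable(1) bd countable_rat)
  then show ?thesis
    by (rule measurable_cong[THEN iffD1, rotated]) (simp add: abs_cont_curve_iff)
qed

lemma measurable_kinetic_energy [measurable]:
  "(kinetic_energy :: (real \<Rightarrow> 'a::{metric_space, second_countable_topology}) \<Rightarrow> ennreal) \<in> borel_measurable curves_borel"
proof -
  have [measurable]: "(\<lambda>\<gamma>::real \<Rightarrow> 'a. \<integral>\<^sup>+t\<in>{0..1}. (lower_speed \<gamma> t)\<^sup>2 \<partial>lborel) \<in> borel_measurable curves_borel"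
    by (rule measurable_nn_integral_lower_speed[of "\<lambda>x. x\<^sup>2"]) simp_all
  have "(\<lambda>\<gamma>::real \<Rightarrow> 'a. if abs_cont_curve \<gamma> then \<integral>\<^sup>+t\<in>{0..1}. (lower_speed \<gamma> t)\<^sup>2 \<partial>lborel else \<infinity>)
    \<in> borel_measurable curves_borel" by measurable
  moreover have "kinetic_energy = (\<lambda>\<gamma>::real \<Rightarrow> 'a. if abs_cont_curve \<gamma> then \<integral>\<^sup>+t\<in>{0..1}. (lower_speed \<gamma> t)\<^sup>2 \<partial>lborel else \<infinity>)"
  proof
    fix \<gamma> :: "real \<Rightarrow> 'a"
    show "kinetic_energy \<gamma> = (if abs_cont_curve \<gamma> then \<integral>\<^sup>+t\<in>{0..1}. (lower_speed \<gamma> t)\<^sup>2 \<partial>lborel else \<infinity>)"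
      using kinetic_energy_eq[of \<gamma>] by (cases "abs_cont_curve \<gamma>") (simp_all add: kinetic_energy_def)
  qed
  ultimately show ?thesis by simp
qed

section \<open>Stopped curves and conditioned test plans\<close>

definition stop_curve :: "real \<Rightarrow> real \<Rightarrow> (real \<Rightarrow> 'a) \<Rightarrow> real \<Rightarrow> 'a" where
  "stop_curve t s \<gamma> = restrict (\<lambda>r. \<gamma> (max t (min s r))) {0..1}"

context
  fixes t s :: real
  assumes ts: "0 \<le> t" "t \<le> s" "s \<le> 1"
begin

lemma eval_clamped_stop_curve:
  "eval_clamped (stop_curve t s \<gamma>) r = eval_clamped \<gamma> (max t (min s r))"
proof -
  have "max t (min s (unit_clamp r)) = unit_clamp (max t (min s r))"
    using ts by (auto simp: unit_clamp_def max_def min_def)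
  then show ?thesis using unit_clamp_mem(1)[of r] by (simp add: eval_clamped_def stop_curve_def)
qed

lemma stop_curve_eval: "r \<in> {0..1} \<Longrightarrow> stop_curve t s \<gamma> r = \<gamma> (max t (min s r))"
  by (simp add: stop_curve_def)

lemma stop_curve_mem:
  assumes "\<gamma> \<in> mspace curves" shows "stop_curve t s \<gamma> \<in> mspace curves"
proof -
  have "continuous_on {0..1} (\<lambda>r. \<gamma> (max t (min s r)))"
    by (rule continuous_on_compose2[of "{0..1}" \<gamma>])
       (use assms ts in \<open>auto simp: mspace_curves intro!: continuous_intros\<close>)
  then show ?thesis
    unfolding mspace_curves stop_curve_def
    by (auto intro: continuous_on_eq)
qed

lemma measurable_stop_curve [measurable]: "stop_curve t s \<in> curves_borel \<rightarrow>\<^sub>M curves_borel"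
proof (rule measurable_curves_borelI, rule Lipschitz_continuous_imp_continuous_map)
  show "Lipschitz_continuous_map curves curves (stop_curve t s :: (real \<Rightarrow> 'a) \<Rightarrow> real \<Rightarrow> 'a)"
    unfolding Lipschitz_continuous_map_def
  proof (intro conjI exI[of _ 1] ballI)
    show "stop_curve t s \<in> mspace curves \<rightarrow> (mspace curves :: (real \<Rightarrow> 'a) set)" using stop_curve_mem by blast
    fix \<gamma> \<eta> :: "real \<Rightarrow> 'a" assume *: "\<gamma> \<in> mspace curves" "\<eta> \<in> mspace curves"
    have max_min_mem: "0 \<le> max t (min s r)" "max t (min s r) \<le> 1" for r using ts by auto
    have "mdist curves (stop_curve t s \<gamma>) (stop_curve t s \<eta>) \<le> mdist curves \<gamma> \<eta>"
      unfolding curves_def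
    proof (rule mdist_cfunspace_le)
      show "0 \<le> mdist (cfunspace (top_of_set {0..1}) euclidean_metric) \<gamma> \<eta>" by simp
      fix r :: real assume "r \<in> topspace (top_of_set {0..1})"
      then show "mdist euclidean_metric (stop_curve t s \<gamma> r) (stop_curve t s \<eta> r)
        \<le> mdist (cfunspace (top_of_set {0..1}) euclidean_metric) \<gamma> \<eta>"
        using dist_le_mdist_curves[OF *, of "max t (min s r)"] max_min_mem by (simp add: stop_curve_eval curves_def)
    qed
    then show "mdist curves (stop_curve t s \<gamma>) (stop_curve t s \<eta>) \<le> 1 * mdist curves \<gamma> \<eta>" by simp
  qed
qed

lemma lower_speed_stop_curve:
  assumes r: "r \<noteq> t" "r \<noteq> s"
  shows "lower_speed (stop_curve t s \<gamma>) r = indicator {t..s} r * lower_speed \<gamma> r"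
proof -
  have lim: "(\<lambda>n. r + 1 / real (Suc n)) \<longlonglongrightarrow> r"
    using tendsto_add[OF tendsto_const LIMSEQ_inverse_real_of_nat] by (simp add: inverse_eq_divide)
  let ?d = "\<lambda>\<eta> n. ennreal (real (Suc n) * dist (eval_clamped \<eta> (r + 1 / real (Suc n))) (eval_clamped \<eta> r))"
  consider "r < t" | "t < r" "r < s" | "s < r" using r by linarith
  then have "\<forall>\<^sub>F n in sequentially. ?d (stop_curve t s \<gamma>) n = indicator {t..s} r * ?d \<gamma> n"
  proof cases
    case 1
    from order_tendstoD(2)[OF lim 1] show ?thesis
      by eventually_elim (use 1 ts in \<open>simp add: eval_clamped_stop_curve max_def min_def\<close>)
  next
    case 2
    from order_tendstoD(2)[OF lim 2(2)] show ?thesis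
    proof eventually_elim
      case (elim n)
      have "r \<le> r + 1 / real (Suc n)" by simp
      then have "max t (min s r) = r" "max t (min s (r + 1 / real (Suc n))) = r + 1 / real (Suc n)"
        using elim 2 by linarith+
      then show ?case using 2 by (simp add: eval_clamped_stop_curve)
    qed
  next
    case 3
    have "max t (min s r) = s" "max t (min s (r + 1 / real (Suc n))) = s" for n
    proof -
      have "r \<le> r + 1 / real (Suc n)" by simp
      then show "max t (min s r) = s" "max t (min s (r + 1 / real (Suc n))) = s" using 3 ts by linarith+
    qed
    then show ?thesis using 3 by (simp add: eval_clamped_stop_curve)
  qed
  then have "liminf (?d (stop_curve t s \<gamma>)) = liminf (\<lambda>n. indicator {t..s} r * ?d \<gamma> n)"
    by (rule Liminf_eq)
  then show ?thesis by (auto simp: lower_speed_def Liminf_const split: split_indicator)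
qed

lemma AE_lower_speed_stop_curve:
  "AE r in lborel. lower_speed (stop_curve t s \<gamma>) r = indicator {t..s} r * lower_speed \<gamma> r"
  using AE_lborel_singleton[of t] AE_lborel_singleton[of s]
  by eventually_elim (rule lower_speed_stop_curve)

lemma abs_cont_curve_stop_curve:
  assumes "abs_cont_curve \<gamma>" shows "abs_cont_curve (stop_curve t s \<gamma>)"
proof -
  obtain f where f: "speed_bound \<gamma> f" using assms by (auto simp: abs_cont_curve_def)
  define g where "g = (\<lambda>t. indicator {0..1} t * \<bar>f t\<bar>)"
  note g = speed_bound_clamped(1,3)[OF f, folded g_def]
  have nn: "0 \<le> g t" for t by (simp add: g_def)
  have "speed_bound (stop_curve t s \<gamma>) g" unfolding speed_bound_def
  proof (intro conjI allI impI)
    show "set_integrable lborel {0..1} g"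
      using integrable_mult_indicator[OF _ g(1), of "{0..1}"] by (simp add: set_integrable_def)
    fix x y :: real assume xy: "0 \<le> x \<and> x < y \<and> y \<le> 1"
    let ?x = "max t (min s x)" and ?y = "max t (min s y)"
    have "dist (stop_curve t s \<gamma> x) (stop_curve t s \<gamma> y) = dist (eval_clamped \<gamma> ?x) (eval_clamped \<gamma> ?y)"
      using eval_clamped_stop_curve[of \<gamma> x] eval_clamped_stop_curve[of \<gamma> y] xy by simp
    also have "\<dots> \<le> (LINT r:{x..y}|lborel. g r)"
    proof (cases "?x = ?y")
      case True
      then show ?thesis using nn by (simp add: set_lebesgue_integral_def)
    next
      case False
      then have sub: "x \<le> ?x" "?x \<le> ?y" "?y \<le> y" using xy by linarith+
      have "dist (eval_clamped \<gamma> ?x) (eval_clamped \<gamma> ?y) \<le> (LINT r:{?x..?y}|lborel. g r)"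
        by (rule g(2)[OF sub(2)])
      also have "\<dots> \<le> (LINT r:{x..y}|lborel. g r)"
        unfolding set_lebesgue_integral_def
      proof (intro integral_mono integrable_mult_indicator[OF _ g(1)])
        fix r
        have "indicator {?x..?y} r \<le> (indicator {x..y} r :: real)"
          using sub by (auto intro!: indicator_leI)
        then show "indicator {?x..?y} r *\<^sub>R g r \<le> indicator {x..y} r *\<^sub>R g r"
          using nn[of r] by (simp add: mult_right_mono)
      qed simp_all
      finally show ?thesis .
    qed
    finally show "dist (stop_curve t s \<gamma> x) (stop_curve t s \<gamma> y) \<le> (LINT r:{x..y}|lborel. g r)" .
  qed
  then show ?thesis by (auto simp: abs_cont_curve_def)
qed

lemma kinetic_energy_stop_curve_le:
  fixes \<gamma> :: "real \<Rightarrow> 'a::{metric_space, second_countable_topology}"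
  shows "kinetic_energy (stop_curve t s \<gamma>) \<le> kinetic_energy \<gamma>"
proof (cases "abs_cont_curve \<gamma>")
  case True
  have "(\<integral>\<^sup>+r\<in>{0..1}. (lower_speed (stop_curve t s \<gamma>) r)\<^sup>2 \<partial>lborel) \<le> (\<integral>\<^sup>+r\<in>{0..1}. (lower_speed \<gamma> r)\<^sup>2 \<partial>lborel)"
    using AE_lower_speed_stop_curve[of \<gamma>]
    by (intro nn_integral_mono_AE, eventually_elim) (auto split: split_indicator)
  then show ?thesis by (simp add: kinetic_energy_eq True abs_cont_curve_stop_curve)
qed (simp add: kinetic_energy_def)

end

text \<open>Time is stopped, not rescaled: an evaluation of the stopped curve is an evaluation of
  the original at a clamped time, so the compression constant is unchanged, and speed is only
  removed, so the energy does not grow.\<close>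

lemma test_plan_stop_curve:
  fixes m :: "'a::{metric_space, second_countable_topology} measure"
  assumes \<pi>: "test_plan m \<pi>" and ts: "0 \<le> t" "t \<le> s" "s \<le> 1"
  shows "test_plan m (distr \<pi> curves_borel (stop_curve t s))"
proof -
  have sets_pi [measurable_cong]: "sets \<pi> = sets curves_borel" using \<pi> by (simp add: test_plan_def)
  then have space_pi: "space \<pi> = mspace curves" by (metis sets_eq_imp_space_eq space_curves_borel)
  note [measurable] = measurable_stop_curve[OF ts]
  have st: "stop_curve t s \<in> \<pi> \<rightarrow>\<^sub>M curves_borel" by measurable
  obtain C :: real where C: "\<And>r B. r \<in> {0..1} \<Longrightarrow> B \<in> sets borel \<Longrightarrow>
    emeasure (distr \<pi> borel (\<lambda>\<gamma>. \<gamma> r)) B \<le> ennreal C * emeasure m B"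
    using \<pi> unfolding test_plan_def by blast
  interpret prob_space \<pi> using \<pi> by (simp add: test_plan_def)
  show ?thesis unfolding test_plan_def
  proof (intro conjI exI[of _ C] ballI)
    show "prob_space (distr \<pi> curves_borel (stop_curve t s))" by (rule prob_space_distr[OF st])
    fix r :: real and B :: "'a set" assume r: "r \<in> {0..1}" and B: "B \<in> sets borel"
    have [measurable]: "(\<lambda>\<gamma>::real \<Rightarrow> 'a. \<gamma> r) \<in> borel_measurable curves_borel"
      using r by (rule measurable_eval_curves')
    have r': "max t (min s r) \<in> {0..1}" using ts by auto
    have "distr (distr \<pi> curves_borel (stop_curve t s)) borel (\<lambda>\<gamma>. \<gamma> r) = distr \<pi> borel (\<lambda>\<gamma>. \<gamma> (max t (min s r)))"
      using r by (subst distr_distr) (auto simp: o_def stop_curve_eval[OF ts] st)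
    then show "emeasure (distr (distr \<pi> curves_borel (stop_curve t s)) borel (\<lambda>\<gamma>. \<gamma> r)) B \<le> ennreal C * emeasure m B"
      using C[OF r' B] by simp
  next
    have "(\<integral>\<^sup>+\<gamma>. kinetic_energy \<gamma> \<partial>distr \<pi> curves_borel (stop_curve t s)) = (\<integral>\<^sup>+\<gamma>. kinetic_energy (stop_curve t s \<gamma>) \<partial>\<pi>)"
      by (rule nn_integral_distr[OF st]) measurable
    also have "\<dots> \<le> (\<integral>\<^sup>+\<gamma>. kinetic_energy \<gamma> \<partial>\<pi>)"
      by (intro nn_integral_mono kinetic_energy_stop_curve_le ts)
    also have "\<dots> < \<infinity>" using \<pi> by (simp add: test_plan_def)
    finally show "(\<integral>\<^sup>+\<gamma>. kinetic_energy \<gamma> \<partial>distr \<pi> curves_borel (stop_curve t s)) < \<infinity>" .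
  qed simp
qed

text \<open>Conditioning on a set of mass p raises the compression constant and the energy by at
  most the factor 1/p.\<close>

lemma test_plan_uniform_measure:
  fixes m :: "'a::{metric_space, second_countable_topology} measure"
  assumes \<pi>: "test_plan m \<pi>" and A: "A \<in> sets \<pi>" "emeasure \<pi> A \<noteq> 0"
  shows "test_plan m (uniform_measure \<pi> A)"
proof -
  have sets_pi [measurable_cong]: "sets \<pi> = sets curves_borel" using \<pi> by (simp add: test_plan_def)
  have [measurable]: "A \<in> sets curves_borel" using A sets_pi by simp
  obtain C :: real where C: "\<And>r B. r \<in> {0..1} \<Longrightarrow> B \<in> sets borel \<Longrightarrow>
    emeasure (distr \<pi> borel (\<lambda>\<gamma>. \<gamma> r)) B \<le> ennreal C * emeasure m B"
    using \<pi> unfolding test_plan_def by blast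
  interpret prob_space \<pi> using \<pi> by (simp add: test_plan_def)
  define p where "p = prob A"
  have p: "emeasure \<pi> A = ennreal p" "0 < p"
    using A(2) by (simp_all add: p_def emeasure_eq_measure) (metis ennreal_0 measure_nonneg order_le_less)
  show ?thesis unfolding test_plan_def
  proof (intro conjI exI[of _ "C / p"] ballI)
    show "prob_space (uniform_measure \<pi> A)"
      using A(2) by (intro prob_space_uniform_measure) auto
    fix r :: real and B :: "'a set" assume r: "r \<in> {0..1}" and B [measurable]: "B \<in> sets borel"
    have [measurable]: "(\<lambda>\<gamma>::real \<Rightarrow> 'a. \<gamma> r) \<in> borel_measurable curves_borel"
      using r by (rule measurable_eval_curves')
    let ?E = "(\<lambda>\<gamma>. \<gamma> r) -` B \<inter> space \<pi>"
    have E [measurable]: "?E \<in> sets \<pi>" by measurable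
    have "emeasure (distr (uniform_measure \<pi> A) borel (\<lambda>\<gamma>. \<gamma> r)) B = emeasure \<pi> (A \<inter> ?E) / emeasure \<pi> A"
      by (subst emeasure_distr) (auto intro!: emeasure_uniform_measure A(1))
    also have "\<dots> \<le> emeasure \<pi> ?E / emeasure \<pi> A"
      by (intro divide_right_mono_ennreal emeasure_mono) auto
    also have "emeasure \<pi> ?E = emeasure (distr \<pi> borel (\<lambda>\<gamma>. \<gamma> r)) B"
      by (subst emeasure_distr) auto
    also have "\<dots> / emeasure \<pi> A \<le> ennreal C * emeasure m B / emeasure \<pi> A"
      by (intro divide_right_mono_ennreal C r B)
    also have "\<dots> = ennreal (C / p) * emeasure m B"
      using p by (simp add: divide_ennreal_def inverse_ennreal divide_inverse ennreal_mult'' ac_simps)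
    finally show "emeasure (distr (uniform_measure \<pi> A) borel (\<lambda>\<gamma>. \<gamma> r)) B \<le> ennreal (C / p) * emeasure m B" .
  next
    have [measurable]: "kinetic_energy \<in> borel_measurable \<pi>" by measurable
    have "(\<integral>\<^sup>+\<gamma>. kinetic_energy \<gamma> \<partial>uniform_measure \<pi> A) = (\<integral>\<^sup>+\<gamma>. kinetic_energy \<gamma> * indicator A \<gamma> \<partial>\<pi>) / emeasure \<pi> A"
      by (rule nn_integral_uniform_measure[OF _ A(1)]) measurable
    also have "\<dots> \<le> (\<integral>\<^sup>+\<gamma>. kinetic_energy \<gamma> \<partial>\<pi>) / emeasure \<pi> A"
      by (intro divide_right_mono_ennreal nn_integral_mono) (auto split: split_indicator)
    also have "\<dots> < \<infinity>"
      using \<pi> p by (auto simp: test_plan_def divide_ennreal_def ennreal_mult_less_top inverse_ennreal)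
    finally show "(\<integral>\<^sup>+\<gamma>. kinetic_energy \<gamma> \<partial>uniform_measure \<pi> A) < \<infinity>" .
  qed (simp add: sets_pi)
qed

section \<open>Weak upper gradients along curves\<close>

definition curve_integral :: "('a::metric_space \<Rightarrow> real) \<Rightarrow> (real \<Rightarrow> 'a) \<Rightarrow> real \<Rightarrow> real \<Rightarrow> ennreal" where
  "curve_integral G \<gamma> x y = (\<integral>\<^sup>+t\<in>{x..y}. ennreal (G (eval_clamped \<gamma> t)) * lower_speed \<gamma> t \<partial>lborel)"

lemma test_plan_sets: "test_plan m \<pi> \<Longrightarrow> sets \<pi> = sets curves_borel"
  and test_plan_space: "test_plan m \<pi> \<Longrightarrow> space \<pi> = mspace curves"
  and test_plan_prob: "test_plan m \<pi> \<Longrightarrow> prob_space \<pi>"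
  by (auto simp: test_plan_def dest: sets_eq_imp_space_eq)

lemma metric_speed_integral_eq:
  fixes \<gamma> :: "real \<Rightarrow> 'a::{metric_space, second_countable_topology}"
  assumes ac: "abs_cont_curve \<gamma>" and G: "\<And>x. 0 \<le> G x"
  shows "(\<integral>\<^sup>+t\<in>{0..1}. ennreal (G (\<gamma> t) * metric_speed \<gamma> t) \<partial>lborel) = curve_integral G \<gamma> 0 1"
  unfolding curve_integral_def
  using abs_cont_lower_speed(6,7)[OF ac]
  by (intro nn_integral_cong_AE, eventually_elim) (auto simp: ennreal_mult G split: split_indicator)

lemma AE_test_plan_abs_cont:
  fixes m :: "'a::{metric_space, second_countable_topology} measure"
  assumes "test_plan m \<pi>"
  shows "AE \<gamma> in \<pi>. \<gamma> \<in> mspace curves \<and> abs_cont_curve \<gamma>"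
proof -
  have [measurable_cong]: "sets \<pi> = sets curves_borel" using assms by (rule test_plan_sets)
  have "AE \<gamma> in \<pi>. kinetic_energy \<gamma> \<noteq> \<infinity>"
    using assms by (intro nn_integral_PInf_AE) (auto simp: test_plan_def)
  then show ?thesis
    using AE_space[of \<pi>] by eventually_elim (auto simp: test_plan_space[OF assms] kinetic_energy_def split: if_splits)
qed

lemma measurable_curve_integrand [measurable]:
  fixes G :: "'a::{metric_space, second_countable_topology} \<Rightarrow> real"
  assumes [measurable]: "G \<in> borel_measurable borel"
  shows "(\<lambda>p. ennreal (G (eval_clamped (fst p) (snd p))) * lower_speed (fst p) (snd p))
    \<in> borel_measurable (curves_borel \<Otimes>\<^sub>M borel)"
  by measurable

lemma measurable_curve_integral:
  fixes G :: "'a::{metric_space, second_countable_topology} \<Rightarrow> real" and h :: "'b \<Rightarrow> real \<Rightarrow> 'a"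
  assumes G: "G \<in> borel_measurable borel" and h: "h \<in> N \<rightarrow>\<^sub>M curves_borel"
    and [measurable]: "a \<in> borel_measurable N" "b \<in> borel_measurable N"
  shows "(\<lambda>x. curve_integral G (h x) (a x) (b x)) \<in> borel_measurable N"
proof -
  have "(\<lambda>p. (h (fst p), snd p)) \<in> N \<Otimes>\<^sub>M borel \<rightarrow>\<^sub>M curves_borel \<Otimes>\<^sub>M borel"
    by (intro measurable_Pair measurable_compose[OF measurable_fst h] measurable_snd)
  from measurable_compose[OF this measurable_curve_integrand[OF G]]
  have [measurable]: "(\<lambda>p. ennreal (G (eval_clamped (h (fst p)) (snd p))) * lower_speed (h (fst p)) (snd p))
    \<in> borel_measurable (N \<Otimes>\<^sub>M borel)" by simp
  have "(\<lambda>p. (ennreal (G (eval_clamped (h (fst p)) (snd p))) * lower_speed (h (fst p)) (snd p)) *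
     (if a (fst p) \<le> snd p \<and> snd p \<le> b (fst p) then 1 else 0)) \<in> borel_measurable (N \<Otimes>\<^sub>M borel)"
    by measurable
  then have "(\<lambda>(x, t). ennreal (G (eval_clamped (h x) t)) * lower_speed (h x) t * indicator {a x..b x} t)
     \<in> borel_measurable (N \<Otimes>\<^sub>M lborel)"
    by (simp add: split_beta' indicator_def cong: measurable_cong_sets)
  then show ?thesis
    unfolding curve_integral_def by (rule lborel.borel_measurable_nn_integral)
qed

lemma curve_integral_add:
  fixes G H :: "'a::{metric_space, second_countable_topology} \<Rightarrow> real"
  assumes [measurable]: "G \<in> borel_measurable borel" "H \<in> borel_measurable borel"
    and nn: "\<And>x. 0 \<le> G x" "\<And>x. 0 \<le> H x" and \<gamma>: "\<gamma> \<in> mspace curves"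
  shows "curve_integral (\<lambda>x. G x + H x) \<gamma> a b = curve_integral G \<gamma> a b + curve_integral H \<gamma> a b"
proof -
  have [measurable]: "eval_clamped \<gamma> \<in> borel_measurable borel" "lower_speed \<gamma> \<in> borel_measurable borel"
    using continuous_on_eval_clamped[OF \<gamma>]
    by (auto intro: borel_measurable_continuous_onI lower_speed_measurable_continuous)
  show ?thesis
    unfolding curve_integral_def by (simp add: nn distrib_right nn_integral_add)
qed

text \<open>Read as an inequality between measures, the compression bound passes from sets to
  integrals.\<close>

lemma nn_integral_test_plan_eval_le:
  fixes m :: "'a::{metric_space, second_countable_topology} measure"
  assumes \<pi>: "test_plan m \<pi>" and m: "sets m = sets borel"
  obtains C :: real where "\<And>f t. f \<in> borel_measurable borel \<Longrightarrow> t \<in> {0..1} \<Longrightarrow>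
    (\<integral>\<^sup>+\<gamma>. f (eval_clamped \<gamma> t) \<partial>\<pi>) \<le> ennreal C * (\<integral>\<^sup>+x. f x \<partial>m)"
proof -
  have [measurable_cong]: "sets \<pi> = sets curves_borel" "sets m = sets borel" using test_plan_sets[OF \<pi>] m .
  obtain C :: real where C: "\<And>r B. r \<in> {0..1} \<Longrightarrow> B \<in> sets borel \<Longrightarrow>
    emeasure (distr \<pi> borel (\<lambda>\<gamma>. \<gamma> r)) B \<le> ennreal C * emeasure m B"
    using \<pi> unfolding test_plan_def by blast
  have "(\<integral>\<^sup>+\<gamma>. f (eval_clamped \<gamma> t) \<partial>\<pi>) \<le> ennreal C * (\<integral>\<^sup>+x. f x \<partial>m)"
    if [measurable]: "f \<in> borel_measurable borel" and t: "t \<in> {0..1}" for f and t :: real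
  proof -
    note [measurable] = measurable_eval_curves'[OF t]
    have "distr \<pi> borel (\<lambda>\<gamma>. \<gamma> t) \<le> scale_measure (ennreal C) m"
      by (subst le_measure) (auto simp: m C[OF t])
    moreover have "(\<lambda>\<gamma>::real \<Rightarrow> 'a. \<gamma> t) = (\<lambda>\<gamma>. eval_clamped \<gamma> t)" using t by auto
    ultimately have "distr \<pi> borel (\<lambda>\<gamma>. eval_clamped \<gamma> t) \<le> scale_measure (ennreal C) m" by simp
    then have "(\<integral>\<^sup>+x. f x \<partial>distr \<pi> borel (\<lambda>\<gamma>. eval_clamped \<gamma> t)) \<le> (\<integral>\<^sup>+x. f x \<partial>scale_measure (ennreal C) m)"
      by (rule nn_integral_mono_measure[rotated]) (simp add: m)
    then show ?thesis
      using measurable_eval_curves[of t]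
      by (subst (asm) nn_integral_distr) (auto simp: nn_integral_scale_measure m cong: measurable_cong_sets)
  qed
  then show ?thesis by (rule that)
qed

lemma ennreal_mult_le_squares: "(a::ennreal) * b \<le> a\<^sup>2 + b\<^sup>2"
proof (cases "a \<le> b")
  case True
  then have "a * b \<le> b * b" by (rule mult_right_mono) simp
  then show ?thesis by (simp add: power2_eq_square add_increasing)
next
  case False
  then have "a * b \<le> a * a" by (intro mult_left_mono) auto
  then show ?thesis by (simp add: power2_eq_square add_increasing2)
qed

text \<open>The product of \<open>G\<close> and the speed is at most the sum of their squares.
  Fubini and the compression bound control the first square by the integral of G^2; the second
  integrates to the kinetic energy.\<close>

lemma curve_integral_finite:
  fixes m :: "'a::{metric_space, second_countable_topology} measure"
  assumes \<pi>: "test_plan m \<pi>" and m: "sets m = sets borel"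
    and G [measurable]: "G \<in> borel_measurable borel" and nn: "\<And>x. 0 \<le> G x"
    and L2: "(\<integral>\<^sup>+x. ennreal ((G x)\<^sup>2) \<partial>m) < \<infinity>"
  shows "(\<integral>\<^sup>+\<gamma>. curve_integral G \<gamma> 0 1 \<partial>\<pi>) < \<infinity>"
proof -
  have sets_pi [measurable_cong]: "sets \<pi> = sets curves_borel" using test_plan_sets[OF \<pi>] .
  interpret prob_space \<pi> using \<pi> by (rule test_plan_prob)
  interpret pair_sigma_finite \<pi> lborel ..
  obtain C where C: "\<And>f t. f \<in> borel_measurable borel \<Longrightarrow> t \<in> {0..1} \<Longrightarrow>
    (\<integral>\<^sup>+\<gamma>. f (eval_clamped \<gamma> t) \<partial>\<pi>) \<le> ennreal C * (\<integral>\<^sup>+x. f x \<partial>m)"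
    using nn_integral_test_plan_eval_le[OF \<pi> m] by blast
  have pairm: "f \<in> borel_measurable (\<pi> \<Otimes>\<^sub>M lborel)" if "f \<in> borel_measurable (curves_borel \<Otimes>\<^sub>M borel)" for f :: "(real \<Rightarrow> 'a) \<times> real \<Rightarrow> ennreal"
    using that by (simp add: sets_pi cong: measurable_cong_sets sets_pair_measure_cong)
  define k where "k p = ennreal ((G (eval_clamped (fst p) (snd p)))\<^sup>2) * indicator {0..1} (snd p)"
    for p :: "(real \<Rightarrow> 'a) \<times> real"
  have k: "k \<in> borel_measurable (\<pi> \<Otimes>\<^sub>M lborel)"
    by (rule pairm) (unfold k_def, measurable)
  define l where "l \<gamma> = (\<integral>\<^sup>+t\<in>{0..1}. (lower_speed \<gamma> t)\<^sup>2 \<partial>lborel)" for \<gamma> :: "real \<Rightarrow> 'a"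
  have l: "l \<in> borel_measurable \<pi>"
  proof -
    have "(\<lambda>\<gamma>::real \<Rightarrow> 'a. \<integral>\<^sup>+t\<in>{0..1}. (lower_speed \<gamma> t)\<^sup>2 \<partial>lborel) \<in> borel_measurable curves_borel"
      by (rule measurable_nn_integral_lower_speed[of "\<lambda>x. x\<^sup>2"]) simp_all
    then show ?thesis unfolding l_def[abs_def] by (simp add: sets_pi cong: measurable_cong_sets)
  qed
  have kint: "(\<lambda>\<gamma>. \<integral>\<^sup>+t. k (\<gamma>, t) \<partial>lborel) \<in> borel_measurable \<pi>"
    using k by (rule lborel.borel_measurable_nn_integral_fst)
  have "curve_integral G \<gamma> 0 1 \<le> (\<integral>\<^sup>+t. k (\<gamma>, t) \<partial>lborel) + l \<gamma>" if "\<gamma> \<in> space \<pi>" for \<gamma>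
  proof -
    have "\<gamma> \<in> mspace curves" using that by (simp add: test_plan_space[OF \<pi>])
    then have [measurable]: "eval_clamped \<gamma> \<in> borel_measurable borel" "lower_speed \<gamma> \<in> borel_measurable borel"
      using continuous_on_eval_clamped
      by (auto intro: borel_measurable_continuous_onI lower_speed_measurable_continuous)
    have "curve_integral G \<gamma> 0 1 \<le> (\<integral>\<^sup>+t. k (\<gamma>, t) + (lower_speed \<gamma> t)\<^sup>2 * indicator {0..1} t \<partial>lborel)"
      unfolding curve_integral_def
    proof (rule nn_integral_mono)
      fix t :: real
      show "ennreal (G (eval_clamped \<gamma> t)) * lower_speed \<gamma> t * indicator {0..1} t
        \<le> k (\<gamma>, t) + (lower_speed \<gamma> t)\<^sup>2 * indicator {0..1} t"
        using ennreal_mult_le_squares[of "ennreal (G (eval_clamped \<gamma> t))" "lower_speed \<gamma> t"] nn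
        by (auto simp: k_def ennreal_power split: split_indicator)
    qed
    also have "\<dots> = (\<integral>\<^sup>+t. k (\<gamma>, t) \<partial>lborel) + l \<gamma>"
      unfolding l_def by (rule nn_integral_add) (auto simp: k_def)
    finally show ?thesis .
  qed
  then have "(\<integral>\<^sup>+\<gamma>. curve_integral G \<gamma> 0 1 \<partial>\<pi>) \<le> (\<integral>\<^sup>+\<gamma>. (\<integral>\<^sup>+t. k (\<gamma>, t) \<partial>lborel) + l \<gamma> \<partial>\<pi>)"
    by (rule nn_integral_mono)
  also have "\<dots> = (\<integral>\<^sup>+\<gamma>. (\<integral>\<^sup>+t. k (\<gamma>, t) \<partial>lborel) \<partial>\<pi>) + (\<integral>\<^sup>+\<gamma>. l \<gamma> \<partial>\<pi>)"
    by (rule nn_integral_add[OF kint l])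
  also have "(\<integral>\<^sup>+\<gamma>. (\<integral>\<^sup>+t. k (\<gamma>, t) \<partial>lborel) \<partial>\<pi>) = (\<integral>\<^sup>+t. (\<integral>\<^sup>+\<gamma>. k (\<gamma>, t) \<partial>\<pi>) \<partial>lborel)"
    using k by (rule Fubini[symmetric])
  also have "\<dots> \<le> (\<integral>\<^sup>+t. (ennreal C * (\<integral>\<^sup>+x. ennreal ((G x)\<^sup>2) \<partial>m)) * indicator {0..1} (t::real) \<partial>lborel)"
  proof (rule nn_integral_mono, goal_cases)
    case (1 t)
    show "(\<integral>\<^sup>+\<gamma>. k (\<gamma>, t) \<partial>\<pi>) \<le> (ennreal C * (\<integral>\<^sup>+x. ennreal ((G x)\<^sup>2) \<partial>m)) * indicator {0..1} t"
      using C[of "\<lambda>x. ennreal ((G x)\<^sup>2)" t] by (auto simp: k_def split: split_indicator)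
  qed
  also have "\<dots> = ennreal C * (\<integral>\<^sup>+x. ennreal ((G x)\<^sup>2) \<partial>m)"
    by (subst nn_integral_cmult_indicator) auto
  also have "(\<integral>\<^sup>+\<gamma>. l \<gamma> \<partial>\<pi>) = (\<integral>\<^sup>+\<gamma>. kinetic_energy \<gamma> \<partial>\<pi>)"
    using AE_test_plan_abs_cont[OF \<pi>] by (intro nn_integral_cong_AE, eventually_elim) (simp add: kinetic_energy_eq l_def)
  also have "ennreal C * (\<integral>\<^sup>+x. ennreal ((G x)\<^sup>2) \<partial>m) + \<dots> < \<infinity>"
    using L2 \<pi> by (auto simp: test_plan_def ennreal_mult_less_top)
  finally show ?thesis by (simp add: add_right_mono)
qed

section \<open>Weak upper gradients tested on almost every curve\<close>

context
  fixes m :: "'a::{metric_space, second_countable_topology} measure"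
  assumes m: "sets m = sets borel"
begin

lemma weak_upper_gradientD:
  assumes "weak_upper_gradient m f G"
  shows "G \<in> borel_measurable borel" "\<And>x. 0 \<le> G x" "(\<integral>\<^sup>+x. ennreal ((G x)\<^sup>2) \<partial>m) < \<infinity>"
  using assms m by (auto simp: weak_upper_gradient_def cong: measurable_cong_sets)

lemma wug_plan_le:
  assumes "weak_upper_gradient m f G" and \<pi>: "test_plan m \<pi>"
  shows "(\<integral>\<^sup>+\<gamma>. ennreal \<bar>f (\<gamma> 1) - f (\<gamma> 0)\<bar> \<partial>\<pi>) \<le> (\<integral>\<^sup>+\<gamma>. curve_integral G \<gamma> 0 1 \<partial>\<pi>)"
proof -
  have "(\<integral>\<^sup>+\<gamma>. ennreal \<bar>f (\<gamma> 1) - f (\<gamma> 0)\<bar> \<partial>\<pi>)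
     \<le> (\<integral>\<^sup>+\<gamma>. (\<integral>\<^sup>+t\<in>{0..1}. ennreal (G (\<gamma> t) * metric_speed \<gamma> t) \<partial>lborel) \<partial>\<pi>)"
    using assms by (auto simp: weak_upper_gradient_def)
  also have "\<dots> = (\<integral>\<^sup>+\<gamma>. curve_integral G \<gamma> 0 1 \<partial>\<pi>)"
    using AE_test_plan_abs_cont[OF \<pi>]
    by (intro nn_integral_cong_AE, eventually_elim) (simp add: metric_speed_integral_eq weak_upper_gradientD[OF assms(1)])
  finally show ?thesis .
qed

text \<open>The way weak upper gradients are produced below: a bound along almost every curve is
  integrated, and the measurable speed is turned back into \<open>metric_speed\<close>.\<close>

lemma weak_upper_gradientI:
  assumes G: "G \<in> borel_measurable borel" "\<And>x. 0 \<le> G x" "(\<integral>\<^sup>+x. ennreal ((G x)\<^sup>2) \<partial>m) < \<infinity>"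
    and bd: "\<And>\<pi>. test_plan m \<pi> \<Longrightarrow> AE \<gamma> in \<pi>. ennreal \<bar>f (\<gamma> 1) - f (\<gamma> 0)\<bar> \<le> curve_integral G \<gamma> 0 1"
  shows "weak_upper_gradient m f G"
  unfolding weak_upper_gradient_def
proof (intro conjI allI impI G)
  show "G \<in> borel_measurable m" using G(1) m by (simp cong: measurable_cong_sets)
  fix \<pi> assume \<pi>: "test_plan m \<pi>"
  have "(\<integral>\<^sup>+\<gamma>. ennreal \<bar>f (\<gamma> 1) - f (\<gamma> 0)\<bar> \<partial>\<pi>) \<le> (\<integral>\<^sup>+\<gamma>. curve_integral G \<gamma> 0 1 \<partial>\<pi>)"
    using bd[OF \<pi>] by (rule nn_integral_mono_AE)
  also have "\<dots> = (\<integral>\<^sup>+\<gamma>. (\<integral>\<^sup>+t\<in>{0..1}. ennreal (G (\<gamma> t) * metric_speed \<gamma> t) \<partial>lborel) \<partial>\<pi>)"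
    using AE_test_plan_abs_cont[OF \<pi>]
    by (intro nn_integral_cong_AE, eventually_elim) (simp add: metric_speed_integral_eq G(2))
  finally show "(\<integral>\<^sup>+\<gamma>. ennreal \<bar>f (\<gamma> 1) - f (\<gamma> 0)\<bar> \<partial>\<pi>)
     \<le> (\<integral>\<^sup>+\<gamma>. (\<integral>\<^sup>+t\<in>{0..1}. ennreal (G (\<gamma> t) * metric_speed \<gamma> t) \<partial>lborel) \<partial>\<pi>)" .
qed

text \<open>Otherwise conditioning the plan on the violating curves would contradict the integrated
  inequality.\<close>

lemma AE_endpoint_bound:
  assumes f: "f \<in> borel_measurable borel" and wug: "weak_upper_gradient m f G" and \<pi>: "test_plan m \<pi>"
  shows "AE \<gamma> in \<pi>. ennreal \<bar>f (\<gamma> 1) - f (\<gamma> 0)\<bar> \<le> curve_integral G \<gamma> 0 1"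
proof -
  note G = weak_upper_gradientD[OF wug]
  have sets_pi [measurable_cong]: "sets \<pi> = sets curves_borel" using test_plan_sets[OF \<pi>] .
  interpret prob_space \<pi> using \<pi> by (rule test_plan_prob)
  define a where "a \<gamma> = ennreal \<bar>f (\<gamma> 1) - f (\<gamma> 0)\<bar>" for \<gamma> :: "real \<Rightarrow> 'a"
  define b where "b \<gamma> = curve_integral G \<gamma> 0 1" for \<gamma> :: "real \<Rightarrow> 'a"
  have [measurable]: "(\<lambda>\<gamma>::real \<Rightarrow> 'a. \<gamma> 0) \<in> borel_measurable curves_borel"
    "(\<lambda>\<gamma>::real \<Rightarrow> 'a. \<gamma> 1) \<in> borel_measurable curves_borel"
    by (simp_all add: measurable_eval_curves')
  note [measurable] = f
  have a [measurable]: "a \<in> borel_measurable \<pi>" unfolding a_def[abs_def] by measurable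
  have b [measurable]: "b \<in> borel_measurable \<pi>" unfolding b_def[abs_def]
    by (rule measurable_curve_integral[OF G(1)]) measurable
  define A where "A = {\<gamma> \<in> space \<pi>. b \<gamma> < a \<gamma>}"
  have A: "A \<in> sets \<pi>" unfolding A_def by measurable
  have "emeasure \<pi> A = 0"
  proof (rule ccontr)
    assume ne: "emeasure \<pi> A \<noteq> 0"
    have tp: "test_plan m (uniform_measure \<pi> A)"
      using \<pi> A ne by (rule test_plan_uniform_measure)
    have "(\<integral>\<^sup>+\<gamma>. a \<gamma> \<partial>uniform_measure \<pi> A) \<le> (\<integral>\<^sup>+\<gamma>. b \<gamma> \<partial>uniform_measure \<pi> A)"
      unfolding a_def b_def by (rule wug_plan_le[OF wug tp])
    then have *: "(\<integral>\<^sup>+\<gamma>. a \<gamma> * indicator A \<gamma> \<partial>\<pi>) / emeasure \<pi> A \<le> (\<integral>\<^sup>+\<gamma>. b \<gamma> * indicator A \<gamma> \<partial>\<pi>) / emeasure \<pi> A"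
      using A by (simp add: nn_integral_uniform_measure)
    have le: "(\<integral>\<^sup>+\<gamma>. a \<gamma> * indicator A \<gamma> \<partial>\<pi>) \<le> (\<integral>\<^sup>+\<gamma>. b \<gamma> * indicator A \<gamma> \<partial>\<pi>)"
    proof -
      have cancel: "z / emeasure \<pi> A * emeasure \<pi> A = z" for z
        using ne by (simp add: ennreal_divide_times ennreal_divide_self less_top[symmetric])
      from mult_right_mono[OF * zero_le, of "emeasure \<pi> A"] show ?thesis by (simp only: cancel)
    qed
    have "(\<integral>\<^sup>+\<gamma>. b \<gamma> * indicator A \<gamma> \<partial>\<pi>) \<le> (\<integral>\<^sup>+\<gamma>. b \<gamma> \<partial>\<pi>)"
      by (intro nn_integral_mono) (auto split: split_indicator)
    also have "\<dots> < \<infinity>" unfolding b_def by (rule curve_integral_finite[OF \<pi> m G])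
    finally have fin: "(\<integral>\<^sup>+\<gamma>. b \<gamma> * indicator A \<gamma> \<partial>\<pi>) \<noteq> \<infinity>" by simp
    have "(\<integral>\<^sup>+\<gamma>. b \<gamma> * indicator A \<gamma> \<partial>\<pi>) < (\<integral>\<^sup>+\<gamma>. a \<gamma> * indicator A \<gamma> \<partial>\<pi>)"
    \<comment> \<open>On \<open>A\<close> the inequality is strict pointwise. As \<open>A\<close>
      has positive mass and the smaller integral is finite, it remains strict after
      integration.\<close>
    proof (rule nn_integral_less[OF _ _ fin])
      show "AE \<gamma> in \<pi>. b \<gamma> * indicator A \<gamma> \<le> a \<gamma> * indicator A \<gamma>"
        by (rule AE_I2) (auto simp: A_def split: split_indicator)
      show "\<not> (AE \<gamma> in \<pi>. a \<gamma> * indicator A \<gamma> \<le> b \<gamma> * indicator A \<gamma>)"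
      proof
        assume "AE \<gamma> in \<pi>. a \<gamma> * indicator A \<gamma> \<le> b \<gamma> * indicator A \<gamma>"
        then have "AE \<gamma> in \<pi>. \<gamma> \<notin> A" by eventually_elim (auto simp: A_def)
        then show False using A ne by (simp add: AE_iff_null_sets[symmetric] null_sets_def)
      qed
    qed (use A in measurable)
    then show False using le by simp
  qed
  then have "AE \<gamma> in \<pi>. \<gamma> \<notin> A" using A by (intro AE_not_in) (auto simp: null_sets_def)
  then show ?thesis using AE_space by eventually_elim (auto simp: A_def a_def b_def not_less)
qed

text \<open>Stopping at \<open>x\<close> and \<open>y\<close> turns these times into endpoints, and
  the speed of the stopped curve lives on [x, y].\<close>

lemma AE_segment_bound:
  assumes f: "f \<in> borel_measurable borel" and wug: "weak_upper_gradient m f G" and \<pi>: "test_plan m \<pi>"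
    and xy: "0 \<le> x" "x \<le> y" "y \<le> 1"
  shows "AE \<gamma> in \<pi>. ennreal \<bar>f (\<gamma> y) - f (\<gamma> x)\<bar> \<le> curve_integral G \<gamma> x y"
proof -
  have [measurable_cong]: "sets \<pi> = sets curves_borel" using test_plan_sets[OF \<pi>] .
  note [measurable] = measurable_stop_curve[OF xy]
  have st: "stop_curve x y \<in> \<pi> \<rightarrow>\<^sub>M curves_borel" by measurable
  have "AE \<gamma> in \<pi>. ennreal \<bar>f (stop_curve x y \<gamma> 1) - f (stop_curve x y \<gamma> 0)\<bar> \<le> curve_integral G (stop_curve x y \<gamma>) 0 1"
    using AE_distrD[OF st AE_endpoint_bound[OF f wug test_plan_stop_curve[OF \<pi> xy]]] .
  moreover have "curve_integral G (stop_curve x y \<gamma>) 0 1 = curve_integral G \<gamma> x y" for \<gamma>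
    unfolding curve_integral_def using AE_lower_speed_stop_curve[OF xy, of \<gamma>]
    by (intro nn_integral_cong_AE, eventually_elim)
       (use xy in \<open>auto simp: eval_clamped_stop_curve[OF xy] split: split_indicator\<close>)
  moreover have "max x (min y 1) = y" "max x (min y 0) = x" using xy by auto
  ultimately show ?thesis by (simp add: stop_curve_eval[OF xy])
qed

end

text \<open>\<open>F\<close> is an absolutely continuous representative of \<open>f\<close> along
  the curve. Agreement at 0 and 1 is demanded separately: these times are negligible, yet they are
  the ones a weak upper gradient is tested on. Outside [0,1], \<open>F\<close> is only required to
  keep its integral bound.\<close>

definition sobolev_path :: "('a::metric_space \<Rightarrow> real) \<Rightarrow> ('a \<Rightarrow> real) \<Rightarrow> (real \<Rightarrow> 'a) \<Rightarrow> (real \<Rightarrow> real) \<Rightarrow> bool" where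
  "sobolev_path f G \<gamma> F \<longleftrightarrow> F 0 = f (\<gamma> 0) \<and> F 1 = f (\<gamma> 1) \<and>
     (AE t in lborel. t \<in> {0..1} \<longrightarrow> F t = f (\<gamma> t)) \<and>
     (\<exists>g. integral_bounded F g \<and>
       (AE t in lborel. t \<in> {0..1} \<longrightarrow> ennreal (g t) = ennreal (G (\<gamma> t)) * lower_speed \<gamma> t))"

text \<open>McShane's formula for the pseudo-distance |P x - P y|, for which \<open>u\<close> is
  1-Lipschitz on \<open>S\<close>.\<close>

lemma McShane_extension:
  fixes u P :: "'x \<Rightarrow> real"
  assumes S: "S \<noteq> {}" and u: "\<And>s t. s \<in> S \<Longrightarrow> t \<in> S \<Longrightarrow> \<bar>u s - u t\<bar> \<le> \<bar>P s - P t\<bar>"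
  obtains F where "\<And>s. s \<in> S \<Longrightarrow> F s = u s" "\<And>x y. \<bar>F x - F y\<bar> \<le> \<bar>P x - P y\<bar>"
proof
  define F where "F x = (INF s\<in>S. u s + \<bar>P x - P s\<bar>)" for x
  obtain s0 where s0: "s0 \<in> S" using S by blast
  have bdd: "bdd_below ((\<lambda>s. u s + \<bar>P x - P s\<bar>) ` S)" for x
  proof (rule bdd_belowI2)
    fix s assume "s \<in> S"
    then show "u s0 - \<bar>P x - P s0\<bar> \<le> u s + \<bar>P x - P s\<bar>" using u[OF s0, of s] by linarith
  qed
  show "F s = u s" if "s \<in> S" for s
  proof (rule antisym)
    show "F s \<le> u s" unfolding F_def using cINF_lower[OF bdd that, of s] by simp
    show "u s \<le> F s" unfolding F_def
    proof (rule cINF_greatest[OF S])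
      fix t assume "t \<in> S"
      then show "u s \<le> u t + \<bar>P s - P t\<bar>" using u[OF that, of t] by linarith
    qed
  qed
  have "F x \<le> F y + \<bar>P x - P y\<bar>" for x y
  proof -
    have "F x - \<bar>P x - P y\<bar> \<le> F y" unfolding F_def[of y]
    proof (rule cINF_greatest[OF S])
      fix s assume "s \<in> S"
      then have "F x \<le> u s + \<bar>P x - P s\<bar>" unfolding F_def by (rule cINF_lower[OF bdd])
      then show "F x - \<bar>P x - P y\<bar> \<le> u s + \<bar>P y - P s\<bar>" by linarith
    qed
    then show ?thesis by linarith
  qed
  from this[of x y for x y] this[of y x for x y] show "\<bar>F x - F y\<bar> \<le> \<bar>P x - P y\<bar>" for x y
    by (smt (verit))
qed

text \<open>With \<open>P\<close> a primitive of \<open>G\<close> times the speed, the hypotheses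
  say that \<open>f\<close> along the curve is 1-Lipschitz for |P s - P t| between rational times
  and between each rational and almost every time. The bound then holds between any two good times,
  and McShane's extension fills in the remaining null set.\<close>

lemma sobolev_path_exists:
  fixes \<gamma> :: "real \<Rightarrow> 'a::{metric_space, second_countable_topology}"
  assumes \<gamma>: "\<gamma> \<in> mspace curves" and ac: "abs_cont_curve \<gamma>"
    and G: "G \<in> borel_measurable borel" "\<And>x. 0 \<le> G x" and fin: "curve_integral G \<gamma> 0 1 < \<infinity>"
    and rat: "\<And>q r. q \<in> \<rat> \<inter> {0..1} \<Longrightarrow> r \<in> \<rat> \<inter> {0..1} \<Longrightarrow> q \<le> r \<Longrightarrow>
      ennreal \<bar>f (\<gamma> r) - f (\<gamma> q)\<bar> \<le> curve_integral G \<gamma> q r"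
    and ae: "\<And>q. q \<in> \<rat> \<inter> {0..1} \<Longrightarrow> AE t in lborel. t \<in> {0..1} \<longrightarrow>
      ennreal \<bar>f (\<gamma> t) - f (\<gamma> q)\<bar> \<le> curve_integral G \<gamma> (min q t) (max q t)"
  shows "\<exists>F. sobolev_path f G \<gamma> F"
proof -
  have [measurable]: "eval_clamped \<gamma> \<in> borel_measurable borel" "lower_speed \<gamma> \<in> borel_measurable borel"
    "G \<in> borel_measurable borel"
    using continuous_on_eval_clamped[OF \<gamma>] G(1)
    by (auto intro: borel_measurable_continuous_onI lower_speed_measurable_continuous)
  define K where "K t = indicator {0..1} t * (G (eval_clamped \<gamma> t) * enn2real (lower_speed \<gamma> t))" for t
  have K_nn: "0 \<le> K t" for t by (simp add: K_def G)
  have [measurable]: "K \<in> borel_measurable borel" unfolding K_def[abs_def] by measurable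
  have K_ae: "AE t in lborel. ennreal (K t) = ennreal (G (eval_clamped \<gamma> t)) * lower_speed \<gamma> t * indicator {0..1} t"
    using abs_cont_lower_speed(3)[OF ac]
    by eventually_elim (auto simp: K_def ennreal_mult G split: split_indicator)
  have K: "integrable lborel K"
  proof (rule integrableI_nonneg)
    have "(\<integral>\<^sup>+t. ennreal (K t) \<partial>lborel) = curve_integral G \<gamma> 0 1"
      unfolding curve_integral_def using K_ae by (rule nn_integral_cong_AE)
    then show "(\<integral>\<^sup>+t. ennreal (K t) \<partial>lborel) < \<infinity>" using fin by simp
  qed (use K_nn in auto)
  obtain P where Pc: "\<And>x. isCont P x" and Pmono: "\<And>x y. x \<le> y \<Longrightarrow> P x \<le> P y"
    and P: "\<And>x y. x \<le> y \<Longrightarrow> P y - P x = (LINT t:{x..y}|lborel. K t)"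
    by (rule integral_primitive[OF K K_nn]) (rule that)
  have ci: "curve_integral G \<gamma> x y = ennreal (P y - P x)" if "0 \<le> x" "x \<le> y" "y \<le> 1" for x y
  proof -
    have "curve_integral G \<gamma> x y = (\<integral>\<^sup>+t\<in>{x..y}. ennreal (K t) \<partial>lborel)"
      unfolding curve_integral_def using K_ae
      by (intro nn_integral_cong_AE, eventually_elim) (use that in \<open>auto split: split_indicator\<close>)
    then show ?thesis using nn_integral_Icc_eq[OF K K_nn] P[OF that(2)] by simp
  qed
  define Q where "Q = \<rat> \<inter> {0..1::real}"
  define S where "S = {t \<in> {0..1}. \<forall>q\<in>Q. \<bar>f (\<gamma> t) - f (\<gamma> q)\<bar> \<le> \<bar>P t - P q\<bar>}"
  have QS: "Q \<subseteq> S"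
  proof
    fix r assume r: "r \<in> Q"
    have "\<bar>f (\<gamma> r) - f (\<gamma> q)\<bar> \<le> \<bar>P r - P q\<bar>" if q: "q \<in> Q" for q
    proof (cases "q \<le> r")
      case True
      then show ?thesis using rat[of q r] r q ci[of q r] Pmono[OF True] by (simp add: Q_def)
    next
      case False
      then show ?thesis using rat[of r q] r q ci[of r q] Pmono[of r q] by (simp add: Q_def abs_minus_commute)
    qed
    then show "r \<in> S" using r by (auto simp: S_def Q_def)
  qed
  have "countable Q" unfolding Q_def using countable_rat by blast
  then have "AE t in lborel. \<forall>q\<in>Q. t \<in> {0..1} \<longrightarrow>
      ennreal \<bar>f (\<gamma> t) - f (\<gamma> q)\<bar> \<le> curve_integral G \<gamma> (min q t) (max q t)"
    using ae by (subst AE_ball_countable) (auto simp: Q_def)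
  then have AE_S: "AE t in lborel. t \<in> {0..1} \<longrightarrow> t \<in> S"
  proof (eventually_elim, intro impI)
    fix t :: real assume *: "\<forall>q\<in>Q. t \<in> {0..1} \<longrightarrow>
      ennreal \<bar>f (\<gamma> t) - f (\<gamma> q)\<bar> \<le> curve_integral G \<gamma> (min q t) (max q t)" and t: "t \<in> {0..1}"
    have "\<bar>f (\<gamma> t) - f (\<gamma> q)\<bar> \<le> \<bar>P t - P q\<bar>" if q: "q \<in> Q" for q
    proof -
      have "ennreal \<bar>f (\<gamma> t) - f (\<gamma> q)\<bar> \<le> curve_integral G \<gamma> (min q t) (max q t)"
        using * q t by blast
      also have "\<dots> = ennreal (P (max q t) - P (min q t))"
        using q t by (intro ci) (auto simp: Q_def)
      finally have "ennreal \<bar>f (\<gamma> t) - f (\<gamma> q)\<bar> \<le> ennreal (P (max q t) - P (min q t))" .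
      moreover have "P (max q t) - P (min q t) = \<bar>P t - P q\<bar>"
        using Pmono[of q t] Pmono[of t q] by (auto simp: max_def min_def)
      ultimately show ?thesis by simp
    qed
    then show "t \<in> S" using t by (auto simp: S_def)
  qed
  \<comment> \<open>The two times are compared through a rational \<open>q\<close> close to
    \<open>t\<close>; by continuity of \<open>P\<close> the detour costs at most
    \<open>e\<close>.\<close>
  have SS: "\<bar>f (\<gamma> s) - f (\<gamma> t)\<bar> \<le> \<bar>P s - P t\<bar>" if s: "s \<in> S" and t: "t \<in> S" for s t
  proof (rule field_le_epsilon)
    fix e :: real assume "0 < e"
    then have "0 < e / 2" by simp
    then obtain d where d: "d > 0" "\<And>x. dist x t < d \<Longrightarrow> dist (P x) (P t) < e / 2"
      using Pc[of t] unfolding continuous_at_eps_delta by blast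
    have "t \<in> closure (\<rat> \<inter> {0<..<1})"
      using t closure_open_Int_superset[of "{0<..<1::real}" \<rat>] by (simp add: S_def Rats_closure_real Int_commute)
    then obtain q where q: "q \<in> \<rat> \<inter> {0<..<1}" "dist q t < d" using d(1) closure_approachable by blast
    then have "q \<in> Q" by (auto simp: Q_def)
    then have "\<bar>f (\<gamma> s) - f (\<gamma> q)\<bar> \<le> \<bar>P s - P q\<bar>" "\<bar>f (\<gamma> t) - f (\<gamma> q)\<bar> \<le> \<bar>P t - P q\<bar>"
      using s t by (auto simp: S_def)
    moreover have "\<bar>P q - P t\<bar> < e / 2" using d(2)[OF q(2)] by (simp add: dist_real_def)
    ultimately show "\<bar>f (\<gamma> s) - f (\<gamma> t)\<bar> \<le> \<bar>P s - P t\<bar> + e" by linarith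
  qed
  \<comment> \<open>Being rational, the endpoints are good times; an almost-everywhere statement
    would not reach them.\<close>
  have "0 \<in> Q" "1 \<in> Q" by (auto simp: Q_def)
  then have S01: "0 \<in> S" "1 \<in> S" using QS by auto
  then obtain F where F: "\<And>s. s \<in> S \<Longrightarrow> F s = f (\<gamma> s)" "\<And>x y. \<bar>F x - F y\<bar> \<le> \<bar>P x - P y\<bar>"
    using McShane_extension[of S "\<lambda>s. f (\<gamma> s)" P] SS by blast
  have "integral_bounded F K"
    unfolding integral_bounded_def
  proof (intro conjI allI impI K K_nn)
    fix x y :: real assume "x \<le> y"
    then show "\<bar>F y - F x\<bar> \<le> (LINT t:{x..y}|lborel. K t)"
      using F(2)[of y x] P[of x y] Pmono[of x y] by linarith
  qed
  moreover have "AE t in lborel. t \<in> {0..1} \<longrightarrow> ennreal (K t) = ennreal (G (\<gamma> t)) * lower_speed \<gamma> t"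
    using K_ae by eventually_elim auto
  moreover have "AE t in lborel. t \<in> {0..1} \<longrightarrow> F t = f (\<gamma> t)"
    using AE_S by eventually_elim (auto simp: F(1))
  ultimately have "sobolev_path f G \<gamma> F"
    unfolding sobolev_path_def using F(1) S01 by blast
  then show ?thesis by blast
qed

text \<open>There are countably many pairs of rational times, so all their segment bounds hold along
  almost every curve. For a rational against an arbitrary time the exceptional curves vary with the
  time, and Fubini exchanges the quantifiers.\<close>

theorem AE_sobolev_path:
  fixes m :: "'a::{metric_space, second_countable_topology} measure"
  assumes m: "sets m = sets borel"
    and f: "f \<in> borel_measurable borel" and wug: "weak_upper_gradient m f G" and \<pi>: "test_plan m \<pi>"
  shows "AE \<gamma> in \<pi>. \<gamma> \<in> mspace curves \<and> abs_cont_curve \<gamma> \<and> (\<exists>F. sobolev_path f G \<gamma> F)"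
proof -
  note G = weak_upper_gradientD[OF m wug]
  have sets_pi [measurable_cong]: "sets \<pi> = sets curves_borel" using test_plan_sets[OF \<pi>] .
  interpret prob_space \<pi> using \<pi> by (rule test_plan_prob)
  interpret pair_sigma_finite \<pi> lborel ..
  define Q where "Q = \<rat> \<inter> {0..1::real}"
  have cQ: "countable Q" unfolding Q_def using countable_rat by blast
  have fin: "AE \<gamma> in \<pi>. curve_integral G \<gamma> 0 1 < \<infinity>"
  proof -
    have "AE \<gamma> in \<pi>. curve_integral G \<gamma> 0 1 \<noteq> \<infinity>"
      by (rule nn_integral_PInf_AE)
         (use curve_integral_finite[OF \<pi> m G] in \<open>auto intro!: measurable_curve_integral[OF G(1)]\<close>)
    then show ?thesis by (simp add: less_top)
  qed
  have "AE \<gamma> in \<pi>. \<forall>q\<in>Q. \<forall>r\<in>Q. q \<le> r \<longrightarrow> ennreal \<bar>f (\<gamma> r) - f (\<gamma> q)\<bar> \<le> curve_integral G \<gamma> q r"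
    using AE_segment_bound[OF m f wug \<pi>] cQ
    by (auto simp: AE_ball_countable Q_def intro!: AE_impI)
  moreover have "AE \<gamma> in \<pi>. \<forall>q\<in>Q. AE t in lborel. t \<in> {0..1} \<longrightarrow>
      ennreal \<bar>f (\<gamma> t) - f (\<gamma> q)\<bar> \<le> curve_integral G \<gamma> (min q t) (max q t)"
  proof (subst AE_ball_countable[OF cQ], intro ballI)
    fix q assume q: "q \<in> Q"
    \<comment> \<open>Stated with \<open>eval_clamped\<close>, whose joint measurability in curve
      and time the exchange of quantifiers requires.\<close>
    define R where "R \<gamma> t \<longleftrightarrow> (t \<in> {0..1} \<longrightarrow>
      ennreal \<bar>f (eval_clamped \<gamma> t) - f (eval_clamped \<gamma> q)\<bar> \<le> curve_integral G \<gamma> (min q t) (max q t))" for \<gamma> t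
    have [measurable]: "(\<lambda>p. curve_integral G (fst p) (min q (snd p)) (max q (snd p))) \<in> borel_measurable (\<pi> \<Otimes>\<^sub>M lborel)"
      by (rule measurable_curve_integral[OF G(1)]) measurable
    have [measurable]: "(\<lambda>p. eval_clamped (fst p) (snd p) :: 'a) \<in> borel_measurable (\<pi> \<Otimes>\<^sub>M lborel)"
      using measurable_eval_curves_pair by (simp add: sets_pi cong: measurable_cong_sets sets_pair_measure_cong)
    note [measurable] = f
    have meas: "{p \<in> space (\<pi> \<Otimes>\<^sub>M lborel). R (fst p) (snd p)} \<in> sets (\<pi> \<Otimes>\<^sub>M lborel)"
      unfolding R_def atLeastAtMost_iff by measurable
    have "AE \<gamma> in \<pi>. R \<gamma> t" for t
    proof (cases "t \<in> {0..1}")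
      case t: True
      show ?thesis
      proof (cases "q \<le> t")
        case True
        then show ?thesis using AE_segment_bound[OF m f wug \<pi>, of q t] q t by (simp add: R_def Q_def)
      next
        case False
        then show ?thesis using AE_segment_bound[OF m f wug \<pi>, of t q] q t
          by (simp add: R_def Q_def abs_minus_commute)
      qed
    qed (auto simp: R_def)
    then have "AE t in lborel. AE \<gamma> in \<pi>. R \<gamma> t" by simp
    then have "AE \<gamma> in \<pi>. AE t in lborel. R \<gamma> t"
      using AE_commute[OF meas] by simp
    then show "AE \<gamma> in \<pi>. AE t in lborel. t \<in> {0..1} \<longrightarrow>
      ennreal \<bar>f (\<gamma> t) - f (\<gamma> q)\<bar> \<le> curve_integral G \<gamma> (min q t) (max q t)"
    proof (rule eventually_mono)
      fix \<gamma> assume "AE t in lborel. R \<gamma> t"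
      then show "AE t in lborel. t \<in> {0..1} \<longrightarrow>
        ennreal \<bar>f (\<gamma> t) - f (\<gamma> q)\<bar> \<le> curve_integral G \<gamma> (min q t) (max q t)"
        by eventually_elim (use q in \<open>auto simp: R_def Q_def\<close>)
    qed
  qed
  ultimately show ?thesis using fin AE_test_plan_abs_cont[OF \<pi>]
  proof eventually_elim
    case (elim \<gamma>)
    then have "\<exists>F. sobolev_path f G \<gamma> F"
      by (intro sobolev_path_exists G) (auto simp: Q_def)
    then show ?case using elim by simp
  qed
qed

section \<open>Calculus along a single curve\<close>

lemma integral_bounded_isCont:
  assumes "integral_bounded F g"
  shows "isCont F x"
proof -
  have g: "integrable lborel g" "\<And>x. 0 \<le> g x"
    and F: "\<And>x y. x \<le> y \<Longrightarrow> \<bar>F y - F x\<bar> \<le> (LINT t:{x..y}|lborel. g t)"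
    using assms by (auto simp: integral_bounded_def)
  obtain P where Pc: "\<And>x. isCont P x" and Pmono: "\<And>x y. x \<le> y \<Longrightarrow> P x \<le> P y"
    and P: "\<And>x y. x \<le> y \<Longrightarrow> P y - P x = (LINT t:{x..y}|lborel. g t)"
    by (rule integral_primitive[OF g]) (rule that)
  have le: "norm (F y - F x) \<le> \<bar>P y - P x\<bar>" for y
    using F[of x y] F[of y x] P[of x y] P[of y x] by (cases "x \<le> y") auto
  have "((\<lambda>s. P s - P x) \<longlongrightarrow> 0) (at x)" using Pc[of x] unfolding isCont_def by (rule LIM_zero)
  then have "((\<lambda>s. \<bar>P s - P x\<bar>) \<longlongrightarrow> 0) (at x)" by (rule tendsto_rabs_zero)
  then have "((\<lambda>s. F s - F x) \<longlongrightarrow> 0) (at x)"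
    by (rule Lim_null_comparison[rotated]) (simp add: le[simplified])
  then show ?thesis unfolding isCont_def by (rule LIM_zero_cancel)
qed

lemma integral_bounded_bounded:
  assumes "integral_bounded F g"
  shows "\<bar>F x\<bar> \<le> \<bar>F 0\<bar> + (LINT t|lborel. g t)"
proof -
  have g: "integrable lborel g" "\<And>x. 0 \<le> g x"
    and F: "\<And>x y. x \<le> y \<Longrightarrow> \<bar>F y - F x\<bar> \<le> (LINT t:{x..y}|lborel. g t)"
    using assms by (auto simp: integral_bounded_def)
  have "(LINT t:{x..y}|lborel. g t) \<le> (LINT t|lborel. g t)" for x y
    unfolding set_lebesgue_integral_def
    by (rule integral_mono[OF integrable_mult_indicator[OF _ g(1)] g(1)])
       (auto split: split_indicator simp: g(2))
  then show ?thesis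
    using F[of 0 x] F[of x 0] by (smt (verit))
qed

text \<open>The set where the functions differ is open, and a nonempty open set has positive
  measure. On the open interval equality also gives equality of derivatives, which serves to compare
  two paths of one function.\<close>

lemma continuous_AE_eq_on_Icc:
  fixes F H :: "real \<Rightarrow> real"
  assumes F: "\<And>x. isCont F x" and H: "\<And>x. isCont H x"
    and ae: "AE t in lborel. t \<in> {0..1} \<longrightarrow> F t = H t" and t: "t \<in> {0<..<1}"
  shows "F t = H t"
proof (rule ccontr)
  assume ne: "F t \<noteq> H t"
  have "continuous_on UNIV (\<lambda>x. F x - H x)"
    using F H by (intro continuous_intros continuous_at_imp_continuous_on) auto
  then have "open ((\<lambda>x. F x - H x) -` (- {0}) \<inter> {0<..<1})"
    by (intro open_Int open_vimage) auto
  moreover have "t \<in> (\<lambda>x. F x - H x) -` (- {0}) \<inter> {0<..<1}" using ne t by auto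
  ultimately obtain e where e: "e > 0" "ball t e \<subseteq> (\<lambda>x. F x - H x) -` (- {0}) \<inter> {0<..<1}"
    using open_contains_ball by blast
  have "AE x in lborel. x \<notin> ball t e"
    using ae by eventually_elim (use e(2) in force)
  then have "ball t e \<in> null_sets lborel" by (simp add: AE_iff_null_sets)
  moreover have "emeasure lborel (ball t e) = ennreal (2 * e)"
    using e(1) by (simp add: ball_eq_greaterThanLessThan)
  ultimately show False using e(1) by (simp add: null_sets_def)
qed

text \<open>Differentiability at y is a Cauchy criterion for difference quotients. Continuity of
  \<phi> reduces the increments to rational ones, leaving countable quantifiers over Borel
  conditions; the derivative is then a limit of Borel functions.\<close>

lemma Borel_differentiable:
  fixes \<phi> :: "real \<Rightarrow> real"
  assumes cont: "continuous_on UNIV \<phi>"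
  shows "Measurable.pred borel (\<lambda>y. \<phi> differentiable (at y))"
    and "(\<lambda>y. if \<phi> differentiable (at y) then deriv \<phi> y else 0) \<in> borel_measurable borel"
proof -
  have [measurable]: "\<phi> \<in> borel_measurable borel" using cont by (rule borel_measurable_continuous_onI)
  \<comment> \<open>The Cauchy condition multiplied by \<open>h * h'\<close>: free of division, it
    is continuous in each increment, at 0 as well, as the extension from rational to real increments
    demands.\<close>
  define C where "C y k \<delta> h h' \<longleftrightarrow> (\<bar>h\<bar> < \<delta> \<and> \<bar>h'\<bar> < \<delta> \<longrightarrow>
    \<bar>(\<phi> (y + h) - \<phi> y) * h' - (\<phi> (y + h') - \<phi> y) * h\<bar> \<le> \<bar>h\<bar> * \<bar>h'\<bar> / real (Suc k))"
    for y \<delta> h h' :: real and k :: nat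
  have iff: "\<phi> differentiable (at y) \<longleftrightarrow> (\<forall>k. \<exists>n. \<forall>h h' :: rat. C y k (1 / real (Suc n)) (of_rat h) (of_rat h'))" for y
  proof
    assume "\<phi> differentiable (at y)"
    then obtain D where "(\<phi> has_real_derivative D) (at y)" using real_differentiable_def by blast
    then have D: "((\<lambda>h. (\<phi> (y + h) - \<phi> y) / h) \<longlongrightarrow> D) (at 0)" by (simp add: DERIV_def)
    show "\<forall>k. \<exists>n. \<forall>h h' :: rat. C y k (1 / real (Suc n)) (of_rat h) (of_rat h')"
    proof
      fix k :: nat
      have "0 < 1 / (2 * real (Suc k))" by simp
      from tendstoD[OF D this] obtain d where d: "d > 0"
        "\<And>h. h \<noteq> 0 \<Longrightarrow> \<bar>h\<bar> < d \<Longrightarrow> \<bar>(\<phi> (y + h) - \<phi> y) / h - D\<bar> < 1 / (2 * real (Suc k))"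
        by (auto simp: eventually_at dist_real_def)
      obtain n where n: "1 / real (Suc n) < d" using nat_approx_posE[OF d(1)] by blast
      have "C y k (1 / real (Suc n)) h h'" for h h'
      proof (cases "h = 0 \<or> h' = 0")
        case False
        show ?thesis unfolding C_def
        proof
          assume "\<bar>h\<bar> < 1 / real (Suc n) \<and> \<bar>h'\<bar> < 1 / real (Suc n)"
          then have "\<bar>(\<phi> (y + h) - \<phi> y) / h - D\<bar> < 1 / (2 * real (Suc k))" "\<bar>(\<phi> (y + h') - \<phi> y) / h' - D\<bar> < 1 / (2 * real (Suc k))"
            using d(2) n False by auto
          then have "\<bar>(\<phi> (y + h) - \<phi> y) / h - (\<phi> (y + h') - \<phi> y) / h'\<bar> \<le> 1 / (2 * real (Suc k)) + 1 / (2 * real (Suc k))"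
            by linarith
          also have "\<dots> = 1 / real (Suc k)" by (simp add: field_simps)
          finally have *: "\<bar>(\<phi> (y + h) - \<phi> y) / h - (\<phi> (y + h') - \<phi> y) / h'\<bar> \<le> 1 / real (Suc k)" .
          have "(\<phi> (y + h) - \<phi> y) * h' - (\<phi> (y + h') - \<phi> y) * h
            = ((\<phi> (y + h) - \<phi> y) / h - (\<phi> (y + h') - \<phi> y) / h') * (h * h')"
            using False by (simp add: field_simps)
          then have "\<bar>(\<phi> (y + h) - \<phi> y) * h' - (\<phi> (y + h') - \<phi> y) * h\<bar>
            = \<bar>(\<phi> (y + h) - \<phi> y) / h - (\<phi> (y + h') - \<phi> y) / h'\<bar> * (\<bar>h\<bar> * \<bar>h'\<bar>)"
            by (simp only: abs_mult)
          also have "\<dots> \<le> 1 / real (Suc k) * (\<bar>h\<bar> * \<bar>h'\<bar>)"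
            using * by (rule mult_right_mono) simp
          finally show "\<bar>(\<phi> (y + h) - \<phi> y) * h' - (\<phi> (y + h') - \<phi> y) * h\<bar> \<le> \<bar>h\<bar> * \<bar>h'\<bar> / real (Suc k)"
            by simp
        qed
      qed (auto simp: C_def)
      then show "\<exists>n. \<forall>h h' :: rat. C y k (1 / real (Suc n)) (of_rat h) (of_rat h')" by blast
    qed
  next
    assume *: "\<forall>k. \<exists>n. \<forall>h h' :: rat. C y k (1 / real (Suc n)) (of_rat h) (of_rat h')"
    have real: "\<exists>\<delta>>0. \<forall>h h'. h \<noteq> 0 \<longrightarrow> h' \<noteq> 0 \<longrightarrow> \<bar>h\<bar> < \<delta> \<longrightarrow> \<bar>h'\<bar> < \<delta> \<longrightarrow>
      \<bar>(\<phi> (y + h) - \<phi> y) / h - (\<phi> (y + h') - \<phi> y) / h'\<bar> \<le> 1 / real (Suc k)" for k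
    proof -
      obtain n where n: "\<And>h h' :: rat. C y k (1 / real (Suc n)) (of_rat h) (of_rat h')" using * by blast
      define \<delta> where "\<delta> = 1 / real (Suc n)"
      have "\<delta> > 0" by (simp add: \<delta>_def)
      define \<Phi> where "\<Phi> h h' = \<bar>(\<phi> (y + h) - \<phi> y) * h' - (\<phi> (y + h') - \<phi> y) * h\<bar> - \<bar>h\<bar> * \<bar>h'\<bar> / real (Suc k)" for h h'
      have c\<phi>: "continuous_on A (\<lambda>h. \<phi> (y + h))" for A
        by (rule continuous_on_compose2[OF cont]) (auto intro!: continuous_intros)
      have cl: "closure (\<rat> \<inter> {-\<delta><..<\<delta>}) = {-\<delta>..\<delta>}"
        using closure_open_Int_superset[of "{-\<delta><..<\<delta>}" \<rat>] \<open>\<delta> > 0\<close> by (simp add: Rats_closure_real Int_commute)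
      have 0: "\<Phi> h h' \<le> 0" if "h \<in> \<rat> \<inter> {-\<delta><..<\<delta>}" "h' \<in> \<rat> \<inter> {-\<delta><..<\<delta>}" for h h'
      proof -
        have "h \<in> \<rat>" "h' \<in> \<rat>" using that by auto
        then obtain x x' where x: "h = of_rat x" "h' = of_rat x'" by (elim Rats_cases)
        have "\<bar>h\<bar> < \<delta>" "\<bar>h'\<bar> < \<delta>" using that by (auto simp: abs_less_iff)
        then show ?thesis using n[of x x'] unfolding C_def \<Phi>_def \<delta>_def[symmetric] x[symmetric] by simp
      qed
      have 1: "\<Phi> h h' \<le> 0" if "h \<in> {-\<delta>..\<delta>}" "h' \<in> \<rat> \<inter> {-\<delta><..<\<delta>}" for h h'
      proof (rule continuous_le_on_closure[where S = "\<rat> \<inter> {-\<delta><..<\<delta>}" and f = "\<lambda>h. \<Phi> h h'"])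
        show "continuous_on (closure (\<rat> \<inter> {-\<delta><..<\<delta>})) (\<lambda>h. \<Phi> h h')"
          unfolding \<Phi>_def by (intro continuous_intros c\<phi>) auto
      qed (use that 0 cl in auto)
      have 2: "\<Phi> h h' \<le> 0" if "h \<in> {-\<delta>..\<delta>}" "h' \<in> {-\<delta>..\<delta>}" for h h'
      proof (rule continuous_le_on_closure[where S = "\<rat> \<inter> {-\<delta><..<\<delta>}" and f = "\<lambda>h'. \<Phi> h h'"])
        show "continuous_on (closure (\<rat> \<inter> {-\<delta><..<\<delta>})) (\<lambda>h'. \<Phi> h h')"
          unfolding \<Phi>_def by (intro continuous_intros c\<phi>) auto
      qed (use that 1 cl in auto)
      show ?thesis
      proof (intro exI[of _ \<delta>] conjI allI impI \<open>\<delta> > 0\<close>)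
        fix h h' :: real assume h: "h \<noteq> 0" "h' \<noteq> 0" "\<bar>h\<bar> < \<delta>" "\<bar>h'\<bar> < \<delta>"
        then have le: "\<bar>(\<phi> (y + h) - \<phi> y) * h' - (\<phi> (y + h') - \<phi> y) * h\<bar> \<le> \<bar>h\<bar> * \<bar>h'\<bar> / real (Suc k)"
        proof -
          have "h \<in> {-\<delta>..\<delta>}" "h' \<in> {-\<delta>..\<delta>}" using h(3,4) by (auto simp: abs_less_iff)
          then show ?thesis using 2[of h h'] by (simp add: \<Phi>_def)
        qed
        have "(\<phi> (y + h) - \<phi> y) / h - (\<phi> (y + h') - \<phi> y) / h'
          = ((\<phi> (y + h) - \<phi> y) * h' - (\<phi> (y + h') - \<phi> y) * h) / (h * h')"
          using h by (simp add: field_simps)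
        then have "\<bar>(\<phi> (y + h) - \<phi> y) / h - (\<phi> (y + h') - \<phi> y) / h'\<bar>
          = \<bar>(\<phi> (y + h) - \<phi> y) * h' - (\<phi> (y + h') - \<phi> y) * h\<bar> / (\<bar>h\<bar> * \<bar>h'\<bar>)"
          by (simp only: abs_divide abs_mult)
        also have "\<dots> \<le> (\<bar>h\<bar> * \<bar>h'\<bar> / real (Suc k)) / (\<bar>h\<bar> * \<bar>h'\<bar>)"
          using le by (rule divide_right_mono) simp
        also have "\<dots> = 1 / real (Suc k)" using h by simp
        finally show "\<bar>(\<phi> (y + h) - \<phi> y) / h - (\<phi> (y + h') - \<phi> y) / h'\<bar> \<le> 1 / real (Suc k)" .
      qed
    qed
    \<comment> \<open>The Cauchy criterion gives a limit along the increments
      \<open>1 / Suc j\<close>; applied once more, it compares all small increments with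
      these.\<close>
    define q where "q j = (\<phi> (y + 1 / real (Suc j)) - \<phi> y) / (1 / real (Suc j))" for j
    have small: "\<forall>\<^sub>F j in sequentially. 1 / real (Suc j) < \<delta>" if "\<delta> > 0" for \<delta>
      using order_tendstoD(2)[OF LIMSEQ_inverse_real_of_nat that] by (simp add: inverse_eq_divide)
    have "Cauchy q"
    proof (rule CauchyI')
      fix e :: real assume "e > 0"
      then obtain k where k: "1 / real (Suc k) < e" using nat_approx_posE by blast
      obtain \<delta> where \<delta>: "\<delta> > 0" "\<And>h h'. h \<noteq> 0 \<Longrightarrow> h' \<noteq> 0 \<Longrightarrow> \<bar>h\<bar> < \<delta> \<Longrightarrow> \<bar>h'\<bar> < \<delta> \<Longrightarrow>
         \<bar>(\<phi> (y + h) - \<phi> y) / h - (\<phi> (y + h') - \<phi> y) / h'\<bar> \<le> 1 / real (Suc k)" using real[of k] by blast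
      obtain M where M: "\<And>j. j \<ge> M \<Longrightarrow> 1 / real (Suc j) < \<delta>"
        using small[OF \<delta>(1)] by (auto simp: eventually_sequentially)
      have "dist (q i) (q j) < e" if "i \<ge> M" "j > i" for i j
      proof -
        have "\<bar>q i - q j\<bar> \<le> 1 / real (Suc k)"
          unfolding q_def by (rule \<delta>(2)) (use M[of i] M[of j] that in auto)
        then show ?thesis using k by (simp add: dist_real_def)
      qed
      then show "\<exists>M. \<forall>i\<ge>M. \<forall>j>i. dist (q i) (q j) < e" by blast
    qed
    then obtain D where D: "q \<longlonglongrightarrow> D" using Cauchy_convergent convergent_def by blast
    have "((\<lambda>h. (\<phi> (y + h) - \<phi> y) / h) \<longlongrightarrow> D) (at 0)"
    proof (rule tendstoI)
      fix e :: real assume "e > 0"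
      then obtain k where k: "1 / real (Suc k) < e" using nat_approx_posE by blast
      obtain \<delta> where \<delta>: "\<delta> > 0" "\<And>h h'. h \<noteq> 0 \<Longrightarrow> h' \<noteq> 0 \<Longrightarrow> \<bar>h\<bar> < \<delta> \<Longrightarrow> \<bar>h'\<bar> < \<delta> \<Longrightarrow>
         \<bar>(\<phi> (y + h) - \<phi> y) / h - (\<phi> (y + h') - \<phi> y) / h'\<bar> \<le> 1 / real (Suc k)" using real[of k] by blast
      have "\<bar>(\<phi> (y + h) - \<phi> y) / h - D\<bar> \<le> 1 / real (Suc k)" if h: "h \<noteq> 0" "\<bar>h\<bar> < \<delta>" for h
      proof (rule tendsto_upperbound)
        show "(\<lambda>j. \<bar>(\<phi> (y + h) - \<phi> y) / h - q j\<bar>) \<longlonglongrightarrow> \<bar>(\<phi> (y + h) - \<phi> y) / h - D\<bar>"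
          using D by (intro tendsto_intros)
        show "\<forall>\<^sub>F j in sequentially. \<bar>(\<phi> (y + h) - \<phi> y) / h - q j\<bar> \<le> 1 / real (Suc k)"
          using small[OF \<delta>(1)]
        proof eventually_elim
          case (elim j)
          show ?case unfolding q_def by (rule \<delta>(2)) (use h elim in auto)
        qed
      qed simp
      then have "\<And>h. h \<noteq> 0 \<Longrightarrow> \<bar>h\<bar> < \<delta> \<Longrightarrow> dist ((\<phi> (y + h) - \<phi> y) / h) D < e"
        using k by (fastforce simp: dist_real_def)
      then show "\<forall>\<^sub>F h in at 0. dist ((\<phi> (y + h) - \<phi> y) / h) D < e"
        unfolding eventually_at using \<delta>(1) by (intro exI[of _ \<delta>]) auto
    qed
    then show "\<phi> differentiable (at y)" unfolding real_differentiable_def DERIV_def by blast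
  qed
  show pred: "Measurable.pred borel (\<lambda>y. \<phi> differentiable (at y))"
    unfolding iff C_def by measurable
  show "(\<lambda>y. if \<phi> differentiable (at y) then deriv \<phi> y else 0) \<in> borel_measurable borel"
  proof (rule borel_measurable_LIMSEQ_metric)
    show "(\<lambda>y. if \<phi> differentiable (at y) then (\<phi> (y + 1 / real (Suc n)) - \<phi> y) / (1 / real (Suc n)) else 0)
      \<in> borel_measurable borel" for n
      using pred by measurable
    fix y :: real
    show "(\<lambda>n. if \<phi> differentiable (at y) then (\<phi> (y + 1 / real (Suc n)) - \<phi> y) / (1 / real (Suc n)) else 0)
      \<longlonglongrightarrow> (if \<phi> differentiable (at y) then deriv \<phi> y else 0)"
    proof (cases "\<phi> differentiable (at y)")
      case True
      then have "(\<phi> has_real_derivative deriv \<phi> y) (at y)"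
        by (simp add: DERIV_deriv_iff_real_differentiable)
      moreover have "filterlim (\<lambda>n. 1 / real (Suc n)) (at 0) sequentially"
        using LIMSEQ_inverse_real_of_nat by (simp add: filterlim_at inverse_eq_divide)
      ultimately have "(\<lambda>n. (\<phi> (y + 1 / real (Suc n)) - \<phi> y) / (1 / real (Suc n))) \<longlonglongrightarrow> deriv \<phi> y"
        unfolding DERIV_def by (rule filterlim_compose)
      then show ?thesis using True by simp
    qed simp
  qed
qed

lemma lipschitz_abs_deriv_le:
  fixes \<phi> :: "real \<Rightarrow> real"
  assumes lip: "L-lipschitz_on UNIV \<phi>" and D: "(\<phi> has_real_derivative D) (at y)"
  shows "\<bar>D\<bar> \<le> L"
proof (rule tendsto_upperbound)
  show "((\<lambda>h. \<bar>(\<phi> (y + h) - \<phi> y) / h\<bar>) \<longlongrightarrow> \<bar>D\<bar>) (at 0)"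
    using D unfolding DERIV_def by (rule tendsto_rabs)
  have "\<bar>(\<phi> (y + h) - \<phi> y) / h\<bar> \<le> L" if "h \<noteq> 0" for h
    using lipschitz_onD[OF lip, of "y + h" y] that by (simp add: dist_real_def abs_divide divide_le_eq)
  then show "\<forall>\<^sub>F h in at 0. \<bar>(\<phi> (y + h) - \<phi> y) / h\<bar> \<le> L"
    by (auto simp: eventually_at intro!: exI[of _ 1])
qed simp

section \<open>Derivative bounds along Sobolev paths\<close>

lemma sobolev_path_derivative_le:
  assumes F: "sobolev_path f G \<gamma> F"
  shows "AE t in lborel. t \<in> {0..1} \<longrightarrow> (\<forall>D. (F has_real_derivative D) (at t) \<longrightarrow>
    ennreal \<bar>D\<bar> \<le> ennreal (G (\<gamma> t)) * lower_speed \<gamma> t)"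
proof -
  obtain g where g: "integral_bounded F g"
    "AE t in lborel. t \<in> {0..1} \<longrightarrow> ennreal (g t) = ennreal (G (\<gamma> t)) * lower_speed \<gamma> t"
    using F by (auto simp: sobolev_path_def)
  from integral_bounded_derivative_le[OF g(1)] g(2) show ?thesis
    by eventually_elim (metis ennreal_leI)
qed

text \<open>The common last step of the chain rule, product, minimum and locality bounds: after it,
  only pointwise derivatives of real functions remain to be estimated.\<close>

lemma endpoint_bound_of_derivative:
  assumes H: "integral_bounded H h" "H 0 = u (\<gamma> 0)" "H 1 = u (\<gamma> 1)"
    and D: "AE t in lborel. t \<in> {0..1} \<longrightarrow> (\<forall>D. (H has_real_derivative D) (at t) \<longrightarrow>
      ennreal \<bar>D\<bar> \<le> ennreal (G (\<gamma> t)) * lower_speed \<gamma> t)"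
  shows "ennreal \<bar>u (\<gamma> 1) - u (\<gamma> 0)\<bar> \<le> curve_integral G \<gamma> 0 1"
proof -
  have "ennreal \<bar>H 1 - H 0\<bar> \<le> (\<integral>\<^sup>+t\<in>{0..1}. ennreal (G (eval_clamped \<gamma> t)) * lower_speed \<gamma> t \<partial>lborel)"
    using D by (intro integral_bounded_le_nn_integral[OF H(1)]) (auto elim: eventually_mono)
  then show ?thesis using H(2,3) by (simp add: curve_integral_def)
qed

lemma integral_bounded_AE_differentiable:
  assumes "integral_bounded F g"
  shows "AE t in lborel. \<exists>D. (F has_real_derivative D) (at t)"
  using integral_bounded_derivative[OF assms] by (metis (mono_tags, lifting) eventually_mono)

lemma integral_bounded_lipschitz:
  fixes \<phi> :: "real \<Rightarrow> real"
  assumes lip: "L-lipschitz_on UNIV \<phi>" and F: "integral_bounded F g"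
  shows "integral_bounded (\<lambda>t. \<phi> (F t)) (\<lambda>t. L * g t)"
  unfolding integral_bounded_def
proof (intro conjI allI impI)
  have L: "0 \<le> L" using lip by (simp add: lipschitz_on_def)
  show "integrable lborel (\<lambda>t. L * g t)" "\<And>x. 0 \<le> L * g x"
    using F L by (auto simp: integral_bounded_def)
  fix x y :: real assume "x \<le> y"
  then have "\<bar>F y - F x\<bar> \<le> (LINT t:{x..y}|lborel. g t)" using F by (auto simp: integral_bounded_def)
  then have "L * \<bar>F y - F x\<bar> \<le> L * (LINT t:{x..y}|lborel. g t)" using L by (rule mult_left_mono)
  moreover have "\<bar>\<phi> (F y) - \<phi> (F x)\<bar> \<le> L * \<bar>F y - F x\<bar>"
    using lipschitz_onD[OF lip, of "F y" "F x"] by (simp add: dist_real_def)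
  ultimately show "\<bar>\<phi> (F y) - \<phi> (F x)\<bar> \<le> (LINT t:{x..y}|lborel. L * g t)" by simp
qed

text \<open>An absolutely continuous function with integrable bound is bounded on the whole line, by
  its value at 0 plus the integral of the bound. With bounds \<open>A\<close> and \<open>B\<close>
  for the factors, \<open>B * f t + A * h t\<close> dominates the product.\<close>

lemma integral_bounded_mult:
  assumes F: "integral_bounded F f" and H: "integral_bounded H h"
  obtains k where "integral_bounded (\<lambda>t. F t * H t) k"
proof -
  have f: "integrable lborel f" "\<And>x. 0 \<le> f x" "\<And>x y. x \<le> y \<Longrightarrow> \<bar>F y - F x\<bar> \<le> (LINT t:{x..y}|lborel. f t)"
    using F by (auto simp: integral_bounded_def)
  have h: "integrable lborel h" "\<And>x. 0 \<le> h x" "\<And>x y. x \<le> y \<Longrightarrow> \<bar>H y - H x\<bar> \<le> (LINT t:{x..y}|lborel. h t)"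
    using H by (auto simp: integral_bounded_def)
  obtain A where A: "\<And>x. \<bar>F x\<bar> \<le> A" using integral_bounded_bounded[OF F] by blast
  obtain B where B: "\<And>x. \<bar>H x\<bar> \<le> B" using integral_bounded_bounded[OF H] by blast
  have "0 \<le> A" "0 \<le> B" using A[of 0] B[of 0] by linarith+
  have "integral_bounded (\<lambda>t. F t * H t) (\<lambda>t. B * f t + A * h t)"
    unfolding integral_bounded_def
  proof (intro conjI allI impI)
    show "integrable lborel (\<lambda>t. B * f t + A * h t)" "\<And>x. 0 \<le> B * f x + A * h x"
      using f h \<open>0 \<le> A\<close> \<open>0 \<le> B\<close> by auto
    fix x y :: real assume xy: "x \<le> y"
    have "(LINT t:{x..y}|lborel. B * f t + A * h t) = (LINT t:{x..y}|lborel. B * f t) + (LINT t:{x..y}|lborel. A * h t)"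
      using integrable_mult_indicator[OF _ f(1), of "{x..y}"] integrable_mult_indicator[OF _ h(1), of "{x..y}"]
      by (intro set_integral_add set_integrable_mult_right) (auto simp: set_integrable_def)
    then have *: "(LINT t:{x..y}|lborel. B * f t + A * h t) = B * (LINT t:{x..y}|lborel. f t) + A * (LINT t:{x..y}|lborel. h t)"
      by simp
    have "F y * H y - F x * H x = (F y - F x) * H y + F x * (H y - H x)" by (simp add: algebra_simps)
    then have "\<bar>F y * H y - F x * H x\<bar> \<le> \<bar>F y - F x\<bar> * \<bar>H y\<bar> + \<bar>F x\<bar> * \<bar>H y - H x\<bar>"
      by (metis abs_mult abs_triangle_ineq)
    also have "\<dots> \<le> (LINT t:{x..y}|lborel. f t) * B + A * (LINT t:{x..y}|lborel. h t)"
      using f(3)[OF xy] h(3)[OF xy] A B \<open>0 \<le> A\<close> by (intro add_mono mult_mono) auto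
    finally show "\<bar>F y * H y - F x * H x\<bar> \<le> (LINT t:{x..y}|lborel. B * f t + A * h t)"
      using * by (simp add: mult.commute)
  qed
  then show ?thesis by (rule that)
qed

text \<open>Where \<open>\<phi>\<close> is not differentiable, the derivative of the path vanishes.\<close>

lemma sobolev_path_lipschitz:
  fixes \<phi> :: "real \<Rightarrow> real"
  assumes lip: "L-lipschitz_on UNIV \<phi>" and F: "sobolev_path f G \<gamma> F"
    and G': "\<And>x. G' x = (if \<phi> differentiable (at (f x)) then \<bar>deriv \<phi> (f x)\<bar> * G x else 0)"
  shows "ennreal \<bar>\<phi> (f (\<gamma> 1)) - \<phi> (f (\<gamma> 0))\<bar> \<le> curve_integral G' \<gamma> 0 1"
proof -
  obtain g where g: "integral_bounded F g" using F by (auto simp: sobolev_path_def)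
  have F01: "F 0 = f (\<gamma> 0)" "F 1 = f (\<gamma> 1)" "AE t in lborel. t \<in> {0..1} \<longrightarrow> F t = f (\<gamma> t)"
    using F by (auto simp: sobolev_path_def)
  show ?thesis
  proof (rule endpoint_bound_of_derivative[where u = "\<lambda>x. \<phi> (f x)", OF integral_bounded_lipschitz[OF lip g]])
    show "\<phi> (F 0) = \<phi> (f (\<gamma> 0))" "\<phi> (F 1) = \<phi> (f (\<gamma> 1))" by (simp_all add: F01)
    show "AE t in lborel. t \<in> {0..1} \<longrightarrow> (\<forall>D. ((\<lambda>t. \<phi> (F t)) has_real_derivative D) (at t) \<longrightarrow>
      ennreal \<bar>D\<bar> \<le> ennreal (G' (\<gamma> t)) * lower_speed \<gamma> t)"
      using sobolev_path_derivative_le[OF F] F01(3) integral_bounded_AE_differentiable[OF g]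
        derivative_eq_0_on_preimage_negligible[OF lipschitz_AE_differentiable[OF lip], of F]
    proof (eventually_elim, intro impI allI)
      fix t D
      assume le: "t \<in> {0..1} \<longrightarrow> (\<forall>D. (F has_real_derivative D) (at t) \<longrightarrow> ennreal \<bar>D\<bar> \<le> ennreal (G (\<gamma> t)) * lower_speed \<gamma> t)"
        and Ft: "t \<in> {0..1} \<longrightarrow> F t = f (\<gamma> t)" and ex: "\<exists>D. (F has_real_derivative D) (at t)"
        and N: "F t \<in> {x. \<not> \<phi> differentiable (at x)} \<longrightarrow> (\<forall>D. (F has_real_derivative D) (at t) \<longrightarrow> D = 0)"
        and t: "t \<in> {0..1}" and D: "((\<lambda>t. \<phi> (F t)) has_real_derivative D) (at t)"
      obtain E where E: "(F has_real_derivative E) (at t)" using ex by blast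
      show "ennreal \<bar>D\<bar> \<le> ennreal (G' (\<gamma> t)) * lower_speed \<gamma> t"
      proof (cases "\<phi> differentiable (at (F t))")
        case True
        then have "(\<phi> has_real_derivative deriv \<phi> (F t)) (at (F t))"
          by (simp add: DERIV_deriv_iff_real_differentiable)
        from DERIV_chain2[OF this E] D have "D = deriv \<phi> (F t) * E" by (rule DERIV_unique[rotated])
        then have "ennreal \<bar>D\<bar> = ennreal \<bar>deriv \<phi> (F t)\<bar> * ennreal \<bar>E\<bar>"
          by (simp add: abs_mult ennreal_mult)
        also have "\<dots> \<le> ennreal \<bar>deriv \<phi> (F t)\<bar> * (ennreal (G (\<gamma> t)) * lower_speed \<gamma> t)"
          using le t E by (intro mult_left_mono) auto
        also have "\<dots> = ennreal (G' (\<gamma> t)) * lower_speed \<gamma> t"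
          using True Ft t by (simp add: G' ennreal_mult' mult.assoc)
        finally show ?thesis .
      next
        case False
        then have "E = 0" using N E by auto
        then have "((\<lambda>h. (F (t + h) - F t) / h) \<longlongrightarrow> 0) (at 0)" using E by (simp add: DERIV_def)
        \<comment> \<open>\<phi> o F varies at most \<open>L\<close> times as much as
          \<open>F\<close>, so a vanishing derivative of \<open>F\<close> forces one for the
          composition even where \<phi> has none.\<close>
        then have lim: "((\<lambda>h. L * \<bar>(F (t + h) - F t) / h\<bar>) \<longlongrightarrow> 0) (at 0)"
          by (intro tendsto_mult_right_zero tendsto_rabs_zero)
        have "((\<lambda>h. (\<phi> (F (t + h)) - \<phi> (F t)) / h) \<longlongrightarrow> 0) (at 0)"
        proof (rule Lim_null_comparison[OF _ lim])
          have "norm ((\<phi> (F (t + h)) - \<phi> (F t)) / h) \<le> L * \<bar>(F (t + h) - F t) / h\<bar>" for h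
            using divide_right_mono[OF lipschitz_onD[OF lip, of "F (t + h)" "F t"], of "\<bar>h\<bar>"]
            by (simp add: dist_real_def abs_divide)
          then show "\<forall>\<^sub>F h in at 0. norm ((\<phi> (F (t + h)) - \<phi> (F t)) / h) \<le> L * \<bar>(F (t + h) - F t) / h\<bar>"
            by simp
        qed
        then have "((\<lambda>t. \<phi> (F t)) has_real_derivative 0) (at t)" by (simp add: DERIV_def)
        then have "D = 0" using D DERIV_unique by blast
        then show ?thesis by simp
      qed
    qed
  qed
qed

lemma sobolev_path_mult:
  assumes F: "sobolev_path f Gf \<gamma> F" and H: "sobolev_path h Gh \<gamma> H"
    and nn: "\<And>x. 0 \<le> Gf x" "\<And>x. 0 \<le> Gh x"
  shows "ennreal \<bar>f (\<gamma> 1) * h (\<gamma> 1) - f (\<gamma> 0) * h (\<gamma> 0)\<bar> \<le> curve_integral (\<lambda>x. \<bar>f x\<bar> * Gh x + \<bar>h x\<bar> * Gf x) \<gamma> 0 1"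
proof -
  obtain g1 g2 where g1: "integral_bounded F g1" and g2: "integral_bounded H g2"
    using F H by (auto simp: sobolev_path_def)
  obtain k where k: "integral_bounded (\<lambda>t. F t * H t) k" using integral_bounded_mult[OF g1 g2] by blast
  have F01: "F 0 = f (\<gamma> 0)" "F 1 = f (\<gamma> 1)" "AE t in lborel. t \<in> {0..1} \<longrightarrow> F t = f (\<gamma> t)"
    using F by (auto simp: sobolev_path_def)
  have H01: "H 0 = h (\<gamma> 0)" "H 1 = h (\<gamma> 1)" "AE t in lborel. t \<in> {0..1} \<longrightarrow> H t = h (\<gamma> t)"
    using H by (auto simp: sobolev_path_def)
  show ?thesis
  proof (rule endpoint_bound_of_derivative[where u = "\<lambda>x. f x * h x", OF k])
    show "F 0 * H 0 = f (\<gamma> 0) * h (\<gamma> 0)" "F 1 * H 1 = f (\<gamma> 1) * h (\<gamma> 1)" by (simp_all add: F01 H01)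
    show "AE t in lborel. t \<in> {0..1} \<longrightarrow> (\<forall>D. ((\<lambda>t. F t * H t) has_real_derivative D) (at t) \<longrightarrow>
      ennreal \<bar>D\<bar> \<le> ennreal (\<bar>f (\<gamma> t)\<bar> * Gh (\<gamma> t) + \<bar>h (\<gamma> t)\<bar> * Gf (\<gamma> t)) * lower_speed \<gamma> t)"
      using sobolev_path_derivative_le[OF F] sobolev_path_derivative_le[OF H] F01(3) H01(3)
        integral_bounded_AE_differentiable[OF g1] integral_bounded_AE_differentiable[OF g2]
    proof (eventually_elim, intro impI allI)
      fix t D
      assume leF: "t \<in> {0..1} \<longrightarrow> (\<forall>D. (F has_real_derivative D) (at t) \<longrightarrow> ennreal \<bar>D\<bar> \<le> ennreal (Gf (\<gamma> t)) * lower_speed \<gamma> t)"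
        and leH: "t \<in> {0..1} \<longrightarrow> (\<forall>D. (H has_real_derivative D) (at t) \<longrightarrow> ennreal \<bar>D\<bar> \<le> ennreal (Gh (\<gamma> t)) * lower_speed \<gamma> t)"
        and Ft: "t \<in> {0..1} \<longrightarrow> F t = f (\<gamma> t)" and Ht: "t \<in> {0..1} \<longrightarrow> H t = h (\<gamma> t)"
        and exF: "\<exists>D. (F has_real_derivative D) (at t)" and exH: "\<exists>D. (H has_real_derivative D) (at t)"
        and t: "t \<in> {0..1}" and D: "((\<lambda>t. F t * H t) has_real_derivative D) (at t)"
      obtain E1 E2 where E: "(F has_real_derivative E1) (at t)" "(H has_real_derivative E2) (at t)"
        using exF exH by blast
      have "D = E1 * H t + E2 * F t"
        using DERIV_unique[OF D DERIV_mult[OF E]] .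
      then have "\<bar>D\<bar> \<le> \<bar>F t\<bar> * \<bar>E2\<bar> + \<bar>H t\<bar> * \<bar>E1\<bar>"
        using abs_triangle_ineq[of "E1 * H t" "E2 * F t"] by (simp add: abs_mult mult.commute)
      then have "ennreal \<bar>D\<bar> \<le> ennreal (\<bar>F t\<bar> * \<bar>E2\<bar> + \<bar>H t\<bar> * \<bar>E1\<bar>)" by (rule ennreal_leI)
      also have "\<dots> = ennreal \<bar>F t\<bar> * ennreal \<bar>E2\<bar> + ennreal \<bar>H t\<bar> * ennreal \<bar>E1\<bar>"
        by (simp add: ennreal_mult)
      also have "\<dots> \<le> ennreal \<bar>F t\<bar> * (ennreal (Gh (\<gamma> t)) * lower_speed \<gamma> t) + ennreal \<bar>H t\<bar> * (ennreal (Gf (\<gamma> t)) * lower_speed \<gamma> t)"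
        using leF leH t E by (intro add_mono mult_left_mono) auto
      also have "\<dots> = ennreal (\<bar>f (\<gamma> t)\<bar> * Gh (\<gamma> t) + \<bar>h (\<gamma> t)\<bar> * Gf (\<gamma> t)) * lower_speed \<gamma> t"
        using Ft Ht t nn by (simp add: ennreal_mult distrib_right mult.assoc)
      finally show "ennreal \<bar>D\<bar> \<le> ennreal (\<bar>f (\<gamma> t)\<bar> * Gh (\<gamma> t) + \<bar>h (\<gamma> t)\<bar> * Gf (\<gamma> t)) * lower_speed \<gamma> t" .
    qed
  qed
qed

text \<open>The two paths are continuous and agree almost everywhere, hence coincide on the open
  interval, and their common derivative obeys both bounds. This is what makes weak upper gradients
  closed under minima.\<close>

lemma sobolev_path_min:
  assumes F: "sobolev_path f G1 \<gamma> F" and H: "sobolev_path f G2 \<gamma> H"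
  shows "ennreal \<bar>f (\<gamma> 1) - f (\<gamma> 0)\<bar> \<le> curve_integral (\<lambda>x. min (G1 x) (G2 x)) \<gamma> 0 1"
proof -
  obtain g1 g2 where g1: "integral_bounded F g1" and g2: "integral_bounded H g2"
    using F H by (auto simp: sobolev_path_def)
  have "AE t in lborel. t \<in> {0..1} \<longrightarrow> F t = f (\<gamma> t)" "AE t in lborel. t \<in> {0..1} \<longrightarrow> H t = f (\<gamma> t)"
    using F H by (auto simp: sobolev_path_def)
  then have "AE t in lborel. t \<in> {0..1} \<longrightarrow> F t = H t" by eventually_elim auto
  then have eq: "F t = H t" if "t \<in> {0<..<1}" for t
    using continuous_AE_eq_on_Icc[OF integral_bounded_isCont[OF g1] integral_bounded_isCont[OF g2] _ that] by blast
  show ?thesis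
  proof (rule endpoint_bound_of_derivative[OF g1])
    show "F 0 = f (\<gamma> 0)" "F 1 = f (\<gamma> 1)" using F by (auto simp: sobolev_path_def)
    show "AE t in lborel. t \<in> {0..1} \<longrightarrow> (\<forall>D. (F has_real_derivative D) (at t) \<longrightarrow>
      ennreal \<bar>D\<bar> \<le> ennreal (min (G1 (\<gamma> t)) (G2 (\<gamma> t))) * lower_speed \<gamma> t)"
      using sobolev_path_derivative_le[OF F] sobolev_path_derivative_le[OF H]
        AE_lborel_singleton[of 0] AE_lborel_singleton[of 1]
    proof (eventually_elim, intro impI allI)
      fix t D :: real
      assume leF: "t \<in> {0..1} \<longrightarrow> (\<forall>D. (F has_real_derivative D) (at t) \<longrightarrow> ennreal \<bar>D\<bar> \<le> ennreal (G1 (\<gamma> t)) * lower_speed \<gamma> t)"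
        and leH: "t \<in> {0..1} \<longrightarrow> (\<forall>D. (H has_real_derivative D) (at t) \<longrightarrow> ennreal \<bar>D\<bar> \<le> ennreal (G2 (\<gamma> t)) * lower_speed \<gamma> t)"
        and t: "t \<noteq> 0" "t \<noteq> 1" "t \<in> {0..1}" and D: "(F has_real_derivative D) (at t)"
      have "(H has_real_derivative D) (at t)"
        using D by (rule has_field_derivative_transform_within_open[where S = "{0<..<1}"]) (use t eq in auto)
      then show "ennreal \<bar>D\<bar> \<le> ennreal (min (G1 (\<gamma> t)) (G2 (\<gamma> t))) * lower_speed \<gamma> t"
        using leF leH D t by (auto simp: min_def)
    qed
  qed
qed

lemma sobolev_path_locality:
  assumes F: "sobolev_path f G \<gamma> F" and N: "negligible N"
  shows "ennreal \<bar>f (\<gamma> 1) - f (\<gamma> 0)\<bar> \<le> curve_integral (\<lambda>x. if f x \<in> N then 0 else G x) \<gamma> 0 1"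
proof -
  obtain g where g: "integral_bounded F g" using F by (auto simp: sobolev_path_def)
  have F01: "F 0 = f (\<gamma> 0)" "F 1 = f (\<gamma> 1)" "AE t in lborel. t \<in> {0..1} \<longrightarrow> F t = f (\<gamma> t)"
    using F by (auto simp: sobolev_path_def)
  show ?thesis
  proof (rule endpoint_bound_of_derivative[where u = f, OF g])
    show "F 0 = f (\<gamma> 0)" "F 1 = f (\<gamma> 1)" by (simp_all add: F01)
    show "AE t in lborel. t \<in> {0..1} \<longrightarrow> (\<forall>D. (F has_real_derivative D) (at t) \<longrightarrow>
      ennreal \<bar>D\<bar> \<le> ennreal (if f (\<gamma> t) \<in> N then 0 else G (\<gamma> t)) * lower_speed \<gamma> t)"
      using sobolev_path_derivative_le[OF F] F01(3) derivative_eq_0_on_preimage_negligible[OF N, of F]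
      by eventually_elim auto
  qed
qed

section \<open>Minimal weak upper gradients\<close>

lemma measurable_S2: "sets m = sets borel \<Longrightarrow> f \<in> S2 m \<Longrightarrow> f \<in> borel_measurable borel"
  by (auto simp: S2_def cong: measurable_cong_sets)

text \<open>The factors 2 come from (p + q)^2 <= 2 p^2 + 2 q^2. The two weights let the same
  estimate serve sums, products and, with a weight 0, single terms.\<close>

lemma nn_integral_square_le:
  fixes u v w :: "'x \<Rightarrow> real"
  assumes [measurable]: "v \<in> borel_measurable m" "w \<in> borel_measurable m"
    and le: "AE x in m. \<bar>u x\<bar> \<le> a * v x + b * w x"
  shows "(\<integral>\<^sup>+x. ennreal ((u x)\<^sup>2) \<partial>m)
    \<le> ennreal (2 * a\<^sup>2) * (\<integral>\<^sup>+x. ennreal ((v x)\<^sup>2) \<partial>m) + ennreal (2 * b\<^sup>2) * (\<integral>\<^sup>+x. ennreal ((w x)\<^sup>2) \<partial>m)"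
proof -
  have "(\<integral>\<^sup>+x. ennreal ((u x)\<^sup>2) \<partial>m)
    \<le> (\<integral>\<^sup>+x. ennreal (2 * a\<^sup>2) * ennreal ((v x)\<^sup>2) + ennreal (2 * b\<^sup>2) * ennreal ((w x)\<^sup>2) \<partial>m)"
    using le
  proof (intro nn_integral_mono_AE, eventually_elim)
    case (elim x)
    have "(u x)\<^sup>2 \<le> (a * v x + b * w x)\<^sup>2"
      using power_mono[OF elim(2) abs_ge_zero, of 2] by simp
    also have "\<dots> \<le> 2 * (a * v x)\<^sup>2 + 2 * (b * w x)\<^sup>2"
      using zero_le_power2[of "a * v x - b * w x"] by (simp add: power2_eq_square algebra_simps)
    finally have "ennreal ((u x)\<^sup>2) \<le> ennreal (2 * a\<^sup>2 * (v x)\<^sup>2 + 2 * b\<^sup>2 * (w x)\<^sup>2)"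
      by (intro ennreal_leI) (simp add: power_mult_distrib)
    also have "\<dots> = ennreal (2 * a\<^sup>2) * ennreal ((v x)\<^sup>2) + ennreal (2 * b\<^sup>2) * ennreal ((w x)\<^sup>2)"
      by (simp add: ennreal_mult)
    finally show ?case .
  qed
  also have "\<dots> = ennreal (2 * a\<^sup>2) * (\<integral>\<^sup>+x. ennreal ((v x)\<^sup>2) \<partial>m) + ennreal (2 * b\<^sup>2) * (\<integral>\<^sup>+x. ennreal ((w x)\<^sup>2) \<partial>m)"
    by (simp add: nn_integral_add nn_integral_cmult)
  finally show ?thesis .
qed

lemma wug_min:
  fixes m :: "'a::{metric_space, second_countable_topology} measure"
  assumes m: "sets m = sets borel" and f: "f \<in> borel_measurable borel"
    and G1: "weak_upper_gradient m f G1" and G2: "weak_upper_gradient m f G2"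
  shows "weak_upper_gradient m f (\<lambda>x. min (G1 x) (G2 x))"
proof (rule weak_upper_gradientI[OF m])
  note g1 = weak_upper_gradientD[OF m G1] and g2 = weak_upper_gradientD[OF m G2]
  show "(\<lambda>x. min (G1 x) (G2 x)) \<in> borel_measurable borel" using g1(1) g2(1) by measurable
  show "0 \<le> min (G1 x) (G2 x)" for x using g1(2) g2(2) by simp
  have "(\<integral>\<^sup>+x. ennreal ((min (G1 x) (G2 x))\<^sup>2) \<partial>m) \<le> (\<integral>\<^sup>+x. ennreal ((G1 x)\<^sup>2) \<partial>m)"
    using g1(2) g2(2) by (intro nn_integral_mono ennreal_leI power_mono) auto
  then show "(\<integral>\<^sup>+x. ennreal ((min (G1 x) (G2 x))\<^sup>2) \<partial>m) < \<infinity>" using g1(3) by (rule le_less_trans)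
  fix \<pi> assume \<pi>: "test_plan m \<pi>"
  from AE_sobolev_path[OF m f G1 \<pi>] AE_sobolev_path[OF m f G2 \<pi>]
  show "AE \<gamma> in \<pi>. ennreal \<bar>f (\<gamma> 1) - f (\<gamma> 0)\<bar> \<le> curve_integral (\<lambda>x. min (G1 x) (G2 x)) \<gamma> 0 1"
    by eventually_elim (blast intro: sobolev_path_min)
qed

text \<open>The direct method: closure under minima turns a minimising sequence for the L^2 norm
  into a decreasing one, and its limit is a weak upper gradient by dominated convergence along
  almost every curve.\<close>

lemma exists_minimal_wug:
  fixes m :: "'a::{metric_space, second_countable_topology} measure"
  assumes m: "sets m = sets borel" and f: "f \<in> S2 m"
  obtains G where "weak_upper_gradient m f G"
    "\<And>H. weak_upper_gradient m f H \<Longrightarrow> AE x in m. G x \<le> H x"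
proof -
  have fm: "f \<in> borel_measurable borel" using m f by (rule measurable_S2)
  define W where "W = {G. weak_upper_gradient m f G}"
  define E where "E G = (\<integral>\<^sup>+x. ennreal ((G x)\<^sup>2) \<partial>m)" for G
  define I where "I = (INF G\<in>W. E G)"
  obtain G0 where G0: "G0 \<in> W" using f by (auto simp: S2_def W_def)
  have Efin: "E G < \<infinity>" if "G \<in> W" for G
    using weak_upper_gradientD(3)[OF m, of f G] that by (auto simp: W_def E_def)
  have "I \<le> E G0" unfolding I_def using G0 by (rule INF_lower)
  then have Ifin: "I < \<infinity>" using Efin[OF G0] by (rule le_less_trans)
  have "\<exists>G\<in>W. E G < I + ennreal (1 / real (Suc n))" for n
  proof -
    have "I < I + ennreal (1 / real (Suc n))"
      using Ifin by (cases I) (auto simp: ennreal_plus[symmetric] ennreal_less_iff simp del: ennreal_plus)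
    then show ?thesis unfolding I_def by (simp add: INF_less_iff)
  qed
  then obtain S where S: "\<And>n. S n \<in> W" "\<And>n. E (S n) < I + ennreal (1 / real (Suc n))" by metis
  define M where "M = rec_nat (S 0) (\<lambda>n M x. min (M x) (S (Suc n) x))"
  have M0: "M 0 = S 0" and MS: "M (Suc n) = (\<lambda>x. min (M n x) (S (Suc n) x))" for n
    by (simp_all add: M_def)
  have MW: "weak_upper_gradient m f (M n)" for n
  proof (induction n)
    case 0
    then show ?case using S(1)[of 0] by (simp add: M0 W_def)
  next
    case (Suc n)
    then show ?case using wug_min[OF m fm Suc] S(1)[of "Suc n"] by (simp add: MS W_def)
  qed
  note Md = weak_upper_gradientD[OF m MW]
  have MleS: "M n x \<le> S n x" for n x by (cases n) (auto simp: M0 MS)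
  have dec: "decseq (\<lambda>n. M n x)" for x by (intro decseq_SucI) (simp add: MS)
  have bdd: "bdd_below (range (\<lambda>n. M n x))" for x using Md(2) by (intro bdd_belowI2[of _ 0]) auto
  define G where "G x = (INF n. M n x)" for x
  have lim: "(\<lambda>n. M n x) \<longlonglongrightarrow> G x" for x
    unfolding G_def by (rule LIMSEQ_decseq_INF[OF bdd dec])
  have GleM: "G x \<le> M n x" for n x unfolding G_def by (rule cINF_lower[OF bdd]) simp
  have G_nn: "0 \<le> G x" for x unfolding G_def using Md(2) by (intro cINF_greatest) auto
  have G_m: "G \<in> borel_measurable borel"
    by (rule borel_measurable_LIMSEQ_real[OF lim Md(1)])
  have EG: "E G \<le> I"
  proof (rule LIMSEQ_le_const)
    have "(\<lambda>n. ennreal (1 / real (Suc n))) \<longlonglongrightarrow> ennreal 0"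
      using LIMSEQ_inverse_real_of_nat by (intro tendsto_ennrealI) (simp add: inverse_eq_divide)
    then show "(\<lambda>n. I + ennreal (1 / real (Suc n))) \<longlonglongrightarrow> I"
      using tendsto_add[OF tendsto_const[of I]] by fastforce
    have "E G \<le> E (S n)" for n
      unfolding E_def by (intro nn_integral_mono ennreal_leI power_mono order_trans[OF GleM MleS] G_nn)
    then show "\<exists>N. \<forall>n\<ge>N. E G \<le> I + ennreal (1 / real (Suc n))"
      using S(2) by (meson less_imp_le order_trans)
  qed
  have GW: "weak_upper_gradient m f G"
  proof (rule weak_upper_gradientI[OF m G_m G_nn])
    show "(\<integral>\<^sup>+x. ennreal ((G x)\<^sup>2) \<partial>m) < \<infinity>" using EG Ifin by (simp add: E_def le_less_trans)
    fix \<pi> assume \<pi>: "test_plan m \<pi>"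
    have "AE \<gamma> in \<pi>. \<forall>n. ennreal \<bar>f (\<gamma> 1) - f (\<gamma> 0)\<bar> \<le> curve_integral (M n) \<gamma> 0 1"
      using AE_endpoint_bound[OF m fm MW \<pi>] by (subst AE_all_countable) auto
    moreover have "AE \<gamma> in \<pi>. curve_integral (M 0) \<gamma> 0 1 \<noteq> \<infinity>"
    proof (rule nn_integral_PInf_AE)
      have "(\<integral>\<^sup>+\<gamma>. curve_integral (M 0) \<gamma> 0 1 \<partial>\<pi>) < \<infinity>"
        by (rule curve_integral_finite[OF \<pi> m Md])
      then show "(\<integral>\<^sup>+\<gamma>. curve_integral (M 0) \<gamma> 0 1 \<partial>\<pi>) \<noteq> \<infinity>" by simp
      show "(\<lambda>\<gamma>. curve_integral (M 0) \<gamma> 0 1) \<in> borel_measurable \<pi>"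
        using test_plan_sets[OF \<pi>]
        by (auto intro!: measurable_curve_integral[OF Md(1)] cong: measurable_cong_sets)
    qed
    ultimately show "AE \<gamma> in \<pi>. ennreal \<bar>f (\<gamma> 1) - f (\<gamma> 0)\<bar> \<le> curve_integral G \<gamma> 0 1"
      using AE_test_plan_abs_cont[OF \<pi>]
    proof eventually_elim
      case (elim \<gamma>)
      then have [measurable]: "eval_clamped \<gamma> \<in> borel_measurable borel" "lower_speed \<gamma> \<in> borel_measurable borel"
        using continuous_on_eval_clamped[of \<gamma>]
        by (auto intro: borel_measurable_continuous_onI lower_speed_measurable_continuous)
      note [measurable] = Md(1) G_m
      \<comment> \<open>Multiplication by a fixed factor is continuous on \<open>ennreal\<close>
        when the factor is finite; an infinite one would break the limit at values tending to
        0.\<close>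
      have lower_speed_finite: "AE t in lborel. lower_speed \<gamma> t < \<infinity>"
        using elim by (intro abs_cont_lower_speed(3)) auto
      have "(\<lambda>n. curve_integral (M n) \<gamma> 0 1) \<longlonglongrightarrow> curve_integral G \<gamma> 0 1"
        unfolding curve_integral_def
      proof (rule nn_integral_dominated_convergence)
        show "(\<integral>\<^sup>+t\<in>{0..1}. ennreal (M 0 (eval_clamped \<gamma> t)) * lower_speed \<gamma> t \<partial>lborel) < \<infinity>"
          using elim by (simp add: curve_integral_def less_top)
        have "M n x \<le> M 0 x" for n x using dec[of x] by (simp add: decseq_def)
        then show "AE t in lborel. ennreal (M n (eval_clamped \<gamma> t)) * lower_speed \<gamma> t * indicator {0..1} t
          \<le> ennreal (M 0 (eval_clamped \<gamma> t)) * lower_speed \<gamma> t * indicator {0..1} t" for n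
          by (intro AE_I2 mult_right_mono ennreal_leI) auto
        show "AE t in lborel. (\<lambda>n. ennreal (M n (eval_clamped \<gamma> t)) * lower_speed \<gamma> t * indicator {0..1} t)
          \<longlonglongrightarrow> ennreal (G (eval_clamped \<gamma> t)) * lower_speed \<gamma> t * indicator {0..1} t"
          using lower_speed_finite
        proof eventually_elim
          case (elim t)
          have "(\<lambda>n. (lower_speed \<gamma> t * indicator {0..1} t) * ennreal (M n (eval_clamped \<gamma> t)))
            \<longlonglongrightarrow> (lower_speed \<gamma> t * indicator {0..1} t) * ennreal (G (eval_clamped \<gamma> t))"
            using elim lim by (intro ennreal_tendsto_cmult tendsto_ennrealI) (auto split: split_indicator)
          then show ?case by (simp add: ac_simps)
        qed
      qed measurable
      then show ?case by (rule LIMSEQ_le_const) (use elim in auto)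
    qed
  qed
  have "AE x in m. G x \<le> H x" if H: "weak_upper_gradient m f H" for H
  proof -
    note Hd = weak_upper_gradientD[OF m H]
    have [measurable]: "G \<in> borel_measurable m" "H \<in> borel_measurable m"
      using G_m Hd(1) m by (auto cong: measurable_cong_sets)
    \<comment> \<open>If \<open>G\<close> exceeded \<open>H\<close> on a set of positive measure,
      the minimum of both would have energy below the infimum.\<close>
    define K where "K x = min (G x) (H x)" for x
    have "K \<in> W" using wug_min[OF m fm GW H] by (simp add: W_def K_def[abs_def])
    then have "I \<le> E K" unfolding I_def by (rule INF_lower)
    then have le: "E G \<le> E K" using EG by simp
    have "AE x in m. ennreal ((G x)\<^sup>2) \<le> ennreal ((K x)\<^sup>2)"
    proof (rule ccontr)
      assume *: "\<not> ?thesis"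
      have "E K < E G" unfolding E_def
      proof (rule nn_integral_less[OF _ _ _ _ *])
        show "(\<integral>\<^sup>+x. ennreal ((K x)\<^sup>2) \<partial>m) \<noteq> \<infinity>" using Efin[OF \<open>K \<in> W\<close>] by (simp add: E_def)
        show "AE x in m. ennreal ((K x)\<^sup>2) \<le> ennreal ((G x)\<^sup>2)"
          using G_nn Hd(2) by (intro AE_I2 ennreal_leI power_mono) (auto simp: K_def)
      qed (auto simp: K_def[abs_def])
      then show False using le by simp
    qed
    then show ?thesis
    proof eventually_elim
      case (elim x)
      then have "(G x)\<^sup>2 \<le> (K x)\<^sup>2" by simp
      then have "G x \<le> K x" by (rule power2_le_imp_le) (simp add: K_def G_nn Hd(2))
      then show ?case by (simp add: K_def)
    qed
  qed
  with GW show ?thesis by (rule that)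
qed

section \<open>Calculus rules for minimal weak upper gradients\<close>

context
  fixes m :: "'a::{metric_space, second_countable_topology} measure"
  assumes m: "sets m = sets borel"
begin

lemma min_wug_wug: "f \<in> S2 m \<Longrightarrow> weak_upper_gradient m f (min_wug m f)"
  and min_wug_le: "f \<in> S2 m \<Longrightarrow> weak_upper_gradient m f H \<Longrightarrow> AE x in m. min_wug m f x \<le> H x"
proof -
  define Q where "Q f G \<longleftrightarrow> weak_upper_gradient m f G \<and>
     (\<forall>H. weak_upper_gradient m f H \<longrightarrow> (AE x in m. G x \<le> H x))" for f G
  have Q: "Q f (min_wug m f)" if f: "f \<in> S2 m" for f
  proof -
    obtain G where "Q f G" using exists_minimal_wug[OF m f] unfolding Q_def by metis
    then show ?thesis unfolding min_wug_def Q_def[symmetric] by (rule someI[of "Q f"])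
  qed
  show "f \<in> S2 m \<Longrightarrow> weak_upper_gradient m f (min_wug m f)"
    using Q unfolding Q_def by blast
  show "f \<in> S2 m \<Longrightarrow> weak_upper_gradient m f H \<Longrightarrow> AE x in m. min_wug m f x \<le> H x"
    using Q unfolding Q_def by blast
qed

lemma min_wug_props:
  assumes "f \<in> S2 m"
  shows "min_wug m f \<in> borel_measurable borel" "0 \<le> min_wug m f x"
    "(\<integral>\<^sup>+x. ennreal ((min_wug m f x)\<^sup>2) \<partial>m) < \<infinity>"
  using weak_upper_gradientD[OF m min_wug_wug[OF assms]] by auto

lemma min_wug_measurable: "f \<in> S2 m \<Longrightarrow> min_wug m f \<in> borel_measurable m"
  using min_wug_props(1) m by (auto cong: measurable_cong_sets)

lemma min_wug_sum_L2:
  assumes f: "f \<in> S2 m" and g: "g \<in> S2 m"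
  shows "(\<lambda>x. min_wug m f x + min_wug m g x) \<in> borel_measurable m"
    "(\<integral>\<^sup>+x. ennreal ((min_wug m f x + min_wug m g x)\<^sup>2) \<partial>m) < \<infinity>"
proof -
  note ms = min_wug_measurable[OF f] min_wug_measurable[OF g]
  then show "(\<lambda>x. min_wug m f x + min_wug m g x) \<in> borel_measurable m" by measurable
  have "(\<integral>\<^sup>+x. ennreal ((min_wug m f x + min_wug m g x)\<^sup>2) \<partial>m)
    \<le> ennreal (2 * 1\<^sup>2) * (\<integral>\<^sup>+x. ennreal ((min_wug m f x)\<^sup>2) \<partial>m) + ennreal (2 * 1\<^sup>2) * (\<integral>\<^sup>+x. ennreal ((min_wug m g x)\<^sup>2) \<partial>m)"
    using min_wug_props(2)[OF f] min_wug_props(2)[OF g]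
    by (intro nn_integral_square_le ms AE_I2) simp
  also have "\<dots> < \<infinity>"
    using min_wug_props(3)[OF f] min_wug_props(3)[OF g] by (simp add: ennreal_mult_less_top)
  finally show "(\<integral>\<^sup>+x. ennreal ((min_wug m f x + min_wug m g x)\<^sup>2) \<partial>m) < \<infinity>" .
qed

lemma wug_S2: "f \<in> borel_measurable borel \<Longrightarrow> weak_upper_gradient m f G \<Longrightarrow> f \<in> S2 m"
  using m by (auto simp: S2_def cong: measurable_cong_sets)

lemma min_wug_const:
  shows "(\<lambda>_. c) \<in> S2 m" "AE x in m. min_wug m (\<lambda>_. c) x = 0"
proof -
  have w: "weak_upper_gradient m (\<lambda>_. c) (\<lambda>_. 0)"
    by (rule weak_upper_gradientI[OF m]) auto
  show S: "(\<lambda>_. c) \<in> S2 m" using w by (intro wug_S2) auto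
  show "AE x in m. min_wug m (\<lambda>_. c) x = 0"
    using min_wug_le[OF S w] by eventually_elim (use min_wug_props(2)[OF S] in \<open>auto intro: antisym\<close>)
qed

lemma min_wug_add:
  assumes f: "f \<in> S2 m" and g: "g \<in> S2 m"
  shows "(\<lambda>x. f x + g x) \<in> S2 m"
    "AE x in m. min_wug m (\<lambda>x. f x + g x) x \<le> min_wug m f x + min_wug m g x"
proof -
  note fd = min_wug_props[OF f] and gd = min_wug_props[OF g]
  have fm [measurable]: "f \<in> borel_measurable borel" and gm [measurable]: "g \<in> borel_measurable borel"
    using measurable_S2[OF m] f g by auto
  have w: "weak_upper_gradient m (\<lambda>x. f x + g x) (\<lambda>x. min_wug m f x + min_wug m g x)"
  proof (rule weak_upper_gradientI[OF m])
    show "(\<lambda>x. min_wug m f x + min_wug m g x) \<in> borel_measurable borel" using fd(1) gd(1) by measurable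
    show "0 \<le> min_wug m f x + min_wug m g x" for x using fd(2) gd(2) by simp
    show "(\<integral>\<^sup>+x. ennreal ((min_wug m f x + min_wug m g x)\<^sup>2) \<partial>m) < \<infinity>"
      by (rule min_wug_sum_L2(2)[OF f g])
    fix \<pi> assume \<pi>: "test_plan m \<pi>"
    from AE_endpoint_bound[OF m fm min_wug_wug[OF f] \<pi>] AE_endpoint_bound[OF m gm min_wug_wug[OF g] \<pi>]
      AE_test_plan_abs_cont[OF \<pi>]
    show "AE \<gamma> in \<pi>. ennreal \<bar>f (\<gamma> 1) + g (\<gamma> 1) - (f (\<gamma> 0) + g (\<gamma> 0))\<bar>
      \<le> curve_integral (\<lambda>x. min_wug m f x + min_wug m g x) \<gamma> 0 1"
    proof eventually_elim
      case (elim \<gamma>)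
      have "ennreal \<bar>f (\<gamma> 1) + g (\<gamma> 1) - (f (\<gamma> 0) + g (\<gamma> 0))\<bar>
        \<le> ennreal \<bar>f (\<gamma> 1) - f (\<gamma> 0)\<bar> + ennreal \<bar>g (\<gamma> 1) - g (\<gamma> 0)\<bar>"
        unfolding ennreal_plus[OF abs_ge_zero abs_ge_zero, symmetric] by (rule ennreal_leI) linarith
      also have "\<dots> \<le> curve_integral (min_wug m f) \<gamma> 0 1 + curve_integral (min_wug m g) \<gamma> 0 1"
        using elim by (intro add_mono) auto
      also have "\<dots> = curve_integral (\<lambda>x. min_wug m f x + min_wug m g x) \<gamma> 0 1"
        using elim by (intro curve_integral_add[symmetric] fd(1,2) gd(1,2)) simp
      finally show ?case .
    qed
  qed
  show S: "(\<lambda>x. f x + g x) \<in> S2 m" by (rule wug_S2[OF _ w]) measurable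
  show "AE x in m. min_wug m (\<lambda>x. f x + g x) x \<le> min_wug m f x + min_wug m g x"
    by (rule min_wug_le[OF S w])
qed

lemma min_wug_lipschitz:
  fixes \<phi> :: "real \<Rightarrow> real"
  assumes f: "f \<in> S2 m" and lip: "L-lipschitz_on UNIV \<phi>"
  shows "(\<lambda>x. \<phi> (f x)) \<in> S2 m"
    "AE x in m. min_wug m (\<lambda>x. \<phi> (f x)) x \<le>
      (if \<phi> differentiable (at (f x)) then \<bar>deriv \<phi> (f x)\<bar> * min_wug m f x else 0)"
proof -
  note fd = min_wug_props[OF f]
  have [measurable]: "f \<in> borel_measurable borel" using measurable_S2[OF m] f by auto
  have cont: "continuous_on UNIV \<phi>" using lip by (rule lipschitz_on_continuous_on)
  have [measurable]: "\<phi> \<in> borel_measurable borel" using cont by (rule borel_measurable_continuous_onI)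
  note [measurable] = Borel_differentiable[OF cont] fd(1)
  \<comment> \<open>Set to 0 at the points without derivative, the derivative is Borel and bounded
    by \<open>L\<close> on the whole line.\<close>
  define d where "d y = (if \<phi> differentiable (at y) then deriv \<phi> y else 0)" for y
  have [measurable]: "d \<in> borel_measurable borel" unfolding d_def[abs_def] by measurable
  define G where "G x = (if \<phi> differentiable (at (f x)) then \<bar>deriv \<phi> (f x)\<bar> * min_wug m f x else 0)" for x
  have G_eq: "G x = \<bar>d (f x)\<bar> * min_wug m f x" for x by (simp add: G_def d_def)
  have L: "0 \<le> L" using lip by (simp add: lipschitz_on_def)
  have d: "\<bar>d y\<bar> \<le> L" for y
    using lipschitz_abs_deriv_le[OF lip, of _ y] L by (auto simp: d_def DERIV_deriv_iff_real_differentiable)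
  have w: "weak_upper_gradient m (\<lambda>x. \<phi> (f x)) G"
  proof (rule weak_upper_gradientI[OF m])
    show "G \<in> borel_measurable borel" unfolding G_eq[abs_def] by measurable
    show "0 \<le> G x" for x using fd(2) by (simp add: G_eq)
    note [measurable] = min_wug_measurable[OF f]
    have "(\<integral>\<^sup>+x. ennreal ((G x)\<^sup>2) \<partial>m) \<le> (\<integral>\<^sup>+x. ennreal (L\<^sup>2) * ennreal ((min_wug m f x)\<^sup>2) \<partial>m)"
    proof (rule nn_integral_mono)
      fix x
      have "(\<bar>d (f x)\<bar> * min_wug m f x)\<^sup>2 \<le> (L * min_wug m f x)\<^sup>2"
        using d[of "f x"] fd(2)[of x] by (intro power_mono mult_right_mono) auto
      then show "ennreal ((G x)\<^sup>2) \<le> ennreal (L\<^sup>2) * ennreal ((min_wug m f x)\<^sup>2)"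
        by (simp add: G_eq power_mult_distrib ennreal_mult[symmetric] ennreal_leI)
    qed
    also have "\<dots> = ennreal (L\<^sup>2) * (\<integral>\<^sup>+x. ennreal ((min_wug m f x)\<^sup>2) \<partial>m)"
      by (rule nn_integral_cmult) measurable
    also have "\<dots> < \<infinity>" using fd(3) by (simp add: ennreal_mult_less_top)
    finally show "(\<integral>\<^sup>+x. ennreal ((G x)\<^sup>2) \<partial>m) < \<infinity>" .
    fix \<pi> assume \<pi>: "test_plan m \<pi>"
    have "AE \<gamma> in \<pi>. \<gamma> \<in> mspace curves \<and> abs_cont_curve \<gamma> \<and> (\<exists>F. sobolev_path f (min_wug m f) \<gamma> F)"
      by (rule AE_sobolev_path[OF m _ min_wug_wug[OF f] \<pi>]) measurable
    then show "AE \<gamma> in \<pi>. ennreal \<bar>\<phi> (f (\<gamma> 1)) - \<phi> (f (\<gamma> 0))\<bar> \<le> curve_integral G \<gamma> 0 1"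
    proof eventually_elim
      case (elim \<gamma>)
      then obtain F where F: "sobolev_path f (min_wug m f) \<gamma> F" by blast
      show ?case by (rule sobolev_path_lipschitz[OF lip F]) (simp add: G_def)
    qed
  qed
  show S: "(\<lambda>x. \<phi> (f x)) \<in> S2 m" by (rule wug_S2[OF _ w]) measurable
  show "AE x in m. min_wug m (\<lambda>x. \<phi> (f x)) x \<le>
      (if \<phi> differentiable (at (f x)) then \<bar>deriv \<phi> (f x)\<bar> * min_wug m f x else 0)"
    using min_wug_le[OF S w] by (simp add: G_def)
qed

lemma min_wug_scale:
  assumes f: "f \<in> S2 m"
  shows "(\<lambda>x. c * f x) \<in> S2 m" "AE x in m. min_wug m (\<lambda>x. c * f x) x \<le> \<bar>c\<bar> * min_wug m f x"
proof -
  have lip: "\<bar>c\<bar>-lipschitz_on UNIV (\<lambda>y. c * y)"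
    by (auto simp: lipschitz_on_def dist_real_def abs_mult[symmetric] algebra_simps)
  have d: "((\<lambda>y. c * y) has_real_derivative c) (at y)" for y
    by (auto intro!: derivative_eq_intros)
  then have "(\<lambda>y. c * y) differentiable (at y)" "deriv (\<lambda>y. c * y) y = c" for y
    using real_differentiable_def DERIV_imp_deriv by blast+
  then show "(\<lambda>x. c * f x) \<in> S2 m" "AE x in m. min_wug m (\<lambda>x. c * f x) x \<le> \<bar>c\<bar> * min_wug m f x"
    using min_wug_lipschitz[OF f lip] by simp_all
qed

lemma min_wug_locality:
  assumes f: "f \<in> S2 m" and N: "N \<in> null_sets lborel"
  shows "AE x in m. f x \<in> N \<longrightarrow> min_wug m f x = 0"
proof -
  note fd = min_wug_props[OF f]
  have fm [measurable]: "f \<in> borel_measurable borel" using measurable_S2[OF m] f by auto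
  have [measurable]: "N \<in> sets borel" using N by auto
  have neg: "negligible N" using N by (simp add: negligible_iff_null_sets null_sets_completionI)
  define G where "G x = (if f x \<in> N then 0 else min_wug m f x)" for x
  have w: "weak_upper_gradient m f G"
  proof (rule weak_upper_gradientI[OF m])
    show "G \<in> borel_measurable borel" unfolding G_def[abs_def] using fd(1) by measurable
    show "0 \<le> G x" for x using fd(2) by (simp add: G_def)
    have "(\<integral>\<^sup>+x. ennreal ((G x)\<^sup>2) \<partial>m) \<le> (\<integral>\<^sup>+x. ennreal ((min_wug m f x)\<^sup>2) \<partial>m)"
      by (intro nn_integral_mono) (auto simp: G_def)
    then show "(\<integral>\<^sup>+x. ennreal ((G x)\<^sup>2) \<partial>m) < \<infinity>" using fd(3) by (rule le_less_trans)
    fix \<pi> assume \<pi>: "test_plan m \<pi>"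
    from AE_sobolev_path[OF m fm min_wug_wug[OF f] \<pi>]
    show "AE \<gamma> in \<pi>. ennreal \<bar>f (\<gamma> 1) - f (\<gamma> 0)\<bar> \<le> curve_integral G \<gamma> 0 1"
      by eventually_elim (use sobolev_path_locality[OF _ neg, of f "min_wug m f"] in \<open>auto simp: G_def[abs_def]\<close>)
  qed
  show ?thesis using min_wug_le[OF f w]
    by eventually_elim (use fd(2) in \<open>auto simp: G_def intro: antisym\<close>)
qed

text \<open>The essential bounds on \<open>f\<close> and \<open>g\<close> put the Leibniz expression
  in L^2; the estimate itself is the product rule along almost every curve.\<close>

lemma min_wug_mult:
  assumes f: "f \<in> S2 m \<inter> Linf m" and g: "g \<in> S2 m \<inter> Linf m"
  shows "(\<lambda>x. f x * g x) \<in> S2 m"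
    "AE x in m. min_wug m (\<lambda>x. f x * g x) x \<le> \<bar>f x\<bar> * min_wug m g x + \<bar>g x\<bar> * min_wug m f x"
proof -
  have fS: "f \<in> S2 m" and gS: "g \<in> S2 m" using f g by auto
  note fd = min_wug_props[OF fS] and gd = min_wug_props[OF gS]
  obtain A B where A: "AE x in m. \<bar>f x\<bar> \<le> A" and B: "AE x in m. \<bar>g x\<bar> \<le> B"
    using f g by (auto simp: Linf_def)
  have [measurable]: "f \<in> borel_measurable borel" "g \<in> borel_measurable borel"
    using measurable_S2[OF m] fS gS by auto
  note [measurable] = min_wug_measurable[OF fS] min_wug_measurable[OF gS]
  define G where "G x = \<bar>f x\<bar> * min_wug m g x + \<bar>g x\<bar> * min_wug m f x" for x
  have w: "weak_upper_gradient m (\<lambda>x. f x * g x) G"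
  proof (rule weak_upper_gradientI[OF m])
    show "G \<in> borel_measurable borel" unfolding G_def[abs_def] using fd(1) gd(1) by measurable
    show "0 \<le> G x" for x using fd(2) gd(2) by (simp add: G_def)
    have "(\<integral>\<^sup>+x. ennreal ((G x)\<^sup>2) \<partial>m)
      \<le> ennreal (2 * A\<^sup>2) * (\<integral>\<^sup>+x. ennreal ((min_wug m g x)\<^sup>2) \<partial>m) + ennreal (2 * B\<^sup>2) * (\<integral>\<^sup>+x. ennreal ((min_wug m f x)\<^sup>2) \<partial>m)"
    proof (rule nn_integral_square_le)
      show "AE x in m. \<bar>G x\<bar> \<le> A * min_wug m g x + B * min_wug m f x"
        using A B
      proof eventually_elim
        case (elim x)
        have "\<bar>G x\<bar> = G x" using fd(2) gd(2) by (simp add: G_def)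
        also have "\<dots> \<le> A * min_wug m g x + B * min_wug m f x"
          unfolding G_def using elim fd(2) gd(2) by (intro add_mono mult_right_mono) auto
        finally show ?case .
      qed
    qed measurable
    also have "\<dots> < \<infinity>" using fd(3) gd(3) by (simp add: ennreal_mult_less_top)
    finally show "(\<integral>\<^sup>+x. ennreal ((G x)\<^sup>2) \<partial>m) < \<infinity>" .
    fix \<pi> assume \<pi>: "test_plan m \<pi>"
    from AE_sobolev_path[OF m _ min_wug_wug[OF fS] \<pi>] AE_sobolev_path[OF m _ min_wug_wug[OF gS] \<pi>]
    show "AE \<gamma> in \<pi>. ennreal \<bar>f (\<gamma> 1) * g (\<gamma> 1) - f (\<gamma> 0) * g (\<gamma> 0)\<bar> \<le> curve_integral G \<gamma> 0 1"
    proof (rule eventually_elim2)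
      fix \<gamma> assume "\<gamma> \<in> mspace curves \<and> abs_cont_curve \<gamma> \<and> (\<exists>F. sobolev_path f (min_wug m f) \<gamma> F)"
        "\<gamma> \<in> mspace curves \<and> abs_cont_curve \<gamma> \<and> (\<exists>F. sobolev_path g (min_wug m g) \<gamma> F)"
      then show "ennreal \<bar>f (\<gamma> 1) * g (\<gamma> 1) - f (\<gamma> 0) * g (\<gamma> 0)\<bar> \<le> curve_integral G \<gamma> 0 1"
        using sobolev_path_mult[of f "min_wug m f" \<gamma> _ g "min_wug m g"] fd(2) gd(2)
        unfolding G_def[abs_def] by blast
    qed auto
  qed
  show S: "(\<lambda>x. f x * g x) \<in> S2 m" by (rule wug_S2[OF _ w]) measurable
  show "AE x in m. min_wug m (\<lambda>x. f x * g x) x \<le> \<bar>f x\<bar> * min_wug m g x + \<bar>g x\<bar> * min_wug m f x"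
    using min_wug_le[OF S w] by (simp add: G_def)
qed

end

section \<open>Families as functions of the base point\<close>

text \<open>Links the unordered sum in \<open>families\<close> to measures: the sum is a supremum
  over finite index sets, and an enumeration turns it into an increasing limit.\<close>

lemma infsum_emeasure:
  assumes I: "countable I" and disj: "disjoint_family_on A I" and A: "\<And>i. i \<in> I \<Longrightarrow> A i \<in> sets M"
  shows "(\<Sum>\<^sub>\<infinity>i\<in>I. emeasure M (A i)) = emeasure M (\<Union>i\<in>I. A i)"
proof (cases "I = {}")
  case False
  have fin: "(\<Sum>i\<in>J. emeasure M (A i)) = emeasure M (\<Union>i\<in>J. A i)" if "finite J" "J \<subseteq> I" for J
    using that A disj by (intro sum_emeasure) (auto elim: disjoint_family_on_mono)
  have eq: "(\<Sum>\<^sub>\<infinity>i\<in>I. emeasure M (A i)) = (SUP J\<in>{J. finite J \<and> J \<subseteq> I}. \<Sum>i\<in>J. emeasure M (A i))"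
    by (rule nonneg_infsum_complete) simp
  show ?thesis unfolding eq
  proof (rule antisym)
    show "(SUP J\<in>{J. finite J \<and> J \<subseteq> I}. \<Sum>i\<in>J. emeasure M (A i)) \<le> emeasure M (\<Union>i\<in>I. A i)"
    proof (rule SUP_least)
      fix J assume J: "J \<in> {J. finite J \<and> J \<subseteq> I}"
      have "emeasure M (\<Union>i\<in>J. A i) \<le> emeasure M (\<Union>i\<in>I. A i)"
        using J I A by (intro emeasure_mono) (auto intro!: sets.countable_UN')
      then show "(\<Sum>i\<in>J. emeasure M (A i)) \<le> emeasure M (\<Union>i\<in>I. A i)" using fin J by simp
    qed
    define J where "J n = from_nat_into I ` {..<n::nat}" for n
    have J: "finite (J n)" "J n \<subseteq> I" for n
      using from_nat_into[OF False] by (auto simp: J_def)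
    have "(\<Union>i\<in>I. A i) = (\<Union>n. \<Union>i\<in>J n. A i)"
    proof -
      have "I \<subseteq> (\<Union>n. J n)"
      proof
        fix i assume i: "i \<in> I"
        obtain n where "from_nat_into I n = i" using from_nat_into_surj[OF I i] ..
        then have "i \<in> J (Suc n)" unfolding J_def by (intro image_eqI[of _ _ n]) simp_all
        then show "i \<in> (\<Union>n. J n)" by (rule UN_I[OF UNIV_I])
      qed
      then have "I = (\<Union>n. J n)" using J(2) by (intro antisym UN_least)
      then show ?thesis by (simp only: UN_UN_flatten)
    qed
    moreover have Jm: "(\<Union>i\<in>J n. A i) \<in> sets M" for n
      using J A by (intro sets.finite_UN) blast+
    moreover have "incseq (\<lambda>n. \<Union>i\<in>J n. A i)"
    proof (rule incseq_SucI)
      show "(\<Union>i\<in>J n. A i) \<subseteq> (\<Union>i\<in>J (Suc n). A i)" for n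
        by (rule UN_mono) (auto simp: J_def)
    qed
    ultimately have "emeasure M (\<Union>i\<in>I. A i) = (SUP n. emeasure M (\<Union>i\<in>J n. A i))"
      using Jm by (subst SUP_emeasure_incseq) auto
    also have "\<dots> \<le> (SUP J\<in>{J. finite J \<and> J \<subseteq> I}. \<Sum>i\<in>J. emeasure M (A i))"
      using J fin by (intro SUP_mono) (auto intro!: bexI[of _ "J _"])
    finally show "emeasure M (\<Union>i\<in>I. A i) \<le> (SUP J\<in>{J. finite J \<and> J \<subseteq> I}. \<Sum>i\<in>J. emeasure M (A i))" .
  qed
qed simp

text \<open>A family as a field of functions: the value at x is the whole function of the member
  whose set contains x. The operations on families thereby become operations on functions at each
  point, whatever the partitions.\<close>

definition family_at :: "'a family \<Rightarrow> 'a \<Rightarrow> 'a \<Rightarrow> real" where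
  "family_at F x = fst (THE p. p \<in> F \<and> x \<in> snd p)"

lemma family_pnorm_at: "family_pnorm m F x = min_wug m (family_at F x) x"
  by (simp add: family_pnorm_def family_at_def)

text \<open>\<open>families\<close> without square summability, so that the structure of a family
  and its size can be treated one after the other.\<close>

definition borel_partition :: "'a::metric_space measure \<Rightarrow> 'a family \<Rightarrow> bool" where
  "borel_partition m F \<longleftrightarrow> countable F \<and> (\<forall>(f, A)\<in>F. f \<in> S2 m \<and> A \<in> sets borel) \<and>
     disjoint_family_on snd F \<and> (\<Union>p\<in>F. snd p) = UNIV"

lemma borel_partition_THE:
  assumes "borel_partition m F" "(f, A) \<in> F" "x \<in> A"
  shows "(THE p. p \<in> F \<and> x \<in> snd p) = (f, A)"
  using assms unfolding borel_partition_def disjoint_family_on_def by (intro the_equality) fastforce+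

lemma borel_partition_unique:
  assumes F: "borel_partition m F" and "(f, A) \<in> F" "x \<in> A" and "(f', A') \<in> F" "x \<in> A'"
  shows "f = f'" "A = A'"
  using borel_partition_THE[OF F assms(2,3)] borel_partition_THE[OF F assms(4,5)] by simp_all

lemma family_at_eq:
  assumes "borel_partition m F" "(f, A) \<in> F" "x \<in> A"
  shows "family_at F x = f"
  using borel_partition_THE[OF assms] by (simp add: family_at_def)

lemma borel_partition_cases:
  assumes "borel_partition m F"
  obtains f A where "(f, A) \<in> F" "x \<in> A" "family_at F x = f" "f \<in> S2 m"
proof -
  have "x \<in> (\<Union>p\<in>F. snd p)" using assms by (simp add: borel_partition_def)
  then obtain f A where *: "(f, A) \<in> F" "x \<in> A" by auto
  then have "f \<in> S2 m" using assms by (auto simp: borel_partition_def)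
  with * show ?thesis using family_at_eq[OF assms *] by (intro that)
qed

lemma family_at_S2: "borel_partition m F \<Longrightarrow> family_at F x \<in> S2 m"
  by (metis borel_partition_cases)

text \<open>Only countably many functions occur in a family, so their exceptional null sets can be
  united and the function may depend on the point. This carries estimates for fixed functions over
  to families.\<close>

lemma AE_family_at:
  assumes F: "borel_partition m F" and P: "\<And>f. f \<in> S2 m \<Longrightarrow> AE x in m. P f x"
  shows "AE x in m. P (family_at F x) x"
proof -
  have "AE x in m. \<forall>p\<in>F. P (fst p) x"
    using F P by (subst AE_ball_countable) (auto simp: borel_partition_def)
  then show ?thesis
    by eventually_elim (metis F borel_partition_cases fst_conv)
qed

lemma AE_family_at2:
  assumes F: "borel_partition m F" and G: "borel_partition m G"
    and P: "\<And>f g. f \<in> S2 m \<Longrightarrow> g \<in> S2 m \<Longrightarrow> AE x in m. P f g x"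
  shows "AE x in m. P (family_at F x) (family_at G x) x"
proof -
  have "AE x in m. \<forall>p\<in>F. \<forall>q\<in>G. P (fst p) (fst q) x"
    using F G P by (simp add: AE_ball_countable borel_partition_def) fastforce
  then show ?thesis
    by eventually_elim (metis F G borel_partition_cases fst_conv)
qed

lemma AE_family_at3:
  assumes F: "borel_partition m F" and G: "borel_partition m G" and H: "borel_partition m H"
    and P: "\<And>f g h. f \<in> S2 m \<Longrightarrow> g \<in> S2 m \<Longrightarrow> h \<in> S2 m \<Longrightarrow> AE x in m. P f g h x"
  shows "AE x in m. P (family_at F x) (family_at G x) (family_at H x) x"
proof -
  have "AE x in m. \<forall>p\<in>F. \<forall>q\<in>G. \<forall>r\<in>H. P (fst p) (fst q) (fst r) x"
    using F G H P by (simp add: AE_ball_countable borel_partition_def) fastforce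
  then show ?thesis
    by eventually_elim (metis F G H borel_partition_cases fst_conv)
qed

lemma borel_partition_singleton: "f \<in> S2 m \<Longrightarrow> borel_partition m {(f, UNIV)}"
  by (auto simp: borel_partition_def disjoint_family_on_def)

lemma family_at_singleton [simp]: "family_at {(f, UNIV)} x = f"
proof -
  have "(THE p. p \<in> {(f, UNIV)} \<and> x \<in> snd p) = (f, UNIV)" by (rule the_equality) auto
  then show ?thesis by (simp only: family_at_def fst_conv)
qed

context
  fixes m :: "'a::{metric_space, second_countable_topology} measure"
  assumes m: "sets m = sets borel"
begin

lemma borel_partition_add:
  assumes F: "borel_partition m F" and G: "borel_partition m G"
  shows "borel_partition m (family_add F G)"
    and "family_at (family_add F G) x = (\<lambda>y. family_at F x y + family_at G x y)"
proof -
  show *: "borel_partition m (family_add F G)"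
    unfolding borel_partition_def
  proof (intro conjI ballI)
    show "countable (family_add F G)" using F G by (auto simp: family_add_def borel_partition_def)
    show "case p of (f, A) \<Rightarrow> f \<in> S2 m \<and> A \<in> sets borel" if "p \<in> family_add F G" for p
      using that F G by (auto simp: family_add_def borel_partition_def intro: min_wug_add(1)[OF m] split: prod.splits)
    show "disjoint_family_on snd (family_add F G)"
      unfolding disjoint_family_on_def
    proof (intro ballI impI)
      fix p q assume p: "p \<in> family_add F G" and q: "q \<in> family_add F G" and ne: "p \<noteq> q"
      obtain f A g B where p': "(f, A) \<in> F" "(g, B) \<in> G" "p = (\<lambda>x. f x + g x, A \<inter> B)"
        using p by (auto simp: family_add_def)
      obtain f' A' g' B' where q': "(f', A') \<in> F" "(g', B') \<in> G" "q = (\<lambda>x. f' x + g' x, A' \<inter> B')"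
        using q by (auto simp: family_add_def)
      show "snd p \<inter> snd q = {}"
      proof (rule ccontr)
        assume "snd p \<inter> snd q \<noteq> {}"
        then obtain x where x: "x \<in> A" "x \<in> A'" "x \<in> B" "x \<in> B'" using p'(3) q'(3) by auto
        note borel_partition_unique[OF F p'(1) x(1) q'(1) x(2)] borel_partition_unique[OF G p'(2) x(3) q'(2) x(4)]
        with ne p'(3) q'(3) show False by simp
      qed
    qed
    have "x \<in> (\<Union>p\<in>family_add F G. snd p)" for x
    proof -
      obtain f A where "(f, A) \<in> F" "x \<in> A" using borel_partition_cases[OF F] by metis
      moreover obtain g B where "(g, B) \<in> G" "x \<in> B" using borel_partition_cases[OF G] by metis
      ultimately show ?thesis by (auto simp: family_add_def intro!: bexI)
    qed
    then show "(\<Union>p\<in>family_add F G. snd p) = UNIV" by blast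
  qed
  obtain f A where f: "(f, A) \<in> F" "x \<in> A" "family_at F x = f" using borel_partition_cases[OF F] by metis
  obtain g B where g: "(g, B) \<in> G" "x \<in> B" "family_at G x = g" using borel_partition_cases[OF G] by metis
  have "(\<lambda>x. f x + g x, A \<inter> B) \<in> family_add F G"
    using f g by (force simp: family_add_def)
  then show "family_at (family_add F G) x = (\<lambda>y. family_at F x y + family_at G x y)"
    using family_at_eq[OF *] f g by auto
qed

lemma borel_partition_mult:
  assumes F: "borel_partition m F" and h: "h \<in> borel_measurable borel" "finite (range h)"
  shows "borel_partition m (family_mult h F)"
    and "family_at (family_mult h F) x = (\<lambda>y. h x * family_at F x y)"
proof -
  have hm [measurable]: "h -` {a} \<in> sets borel" for a
    using measurable_sets[OF h(1), of "{a}"] by simp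
  show *: "borel_partition m (family_mult h F)"
    unfolding borel_partition_def
  proof (intro conjI ballI)
    show "countable (family_mult h F)" using F h by (auto simp: family_mult_def borel_partition_def countable_finite)
    show "case p of (f, A) \<Rightarrow> f \<in> S2 m \<and> A \<in> sets borel" if "p \<in> family_mult h F" for p
      using that F hm by (auto simp: family_mult_def borel_partition_def intro!: min_wug_scale(1)[OF m] sets.Int split: prod.splits)
    show "disjoint_family_on snd (family_mult h F)"
      unfolding disjoint_family_on_def
    proof (intro ballI impI)
      fix p q assume p: "p \<in> family_mult h F" and q: "q \<in> family_mult h F" and ne: "p \<noteq> q"
      obtain f A a where p': "(f, A) \<in> F" "p = (\<lambda>x. a * f x, A \<inter> h -` {a})"
        using p by (auto simp: family_mult_def)
      obtain f' A' a' where q': "(f', A') \<in> F" "q = (\<lambda>x. a' * f' x, A' \<inter> h -` {a'})"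
        using q by (auto simp: family_mult_def)
      show "snd p \<inter> snd q = {}"
      proof (rule ccontr)
        assume "snd p \<inter> snd q \<noteq> {}"
        then obtain x where x: "x \<in> A" "x \<in> A'" "h x = a" "h x = a'" using p'(2) q'(2) by auto
        note borel_partition_unique[OF F p'(1) x(1) q'(1) x(2)] x(3,4)
        with ne p'(2) q'(2) show False by simp
      qed
    qed
    have "x \<in> (\<Union>p\<in>family_mult h F. snd p)" for x
    proof -
      obtain f A where "(f, A) \<in> F" "x \<in> A" using borel_partition_cases[OF F] by metis
      then show ?thesis by (force simp: family_mult_def)
    qed
    then show "(\<Union>p\<in>family_mult h F. snd p) = UNIV" by blast
  qed
  obtain f A where f: "(f, A) \<in> F" "x \<in> A" "family_at F x = f" using borel_partition_cases[OF F] by metis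
  have "(\<lambda>y. h x * f y, A \<inter> h -` {h x}) \<in> family_mult h F"
    using f by (force simp: family_mult_def)
  then show "family_at (family_mult h F) x = (\<lambda>y. h x * family_at F x y)"
    using family_at_eq[OF *] f by auto
qed

lemma family_scale_eq_mult: "family_scale c F = family_mult (\<lambda>_. c) F"
  by (force simp: family_scale_def family_mult_def)

lemma borel_partition_scale:
  assumes F: "borel_partition m F"
  shows "borel_partition m (family_scale c F)"
    and "family_at (family_scale c F) x = (\<lambda>y. c * family_at F x y)"
  using borel_partition_mult[OF F, of "\<lambda>_. c"] by (simp_all add: family_scale_eq_mult)

text \<open>The selector of the active member takes countably many values, each on a Borel
  set.\<close>

lemma measurable_family_at:
  assumes F: "borel_partition m F" and k: "\<And>f. f \<in> S2 m \<Longrightarrow> k f \<in> borel_measurable m"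
  shows "(\<lambda>x. k (family_at F x) x) \<in> borel_measurable m"
  unfolding family_at_def
proof (rule measurable_compose_countable'[where I = F and f = "\<lambda>p x. k (fst p) x"])
  show "countable F" using F by (simp add: borel_partition_def)
  show "k (fst p) \<in> borel_measurable m" if "p \<in> F" for p
    using that F by (intro k) (auto simp: borel_partition_def)
  have sp: "space m = UNIV" using m by (metis sets_eq_imp_space_eq space_borel)
  have THE: "(THE p. p \<in> F \<and> x \<in> snd p) \<in> F \<and> x \<in> snd (THE p. p \<in> F \<and> x \<in> snd p)" for x
  proof -
    obtain f A where "(f, A) \<in> F" "x \<in> A" by (rule borel_partition_cases[OF F])
    then show ?thesis using borel_partition_THE[OF F, of f A x] by simp
  qed
  show "(\<lambda>x. THE p. p \<in> F \<and> x \<in> snd p) \<in> m \<rightarrow>\<^sub>M count_space F"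
  proof (subst measurable_count_space_eq_countable)
    show "countable F" using F by (simp add: borel_partition_def)
    have "(\<lambda>x. THE p. p \<in> F \<and> x \<in> snd p) -` {p} \<inter> space m = snd p" if "p \<in> F" for p
    proof (intro set_eqI iffI)
      fix x assume "x \<in> (\<lambda>x. THE p. p \<in> F \<and> x \<in> snd p) -` {p} \<inter> space m"
      then have "(THE p. p \<in> F \<and> x \<in> snd p) = p" by simp
      then show "x \<in> snd p" using THE[of x] by simp
    next
      fix x assume "x \<in> snd p"
      then have "(THE p. p \<in> F \<and> x \<in> snd p) = p"
        using borel_partition_THE[OF F, of "fst p" "snd p" x] \<open>p \<in> F\<close> by simp
      then show "x \<in> (\<lambda>x. THE p. p \<in> F \<and> x \<in> snd p) -` {p} \<inter> space m" by (simp add: sp)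
    qed
    moreover have "snd p \<in> sets m" if "p \<in> F" for p
      using that F m by (auto simp: borel_partition_def)
    ultimately show "(\<lambda>x. THE p. p \<in> F \<and> x \<in> snd p) \<in> space m \<rightarrow> F \<and>
      (\<forall>p\<in>F. (\<lambda>x. THE p. p \<in> F \<and> x \<in> snd p) -` {p} \<inter> space m \<in> sets m)"
      using THE by auto
  qed
qed

lemma family_pnorm_measurable: "borel_partition m F \<Longrightarrow> family_pnorm m F \<in> borel_measurable m"
  unfolding family_pnorm_at[abs_def] by (rule measurable_family_at[OF _ min_wug_measurable[OF m]])

text \<open>As the sets of the members partition the space, the sum of integrals is the total mass
  of the measure whose density is the squared pointwise norm.\<close>

lemma families_iff:
  "F \<in> families m \<longleftrightarrow> borel_partition m F \<and> (\<integral>\<^sup>+x. ennreal ((family_pnorm m F x)\<^sup>2) \<partial>m) < \<infinity>"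
proof -
  have "(\<Sum>\<^sub>\<infinity>(f, A)\<in>F. \<integral>\<^sup>+x\<in>A. ennreal ((min_wug m f x)\<^sup>2) \<partial>m) = (\<integral>\<^sup>+x. ennreal ((family_pnorm m F x)\<^sup>2) \<partial>m)"
    if F: "borel_partition m F"
  proof -
    have [measurable]: "family_pnorm m F \<in> borel_measurable m" using F by (rule family_pnorm_measurable)
    have sp: "space m = UNIV" using m by (metis sets_eq_imp_space_eq space_borel)
    let ?N = "density m (\<lambda>x. ennreal ((family_pnorm m F x)\<^sup>2))"
    have "(\<Sum>\<^sub>\<infinity>(f, A)\<in>F. \<integral>\<^sup>+x\<in>A. ennreal ((min_wug m f x)\<^sup>2) \<partial>m) = (\<Sum>\<^sub>\<infinity>p\<in>F. emeasure ?N (snd p))"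
    proof (rule infsum_cong)
      fix p assume p: "p \<in> F"
      obtain f A where fA: "p = (f, A)" by (cases p)
      have "A \<in> sets m" using p F fA m by (auto simp: borel_partition_def)
      then have "emeasure ?N A = (\<integral>\<^sup>+x\<in>A. ennreal ((family_pnorm m F x)\<^sup>2) \<partial>m)" by (subst emeasure_density) auto
      also have "\<dots> = (\<integral>\<^sup>+x\<in>A. ennreal ((min_wug m f x)\<^sup>2) \<partial>m)"
        using family_at_eq[OF F] p fA
        by (intro nn_integral_cong) (auto simp: family_pnorm_at split: split_indicator)
      finally show "(case p of (f, A) \<Rightarrow> \<integral>\<^sup>+x\<in>A. ennreal ((min_wug m f x)\<^sup>2) \<partial>m) = emeasure ?N (snd p)"
        by (simp add: fA)
    qed
    also have "\<dots> = emeasure ?N (\<Union>p\<in>F. snd p)"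
      using F m by (intro infsum_emeasure) (auto simp: borel_partition_def)
    also have "\<dots> = emeasure ?N (space m)" using F by (simp add: borel_partition_def sp)
    also have "\<dots> = (\<integral>\<^sup>+x. ennreal ((family_pnorm m F x)\<^sup>2) \<partial>m)"
      by (subst emeasure_density) (auto intro!: nn_integral_cong)
    finally show ?thesis .
  qed
  then show ?thesis unfolding families_def borel_partition_def by auto
qed

end

section \<open>Squared distance between families\<close>

definition family_gap :: "'a::metric_space measure \<Rightarrow> 'a family \<Rightarrow> 'a family \<Rightarrow> 'a \<Rightarrow> real" where
  "family_gap m F G x = min_wug m (\<lambda>y. family_at F x y - family_at G x y) x"

text \<open>The squared distance of the classes of \<open>F\<close> and \<open>G\<close>. In
  \<open>ennreal\<close> it makes sense before any summability is known.\<close>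

definition sq_gap :: "'a::metric_space measure \<Rightarrow> 'a family \<Rightarrow> 'a family \<Rightarrow> ennreal" where
  "sq_gap m F G = (\<integral>\<^sup>+x. ennreal ((family_gap m F G x)\<^sup>2) \<partial>m)"

definition sq_norm :: "'a::metric_space measure \<Rightarrow> 'a family \<Rightarrow> ennreal" where
  "sq_norm m F = (\<integral>\<^sup>+x. ennreal ((family_pnorm m F x)\<^sup>2) \<partial>m)"

context
  fixes m :: "'a::{metric_space, second_countable_topology} measure"
  assumes m: "sets m = sets borel"
begin

lemma S2_diff:
  assumes "f \<in> S2 m" "g \<in> S2 m"
  shows "(\<lambda>x. f x - g x) \<in> S2 m"
    "AE x in m. min_wug m (\<lambda>x. f x - g x) x \<le> min_wug m f x + min_wug m g x"
proof -
  note sc = min_wug_scale[OF m assms(2), of "-1"]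
  have eq: "(\<lambda>x. f x + -1 * g x) = (\<lambda>x. f x - g x)" by simp
  note ad = min_wug_add[OF m assms(1) sc(1), unfolded eq]
  show "(\<lambda>x. f x - g x) \<in> S2 m" by (rule ad)
  show "AE x in m. min_wug m (\<lambda>x. f x - g x) x \<le> min_wug m f x + min_wug m g x"
    using ad(2) sc(2) by eventually_elim simp
qed

lemma min_wug_diff_commute:
  assumes "f \<in> S2 m" "g \<in> S2 m"
  shows "AE x in m. min_wug m (\<lambda>x. f x - g x) x \<le> min_wug m (\<lambda>x. g x - f x) x"
  using min_wug_scale(2)[OF m S2_diff(1)[OF assms(2,1)], of "-1"] by simp

lemma min_wug_diff_triangle:
  assumes "f \<in> S2 m" "g \<in> S2 m" "h \<in> S2 m"
  shows "AE x in m. min_wug m (\<lambda>x. f x - h x) x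
    \<le> min_wug m (\<lambda>x. f x - g x) x + min_wug m (\<lambda>x. g x - h x) x"
  using min_wug_add(2)[OF m S2_diff(1)[OF assms(1,2)] S2_diff(1)[OF assms(2,3)]] by simp

lemma min_wug_le_diff_add:
  assumes "f \<in> S2 m" "g \<in> S2 m"
  shows "AE x in m. min_wug m f x \<le> min_wug m (\<lambda>x. f x - g x) x + min_wug m g x"
  using min_wug_add(2)[OF m S2_diff(1)[OF assms] assms(2)] by simp

lemma family_gap_eq_pnorm:
  assumes "borel_partition m F" "borel_partition m G"
  shows "family_gap m F G = family_pnorm m (family_add F (family_scale (- 1) G))"
proof
  fix x
  have "family_at (family_add F (family_scale (- 1) G)) x = (\<lambda>y. family_at F x y - family_at G x y)"
    by (simp add: borel_partition_add(2)[OF m assms(1) borel_partition_scale(1)[OF m assms(2)]]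
        borel_partition_scale(2)[OF m assms(2)])
  then show "family_gap m F G x = family_pnorm m (family_add F (family_scale (- 1) G)) x"
    by (simp only: family_gap_def family_pnorm_at)
qed

lemma family_gap_measurable [measurable]:
  assumes "borel_partition m F" "borel_partition m G"
  shows "family_gap m F G \<in> borel_measurable m"
  using assms
  by (simp add: family_gap_eq_pnorm family_pnorm_measurable[OF m] borel_partition_add[OF m] borel_partition_scale[OF m])

lemma family_gap_nonneg:
  assumes "borel_partition m F" "borel_partition m G"
  shows "0 \<le> family_gap m F G x"
  unfolding family_gap_def
  by (rule min_wug_props(2)[OF m S2_diff(1)]) (rule family_at_S2[OF assms(1)] family_at_S2[OF assms(2)])+

lemma family_pnorm_nonneg: "borel_partition m F \<Longrightarrow> 0 \<le> family_pnorm m F x"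
  unfolding family_pnorm_at by (rule min_wug_props(2)[OF m family_at_S2])

lemma families_partition: "F \<in> families m \<Longrightarrow> borel_partition m F"
  by (simp add: families_iff[OF m])

lemma sq_norm_finite: "F \<in> families m \<Longrightarrow> sq_norm m F < \<infinity>"
  by (simp add: families_iff[OF m] sq_norm_def)

lemma familiesI: "borel_partition m F \<Longrightarrow> sq_norm m F < \<infinity> \<Longrightarrow> F \<in> families m"
  by (simp add: families_iff[OF m] sq_norm_def)

lemma families_singleton:
  assumes "f \<in> S2 m" shows "{(f, UNIV)} \<in> families m"
  using borel_partition_singleton[OF assms] min_wug_props(3)[OF m assms]
  by (intro familiesI) (simp_all add: sq_norm_def family_pnorm_at)

lemma families_add:
  assumes F: "F \<in> families m" and G: "G \<in> families m"
  shows "family_add F G \<in> families m"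
proof (rule familiesI)
  note F' = families_partition[OF F] and G' = families_partition[OF G]
  show "borel_partition m (family_add F G)" by (rule borel_partition_add(1)[OF m F' G'])
  have "AE x in m. min_wug m (\<lambda>y. family_at F x y + family_at G x y) x
      \<le> min_wug m (family_at F x) x + min_wug m (family_at G x) x"
    by (rule AE_family_at2[OF F' G']) (rule min_wug_add(2)[OF m])
  then have "AE x in m. \<bar>family_pnorm m (family_add F G) x\<bar> \<le> 1 * family_pnorm m F x + 1 * family_pnorm m G x"
    using family_pnorm_nonneg[OF borel_partition_add(1)[OF m F' G']]
    by (simp add: family_pnorm_at borel_partition_add(2)[OF m F' G'])
  then have "sq_norm m (family_add F G) \<le> ennreal (2 * 1\<^sup>2) * sq_norm m F + ennreal (2 * 1\<^sup>2) * sq_norm m G"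
    unfolding sq_norm_def by (intro nn_integral_square_le family_pnorm_measurable[OF m] F' G')
  also have "\<dots> < \<infinity>" using sq_norm_finite[OF F] sq_norm_finite[OF G] by (simp add: ennreal_mult_less_top)
  finally show "sq_norm m (family_add F G) < \<infinity>" .
qed

text \<open>From the splitting \<open>a * f - b * g = a * (f - g) + (a - b) * g\<close>.\<close>

lemma min_wug_lincomb_diff:
  assumes f: "f \<in> S2 m" and g: "g \<in> S2 m"
  shows "AE x in m. min_wug m (\<lambda>y. a * f y - b * g y) x
    \<le> \<bar>a\<bar> * min_wug m (\<lambda>y. f y - g y) x + \<bar>a - b\<bar> * min_wug m g x"
proof -
  note d = S2_diff(1)[OF f g]
  note s1 = min_wug_scale[OF m d, of a] and s2 = min_wug_scale[OF m g, of "a - b"]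
  have eq: "(\<lambda>y. a * (f y - g y) + (a - b) * g y) = (\<lambda>y. a * f y - b * g y)"
    by (simp add: algebra_simps)
  show ?thesis
    using min_wug_add(2)[OF m s1(1) s2(1), unfolded eq] s1(2) s2(2) by eventually_elim linarith
qed

text \<open>The estimate behind multiplication, with the simple function and the family varying at
  once. Since \<open>h\<close> and \<open>k\<close> have finitely many values, the bound for
  constant factors holds almost everywhere for all pairs of values together, in particular for the
  values at the point itself.\<close>

lemma sq_gap_mult_le:
  assumes F: "borel_partition m F" and G: "borel_partition m G"
    and h: "h \<in> borel_measurable borel" "finite (range h)"
    and k: "k \<in> borel_measurable borel" "finite (range k)"
    and C: "AE x in m. \<bar>h x\<bar> \<le> C" and e: "AE x in m. \<bar>h x - k x\<bar> \<le> e"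
  shows "sq_gap m (family_mult h F) (family_mult k G) \<le> ennreal (2 * C\<^sup>2) * sq_gap m F G + ennreal (2 * e\<^sup>2) * sq_norm m G"
proof -
  have ae: "AE x in m. \<forall>a\<in>range h. \<forall>b\<in>range k. min_wug m (\<lambda>y. a * family_at F x y - b * family_at G x y) x
    \<le> \<bar>a\<bar> * min_wug m (\<lambda>y. family_at F x y - family_at G x y) x + \<bar>a - b\<bar> * min_wug m (family_at G x) x"
  proof (rule AE_family_at2[OF F G])
    fix f g assume "f \<in> S2 m" "g \<in> S2 m"
    then show "AE x in m. \<forall>a\<in>range h. \<forall>b\<in>range k. min_wug m (\<lambda>y. a * f y - b * g y) x
      \<le> \<bar>a\<bar> * min_wug m (\<lambda>y. f y - g y) x + \<bar>a - b\<bar> * min_wug m g x"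
      using h(2) k(2) by (intro AE_finite_allI min_wug_lincomb_diff)
  qed
  have "AE x in m. \<bar>family_gap m (family_mult h F) (family_mult k G) x\<bar> \<le> C * family_gap m F G x + e * family_pnorm m G x"
    using ae C e
  proof eventually_elim
    case (elim x)
    have "family_gap m (family_mult h F) (family_mult k G) x
      \<le> \<bar>h x\<bar> * family_gap m F G x + \<bar>h x - k x\<bar> * family_pnorm m G x"
      using elim(1) by (simp add: family_gap_def family_pnorm_at borel_partition_mult(2)[OF m F h] borel_partition_mult(2)[OF m G k])
    also have "\<dots> \<le> C * family_gap m F G x + e * family_pnorm m G x"
      using elim family_gap_nonneg[OF F G] family_pnorm_nonneg[OF G] by (intro add_mono mult_right_mono) auto
    finally show ?case
      using family_gap_nonneg[OF borel_partition_mult(1)[OF m F h] borel_partition_mult(1)[OF m G k], of x] by simp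
  qed
  then show ?thesis
    unfolding sq_gap_def sq_norm_def
    by (intro nn_integral_square_le family_pnorm_measurable[OF m] family_gap_measurable F G)
qed

lemma families_mult:
  assumes F: "F \<in> families m" and h: "h \<in> borel_measurable borel" "finite (range h)"
  shows "family_mult h F \<in> families m"
proof (rule familiesI)
  note F' = families_partition[OF F]
  show p: "borel_partition m (family_mult h F)" by (rule borel_partition_mult(1)[OF m F' h])
  obtain C where C: "\<And>x. \<bar>h x\<bar> \<le> C"
    using finite_imp_bounded[OF h(2)] unfolding bounded_iff by auto
  have "AE x in m. \<forall>a\<in>range h. min_wug m (\<lambda>y. a * family_at F x y) x \<le> \<bar>a\<bar> * min_wug m (family_at F x) x"
    by (rule AE_family_at[OF F']) (intro AE_finite_allI h(2) min_wug_scale(2)[OF m])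
  \<comment> \<open>The zero summand brings the bound into the two-term form of
    \<open>nn_integral_square_le\<close>.\<close>
  then have "AE x in m. \<bar>family_pnorm m (family_mult h F) x\<bar> \<le> C * family_pnorm m F x + 0 * family_pnorm m F x"
  proof eventually_elim
    case (elim x)
    then have "family_pnorm m (family_mult h F) x \<le> \<bar>h x\<bar> * family_pnorm m F x"
      by (simp add: family_pnorm_at borel_partition_mult(2)[OF m F' h])
    also have "\<dots> \<le> C * family_pnorm m F x"
      using C family_pnorm_nonneg[OF F'] by (rule mult_right_mono)
    finally show ?case using family_pnorm_nonneg[OF p, of x] by simp
  qed
  then have "sq_norm m (family_mult h F) \<le> ennreal (2 * C\<^sup>2) * sq_norm m F + ennreal (2 * 0\<^sup>2) * sq_norm m F"
    unfolding sq_norm_def by (intro nn_integral_square_le family_pnorm_measurable[OF m] F')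
  also have "\<dots> < \<infinity>" using sq_norm_finite[OF F] by (simp add: ennreal_mult_less_top)
  finally show "sq_norm m (family_mult h F) < \<infinity>" .
qed

lemma families_scale: "F \<in> families m \<Longrightarrow> family_scale c F \<in> families m"
  unfolding family_scale_eq_mult[OF m] by (rule families_mult) auto

lemma sq_gap_finite:
  assumes "F \<in> families m" "G \<in> families m" shows "sq_gap m F G < \<infinity>"
  using sq_norm_finite[OF families_add[OF assms(1) families_scale[OF assms(2)]], of "- 1"] assms
  by (simp add: sq_gap_def sq_norm_def family_gap_eq_pnorm families_partition)

lemma sq_gap_self: assumes "borel_partition m F" shows "sq_gap m F F = 0"
proof -
  have "AE x in m. ennreal ((family_gap m F F x)\<^sup>2) = 0"
    using min_wug_const(2)[OF m, of 0] by eventually_elim (simp add: family_gap_def)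
  then have "sq_gap m F F = (\<integral>\<^sup>+x. 0 \<partial>m)" unfolding sq_gap_def by (rule nn_integral_cong_AE)
  then show ?thesis by simp
qed

lemma sq_gap_triangle:
  assumes F: "borel_partition m F" and G: "borel_partition m G" and H: "borel_partition m H"
  shows "sq_gap m F H \<le> 2 * sq_gap m F G + 2 * sq_gap m G H"
proof -
  have "AE x in m. min_wug m (\<lambda>y. family_at F x y - family_at H x y) x
    \<le> min_wug m (\<lambda>y. family_at F x y - family_at G x y) x + min_wug m (\<lambda>y. family_at G x y - family_at H x y) x"
    by (rule AE_family_at3[OF F G H]) (rule min_wug_diff_triangle)
  then have "AE x in m. \<bar>family_gap m F H x\<bar> \<le> 1 * family_gap m F G x + 1 * family_gap m G H x"
    using family_gap_nonneg[OF F H] by (simp add: family_gap_def)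
  then have "sq_gap m F H \<le> ennreal (2 * 1\<^sup>2) * sq_gap m F G + ennreal (2 * 1\<^sup>2) * sq_gap m G H"
    unfolding sq_gap_def by (intro nn_integral_square_le family_gap_measurable F G H)
  then show ?thesis by simp
qed

lemma sq_gap_commute:
  assumes F: "borel_partition m F" and G: "borel_partition m G"
  shows "sq_gap m F G = sq_gap m G F"
proof -
  have "AE x in m. min_wug m (\<lambda>y. family_at F x y - family_at G x y) x = min_wug m (\<lambda>y. family_at G x y - family_at F x y) x"
  proof (rule AE_family_at2[OF F G])
    fix f g assume "f \<in> S2 m" "g \<in> S2 m"
    from min_wug_diff_commute[OF this] min_wug_diff_commute[OF this(2,1)]
    show "AE x in m. min_wug m (\<lambda>y. f y - g y) x = min_wug m (\<lambda>y. g y - f y) x"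
      by eventually_elim (rule antisym)
  qed
  then show ?thesis unfolding sq_gap_def family_gap_def by (intro nn_integral_cong_AE) (auto elim: eventually_mono)
qed

text \<open>The difference of the sums is regrouped as the sum of the differences; these are
  families themselves, and subadditivity applies to them.\<close>

lemma sq_gap_add_le:
  assumes F: "borel_partition m F" and G: "borel_partition m G" and F': "borel_partition m F'" and G': "borel_partition m G'"
  shows "sq_gap m (family_add F G) (family_add F' G') \<le> 2 * sq_gap m F F' + 2 * sq_gap m G G'"
proof -
  have part: "borel_partition m (family_add F (family_scale (-1) F'))" "borel_partition m (family_add G (family_scale (-1) G'))"
    using assms by (simp_all add: borel_partition_add[OF m] borel_partition_scale[OF m])
  let ?D = "family_add F (family_scale (-1) F')" and ?E = "family_add G (family_scale (-1) G')"
  have "AE x in m. min_wug m (\<lambda>y. family_at ?D x y + family_at ?E x y) x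
    \<le> min_wug m (family_at ?D x) x + min_wug m (family_at ?E x) x"
    by (rule AE_family_at2[OF part]) (rule min_wug_add(2)[OF m])
  moreover have "(\<lambda>y. family_at ?D x y + family_at ?E x y)
    = (\<lambda>y. family_at (family_add F G) x y - family_at (family_add F' G') x y)" for x
    using assms by (simp add: borel_partition_add[OF m] borel_partition_scale[OF m] fun_eq_iff)
  ultimately have "AE x in m. family_gap m (family_add F G) (family_add F' G') x \<le> family_pnorm m ?D x + family_pnorm m ?E x"
    by (simp add: family_gap_def family_pnorm_at)
  then have "AE x in m. \<bar>family_gap m (family_add F G) (family_add F' G') x\<bar> \<le> 1 * family_gap m F F' x + 1 * family_gap m G G' x"
    using family_gap_nonneg[OF borel_partition_add(1)[OF m F G] borel_partition_add(1)[OF m F' G']]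
    by (simp add: family_gap_eq_pnorm[OF F F'] family_gap_eq_pnorm[OF G G'])
  then have "sq_gap m (family_add F G) (family_add F' G') \<le> ennreal (2 * 1\<^sup>2) * sq_gap m F F' + ennreal (2 * 1\<^sup>2) * sq_gap m G G'"
    unfolding sq_gap_def by (intro nn_integral_square_le family_gap_measurable assms)
  then show ?thesis by simp
qed

text \<open>There are countably many intersections of members, so vanishing almost everywhere on
  each of them amounts to vanishing almost everywhere on the space.\<close>

lemma family_rel_iff:
  "(F, G) \<in> family_rel m \<longleftrightarrow> F \<in> families m \<and> G \<in> families m \<and> sq_gap m F G = 0"
proof (cases "F \<in> families m \<and> G \<in> families m")
  case True
  then have F: "borel_partition m F" and G: "borel_partition m G" by (simp_all add: families_partition)
  have [measurable]: "family_gap m F G \<in> borel_measurable m" by (rule family_gap_measurable[OF F G])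
  have cF: "countable F" and cG: "countable G" using F G by (simp_all add: borel_partition_def)
  have "sq_gap m F G = 0 \<longleftrightarrow> (AE x in m. family_gap m F G x = 0)"
    unfolding sq_gap_def by (subst nn_integral_0_iff_AE) auto
  also have "\<dots> \<longleftrightarrow> (\<forall>p\<in>F. \<forall>q\<in>G. AE x in m. x \<in> snd p \<inter> snd q \<longrightarrow> min_wug m (\<lambda>y. fst p y - fst q y) x = 0)"
  proof
    assume *: "AE x in m. family_gap m F G x = 0"
    show "\<forall>p\<in>F. \<forall>q\<in>G. AE x in m. x \<in> snd p \<inter> snd q \<longrightarrow> min_wug m (\<lambda>y. fst p y - fst q y) x = 0"
    proof (intro ballI)
      fix p q assume pq: "p \<in> F" "q \<in> G"
      from * show "AE x in m. x \<in> snd p \<inter> snd q \<longrightarrow> min_wug m (\<lambda>y. fst p y - fst q y) x = 0"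
      proof (eventually_elim, intro impI)
        fix x assume "family_gap m F G x = 0" "x \<in> snd p \<inter> snd q"
        then show "min_wug m (\<lambda>y. fst p y - fst q y) x = 0"
          using family_at_eq[OF F, of "fst p" "snd p" x] family_at_eq[OF G, of "fst q" "snd q" x] pq
          by (simp add: family_gap_def)
      qed
    qed
  next
    assume "\<forall>p\<in>F. \<forall>q\<in>G. AE x in m. x \<in> snd p \<inter> snd q \<longrightarrow> min_wug m (\<lambda>y. fst p y - fst q y) x = 0"
    then have "AE x in m. \<forall>p\<in>F. \<forall>q\<in>G. x \<in> snd p \<inter> snd q \<longrightarrow> min_wug m (\<lambda>y. fst p y - fst q y) x = 0"
      by (simp only: AE_ball_countable[OF cF] AE_ball_countable[OF cG] simp_thms)
    then show "AE x in m. family_gap m F G x = 0"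
    proof eventually_elim
      case (elim x)
      obtain f A where f: "(f, A) \<in> F" "x \<in> A" "family_at F x = f" by (rule borel_partition_cases[OF F])
      obtain g B where g: "(g, B) \<in> G" "x \<in> B" "family_at G x = g" by (rule borel_partition_cases[OF G])
      from bspec[OF bspec[OF elim f(1)] g(1)] f g show ?case by (simp add: family_gap_def)
    qed
  qed
  finally show ?thesis using True by (auto simp: family_rel_def split_beta)
qed (auto simp: family_rel_def)

lemma equiv_family_rel: "equiv (families m) (family_rel m)"
proof (rule equivI)
  show "family_rel m \<subseteq> families m \<times> families m" by (auto simp: family_rel_iff)
  show "refl_on (families m) (family_rel m)"
    by (auto simp: refl_on_def family_rel_iff sq_gap_self families_partition)
  show "sym (family_rel m)"
    by (auto simp: sym_def family_rel_iff sq_gap_commute families_partition)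
  show "trans (family_rel m)"
  proof (rule transI)
    fix F G H assume *: "(F, G) \<in> family_rel m" "(G, H) \<in> family_rel m"
    then have "sq_gap m F H \<le> 2 * sq_gap m F G + 2 * sq_gap m G H"
      by (intro sq_gap_triangle) (auto simp: family_rel_iff families_partition)
    then show "(F, H) \<in> family_rel m" using * by (simp add: family_rel_iff)
  qed
qed

section \<open>Operations on classes of families\<close>

lemma mem_precot_class: "G \<in> precot_class m F \<longleftrightarrow> F \<in> families m \<and> G \<in> families m \<and> sq_gap m F G = 0"
  by (simp add: precot_class_def family_rel_iff)

lemma precot_class_self: "F \<in> families m \<Longrightarrow> F \<in> precot_class m F"
  by (simp add: mem_precot_class sq_gap_self families_partition)

lemma precot_class_eq: "F \<in> families m \<Longrightarrow> G \<in> families m \<Longrightarrow> sq_gap m F G = 0 \<Longrightarrow> precot_class m F = precot_class m G"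
  unfolding precot_class_def by (rule equiv_class_eq[OF equiv_family_rel]) (simp add: family_rel_iff)

lemma precot_class_mem: "F \<in> families m \<Longrightarrow> precot_class m F \<in> precot m"
  unfolding precot_def precot_class_def by (rule quotientI)

lemma precotE:
  assumes "X \<in> precot m" obtains F where "F \<in> families m" "X = precot_class m F"
  using assms unfolding precot_def precot_class_def by (auto elim: quotientE)

text \<open>Representatives at distance zero have sums at distance zero, so the defining union
  collapses to one class.\<close>

lemma precot_add_class:
  assumes F: "F \<in> families m" and G: "G \<in> families m"
  shows "precot_add m (precot_class m F) (precot_class m G) = precot_class m (family_add F G)"
proof -
  have "precot_class m (family_add F' G') = precot_class m (family_add F G)"
    if F': "F' \<in> precot_class m F" and G': "G' \<in> precot_class m G" for F' G'
  proof (rule precot_class_eq[symmetric])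
    have "sq_gap m (family_add F G) (family_add F' G') \<le> 2 * sq_gap m F F' + 2 * sq_gap m G G'"
      using F' G' by (intro sq_gap_add_le) (auto simp: mem_precot_class families_partition)
    then show "sq_gap m (family_add F G) (family_add F' G') = 0" using F' G' by (simp add: mem_precot_class)
  qed (use F' G' in \<open>auto simp: mem_precot_class families_add\<close>)
  then have "precot_add m (precot_class m F) (precot_class m G)
    = (\<Union>F'\<in>precot_class m F. \<Union>G'\<in>precot_class m G. precot_class m (family_add F G))"
    unfolding precot_add_def by (intro SUP_cong refl) auto
  also have "\<dots> = precot_class m (family_add F G)"
    using precot_class_self[OF F] precot_class_self[OF G] by auto
  finally show ?thesis .
qed

lemma precot_mult_class:
  assumes F: "F \<in> families m" and h: "h \<in> borel_measurable borel" "finite (range h)"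
  shows "precot_mult m h (precot_class m F) = precot_class m (family_mult h F)"
proof -
  obtain C where C: "\<And>x. \<bar>h x\<bar> \<le> C"
    using finite_imp_bounded[OF h(2)] unfolding bounded_iff by auto
  have "precot_class m (family_mult h F') = precot_class m (family_mult h F)"
    if F': "F' \<in> precot_class m F" for F'
  proof (rule precot_class_eq[symmetric])
    \<comment> \<open>With the same simple function on both sides the deviation is 0, which removes
      the term containing the norm.\<close>
    have "sq_gap m (family_mult h F) (family_mult h F') \<le> ennreal (2 * C\<^sup>2) * sq_gap m F F' + ennreal (2 * 0\<^sup>2) * sq_norm m F'"
      using F' C h by (intro sq_gap_mult_le) (auto simp: mem_precot_class families_partition)
    then show "sq_gap m (family_mult h F) (family_mult h F') = 0" using F' by (simp add: mem_precot_class)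
  qed (use F' in \<open>auto simp: mem_precot_class families_mult h\<close>)
  then have "precot_mult m h (precot_class m F) = (\<Union>F'\<in>precot_class m F. precot_class m (family_mult h F))"
    unfolding precot_mult_def by (intro SUP_cong refl) auto
  also have "\<dots> = precot_class m (family_mult h F)"
    using precot_class_self[OF F] by auto
  finally show ?thesis .
qed

lemma precot_scale_class:
  assumes F: "F \<in> families m"
  shows "precot_scale m c (precot_class m F) = precot_class m (family_scale c F)"
  using precot_mult_class[OF F, of "\<lambda>_. c"]
  by (simp add: precot_scale_def precot_mult_def family_scale_eq_mult[OF m])

text \<open>Equivalent representatives have the same pointwise norm almost everywhere, so
  \<open>the_elem\<close> is applied to a singleton.\<close>

lemma precot_norm_class:
  assumes F: "F \<in> families m"
  shows "precot_norm m (precot_class m F) = sqrt (enn2real (sq_norm m F))"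
proof -
  have "sqrt (\<integral>x. (family_pnorm m G x)\<^sup>2 \<partial>m) = sqrt (enn2real (sq_norm m F))" if G: "G \<in> precot_class m F" for G
  proof -
    have F': "borel_partition m F" and G': "borel_partition m G"
      using F G by (simp_all add: families_partition mem_precot_class)
    have gm: "family_gap m F G \<in> borel_measurable m" by (rule family_gap_measurable[OF F' G'])
    have [measurable]: "family_pnorm m G \<in> borel_measurable m" by (rule family_pnorm_measurable[OF m G'])
    have gap0: "AE x in m. family_gap m F G x = 0"
      using G gm unfolding mem_precot_class sq_gap_def by (subst (asm) nn_integral_0_iff_AE) auto
    have "AE x in m. min_wug m (family_at F x) x \<le>
        min_wug m (\<lambda>y. family_at F x y - family_at G x y) x + min_wug m (family_at G x) x"
      by (rule AE_family_at2[OF F' G']) (rule min_wug_le_diff_add)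
    moreover have "AE x in m. min_wug m (family_at G x) x \<le>
        min_wug m (\<lambda>y. family_at F x y - family_at G x y) x + min_wug m (family_at F x) x"
    proof (rule AE_family_at2[OF F' G'])
      fix f g assume "f \<in> S2 m" "g \<in> S2 m"
      from min_wug_le_diff_add[OF this(2,1)] min_wug_diff_commute[OF this(2,1)]
      show "AE x in m. min_wug m g x \<le> min_wug m (\<lambda>y. f y - g y) x + min_wug m f x"
        by eventually_elim linarith
    qed
    ultimately have "AE x in m. family_pnorm m G x = family_pnorm m F x"
      using gap0 by eventually_elim (simp add: family_gap_def family_pnorm_at)
    then have "(\<integral>\<^sup>+x. ennreal ((family_pnorm m G x)\<^sup>2) \<partial>m) = sq_norm m F"
      unfolding sq_norm_def by (intro nn_integral_cong_AE) (auto elim: eventually_mono)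
    then show ?thesis by (subst integral_eq_nn_integral) auto
  qed
  then have "(\<lambda>G. sqrt (\<integral>x. (family_pnorm m G x)\<^sup>2 \<partial>m)) ` precot_class m F = {sqrt (enn2real (sq_norm m F))}"
    using precot_class_self[OF F] by auto
  then show ?thesis by (simp add: precot_norm_def)
qed

lemma precot_dist_class:
  assumes F: "F \<in> families m" and G: "G \<in> families m"
  shows "precot_dist m (precot_class m F) (precot_class m G) = sqrt (enn2real (sq_gap m F G))"
  using assms
  by (simp add: precot_dist_def precot_scale_class precot_add_class precot_norm_class families_add families_scale
      sq_gap_def sq_norm_def family_gap_eq_pnorm families_partition)

end

section \<open>Completion and the calculus rules\<close>

context
  fixes m :: "'a::{metric_space, second_countable_topology} measure"
  assumes m: "sets m = sets borel"
begin

text \<open>The Cauchy property of the classes, expressed on representatives and by squared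
  distances.\<close>

definition cauchy_families :: "(nat \<Rightarrow> 'a family) \<Rightarrow> bool" where
  "cauchy_families F \<longleftrightarrow> (\<forall>n. F n \<in> families m) \<and>
     (\<forall>e>0. \<exists>N. \<forall>i\<ge>N. \<forall>j\<ge>N. sq_gap m (F i) (F j) < ennreal e)"

definition null_gap :: "(nat \<Rightarrow> 'a family) \<Rightarrow> (nat \<Rightarrow> 'a family) \<Rightarrow> bool" where
  "null_gap F G \<longleftrightarrow> (\<lambda>n. sq_gap m (F n) (G n)) \<longlonglongrightarrow> 0"

lemma sqrt_enn2real_less:
  assumes "x < \<infinity>" "0 < e"
  shows "sqrt (enn2real x) < e \<longleftrightarrow> x < ennreal (e\<^sup>2)"
proof -
  have "sqrt (enn2real x) < e \<longleftrightarrow> enn2real x < e\<^sup>2"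
    using assms(2) by (metis enn2real_nonneg less_eq_real_def real_less_lsqrt real_sqrt_less_iff real_sqrt_abs abs_of_pos)
  also have "\<dots> \<longleftrightarrow> x < ennreal (e\<^sup>2)"
    using assms by (cases x) (auto simp: ennreal_less_iff)
  finally show ?thesis .
qed

lemma cot_cauchy_class_iff:
  assumes F: "\<And>n. F n \<in> families m"
  shows "(\<lambda>n. precot_class m (F n)) \<in> cot_cauchy m \<longleftrightarrow> cauchy_families F"
proof -
  have *: "precot_dist m (precot_class m (F i)) (precot_class m (F j)) < e \<longleftrightarrow> sq_gap m (F i) (F j) < ennreal (e\<^sup>2)"
    if "0 < e" for e i j
    using that by (simp add: precot_dist_class[OF m F F] sqrt_enn2real_less[OF sq_gap_finite[OF m F F]])
  have "(\<forall>e>0. \<exists>N. \<forall>i\<ge>N. \<forall>j\<ge>N. precot_dist m (precot_class m (F i)) (precot_class m (F j)) < e)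
    \<longleftrightarrow> (\<forall>e>0. \<exists>N. \<forall>i\<ge>N. \<forall>j\<ge>N. sq_gap m (F i) (F j) < ennreal e)" (is "?L \<longleftrightarrow> ?R")
  proof
    assume L: ?L
    show ?R
    proof (intro allI impI)
      fix e :: real assume "0 < e"
      then have "0 < sqrt e" by simp
      with L obtain N where "\<forall>i\<ge>N. \<forall>j\<ge>N. precot_dist m (precot_class m (F i)) (precot_class m (F j)) < sqrt e" by blast
      then have "\<forall>i\<ge>N. \<forall>j\<ge>N. sq_gap m (F i) (F j) < ennreal e"
        using *[OF \<open>0 < sqrt e\<close>] \<open>0 < e\<close> by simp
      then show "\<exists>N. \<forall>i\<ge>N. \<forall>j\<ge>N. sq_gap m (F i) (F j) < ennreal e" by blast
    qed
  next
    assume R: ?R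
    show ?L
    proof (intro allI impI)
      fix e :: real assume e: "0 < e"
      then have "0 < e\<^sup>2" by simp
      with R obtain N where "\<forall>i\<ge>N. \<forall>j\<ge>N. sq_gap m (F i) (F j) < ennreal (e\<^sup>2)" by blast
      then show "\<exists>N. \<forall>i\<ge>N. \<forall>j\<ge>N. precot_dist m (precot_class m (F i)) (precot_class m (F j)) < e"
        using *[OF e] by blast
    qed
  qed
  then show ?thesis using F by (simp add: cot_cauchy_def cauchy_families_def precot_class_mem[OF m])
qed

lemma cot_cauchyE:
  assumes "X \<in> cot_cauchy m"
  obtains F where "cauchy_families F" "X = (\<lambda>n. precot_class m (F n))"
proof -
  have "\<exists>F. F \<in> families m \<and> X n = precot_class m F" for n
  proof -
    have "X n \<in> precot m" using assms by (simp add: cot_cauchy_def)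
    then show ?thesis by (rule precotE[OF m]) blast
  qed
  then obtain F where F: "\<And>n. F n \<in> families m" "\<And>n. X n = precot_class m (F n)" by metis
  then have X: "X = (\<lambda>n. precot_class m (F n))" by (simp add: fun_eq_iff)
  then have "cauchy_families F" using assms cot_cauchy_class_iff[OF F(1)] by simp
  then show ?thesis using X by (rule that)
qed

lemma cauchy_familiesD: "cauchy_families F \<Longrightarrow> F n \<in> families m"
  by (simp add: cauchy_families_def)

lemma cot_rel_class_iff:
  assumes F: "cauchy_families F" and G: "cauchy_families G"
  shows "((\<lambda>n. precot_class m (F n)), (\<lambda>n. precot_class m (G n))) \<in> cot_rel m \<longleftrightarrow> null_gap F G"
proof -
  note F' = cauchy_familiesD[OF F] and G' = cauchy_familiesD[OF G]
  have eq: "ennreal ((sqrt (enn2real (sq_gap m (F n) (G n))))\<^sup>2) = sq_gap m (F n) (G n)" for n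
    using sq_gap_finite[OF m F' G'] by simp
  have "(\<lambda>n. sqrt (enn2real (sq_gap m (F n) (G n)))) \<longlonglongrightarrow> 0 \<longleftrightarrow> null_gap F G"
  proof
    assume "(\<lambda>n. sqrt (enn2real (sq_gap m (F n) (G n)))) \<longlonglongrightarrow> 0"
    then have "(\<lambda>n. ennreal ((sqrt (enn2real (sq_gap m (F n) (G n))))\<^sup>2)) \<longlonglongrightarrow> ennreal (0\<^sup>2)"
      by (intro tendsto_ennrealI tendsto_power)
    then show "null_gap F G" unfolding null_gap_def eq by simp
  next
    assume "null_gap F G"
    then have "(\<lambda>n. sqrt (enn2real (sq_gap m (F n) (G n)))) \<longlonglongrightarrow> sqrt (enn2real 0)"
      unfolding null_gap_def by (intro tendsto_real_sqrt tendsto_enn2real) auto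
    then show "(\<lambda>n. sqrt (enn2real (sq_gap m (F n) (G n)))) \<longlonglongrightarrow> 0" by simp
  qed
  then show ?thesis
    using F G by (simp add: cot_rel_def cot_cauchy_class_iff[OF F'] cot_cauchy_class_iff[OF G'] precot_dist_class[OF m F' G'])
qed

lemma tendsto_0_two_sum:
  fixes a b c :: "nat \<Rightarrow> ennreal"
  assumes a: "a \<longlonglongrightarrow> 0" and b: "b \<longlonglongrightarrow> 0" and le: "\<And>n. c n \<le> 2 * a n + 2 * b n"
  shows "c \<longlonglongrightarrow> 0"
proof (rule tendsto_sandwich[where f = "\<lambda>_. 0" and h = "\<lambda>n. 2 * a n + 2 * b n"])
  have "(\<lambda>n. 2 * a n + 2 * b n) \<longlonglongrightarrow> 2 * 0 + 2 * 0"
    by (intro tendsto_add ennreal_tendsto_cmult a b) simp_all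
  then show "(\<lambda>n. 2 * a n + 2 * b n) \<longlonglongrightarrow> 0" by simp
qed (use le in \<open>auto intro: tendsto_const\<close>)

lemma null_gap_trans:
  assumes "\<And>n. F n \<in> families m" "\<And>n. G n \<in> families m" "\<And>n. H n \<in> families m" "null_gap F G" "null_gap G H"
  shows "null_gap F H"
  using assms(4,5) unfolding null_gap_def
  by (rule tendsto_0_two_sum) (intro sq_gap_triangle[OF m] families_partition[OF m] assms)

lemma null_gap_sym:
  assumes "\<And>n. F n \<in> families m" "\<And>n. G n \<in> families m" "null_gap F G"
  shows "null_gap G F"
  using assms(3) sq_gap_commute[OF m families_partition[OF m assms(1)] families_partition[OF m assms(2)]]
  by (simp add: null_gap_def)

lemma equiv_cot_rel: "equiv (cot_cauchy m) (cot_rel m)"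
proof (rule equivI)
  show "cot_rel m \<subseteq> cot_cauchy m \<times> cot_cauchy m" by (auto simp: cot_rel_def)
  show "refl_on (cot_cauchy m) (cot_rel m)"
  proof (rule refl_onI)
    fix X assume "X \<in> cot_cauchy m"
    then obtain F where F: "cauchy_families F" "X = (\<lambda>n. precot_class m (F n))" by (rule cot_cauchyE)
    then show "(X, X) \<in> cot_rel m"
      by (simp add: cot_rel_class_iff null_gap_def sq_gap_self[OF m families_partition[OF m cauchy_familiesD]])
  qed
  show "sym (cot_rel m)"
  proof (rule symI)
    fix X Y assume XY: "(X, Y) \<in> cot_rel m"
    then have "X \<in> cot_cauchy m" "Y \<in> cot_cauchy m" by (auto simp: cot_rel_def)
    then obtain F G where "cauchy_families F" "X = (\<lambda>n. precot_class m (F n))"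
      "cauchy_families G" "Y = (\<lambda>n. precot_class m (G n))" by (metis cot_cauchyE)
    then show "(Y, X) \<in> cot_rel m" using XY by (simp add: cot_rel_class_iff null_gap_sym cauchy_familiesD)
  qed
  show "trans (cot_rel m)"
  proof (rule transI)
    fix X Y Z assume XYZ: "(X, Y) \<in> cot_rel m" "(Y, Z) \<in> cot_rel m"
    then have "X \<in> cot_cauchy m" "Y \<in> cot_cauchy m" "Z \<in> cot_cauchy m" by (auto simp: cot_rel_def)
    then obtain F G H where F: "cauchy_families F" "X = (\<lambda>n. precot_class m (F n))"
      and G: "cauchy_families G" "Y = (\<lambda>n. precot_class m (G n))"
      and H: "cauchy_families H" "Z = (\<lambda>n. precot_class m (H n))" by (metis cot_cauchyE)
    have "null_gap F H"
      using XYZ F G H by (intro null_gap_trans[of F G H]) (simp_all add: cot_rel_class_iff cauchy_familiesD)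
    then show "(X, Z) \<in> cot_rel m" using F H by (simp add: cot_rel_class_iff)
  qed
qed

definition cot_class :: "(nat \<Rightarrow> 'a family) \<Rightarrow> 'a covector" where
  "cot_class F = cot_rel m `` {\<lambda>n. precot_class m (F n)}"

lemma cot_class_eq:
  assumes "cauchy_families F" "cauchy_families G" "null_gap F G"
  shows "cot_class F = cot_class G"
  unfolding cot_class_def using assms by (intro equiv_class_eq[OF equiv_cot_rel]) (simp add: cot_rel_class_iff)

lemma cot_class_self:
  assumes "cauchy_families F"
  shows "(\<lambda>n. precot_class m (F n)) \<in> cot_class F"
  unfolding cot_class_def
  by (rule equiv_class_self[OF equiv_cot_rel]) (use assms in \<open>simp add: cot_cauchy_class_iff cauchy_familiesD\<close>)

lemma cot_class_nonempty: "cauchy_families F \<Longrightarrow> cot_class F \<noteq> {}"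
  using cot_class_self by blast

lemma cot_classE:
  assumes F: "cauchy_families F" and X: "X \<in> cot_class F"
  obtains G where "cauchy_families G" "null_gap G F" "X = (\<lambda>n. precot_class m (G n))"
proof -
  have "X \<in> cot_cauchy m" using X by (auto simp: cot_class_def cot_rel_def)
  then obtain G where G: "cauchy_families G" "X = (\<lambda>n. precot_class m (G n))" by (rule cot_cauchyE)
  have "((\<lambda>n. precot_class m (F n)), X) \<in> cot_rel m" using X by (simp only: cot_class_def Image_singleton_iff)
  then have "null_gap F G" unfolding G(2) cot_rel_class_iff[OF F G(1)] .
  then have "null_gap G F" by (rule null_gap_sym[OF cauchy_familiesD[OF F] cauchy_familiesD[OF G(1)]])
  from that[OF G(1) this G(2)] show ?thesis .
qed

lemma cauchy_families_const: "F \<in> families m \<Longrightarrow> cauchy_families (\<lambda>_. F)"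
  by (auto simp: cauchy_families_def sq_gap_self[OF m families_partition[OF m]])

lemma cauchy_families_null_gap:
  assumes F: "cauchy_families F" and G: "\<And>n. G n \<in> families m" and gap: "null_gap F G"
  shows "cauchy_families G"
  unfolding cauchy_families_def
proof (intro conjI allI impI G)
  note F' = families_partition[OF m cauchy_familiesD[OF F]] and G' = families_partition[OF m G]
  \<comment> \<open>Two squared triangle inequalities produce the weights 2, 4 and 4, so three terms
    below e/16 add up to at most 10 e/16.\<close>
  fix e :: real assume e: "0 < e"
  have "\<forall>\<^sub>F n in sequentially. sq_gap m (F n) (G n) < ennreal (e / 16)"
    using gap e unfolding null_gap_def by (intro order_tendstoD(2)) auto
  then obtain N1 where N1: "\<And>n. n \<ge> N1 \<Longrightarrow> sq_gap m (F n) (G n) < ennreal (e / 16)"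
    by (auto simp: eventually_sequentially)
  obtain N2 where N2: "\<And>i j. i \<ge> N2 \<Longrightarrow> j \<ge> N2 \<Longrightarrow> sq_gap m (F i) (F j) < ennreal (e / 16)"
    using F e unfolding cauchy_families_def by (metis divide_pos_pos zero_less_numeral)
  have "sq_gap m (G i) (G j) < ennreal e" if ij: "i \<ge> max N1 N2" "j \<ge> max N1 N2" for i j
  proof -
    have "sq_gap m (G i) (G j) \<le> 2 * sq_gap m (G i) (F i) + 2 * sq_gap m (F i) (G j)"
      by (rule sq_gap_triangle[OF m G' F' G'])
    also have "sq_gap m (G i) (F i) = sq_gap m (F i) (G i)"
      by (rule sq_gap_commute[OF m G' F'])
    also have "sq_gap m (F i) (G j) \<le> 2 * sq_gap m (F i) (F j) + 2 * sq_gap m (F j) (G j)"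
      by (rule sq_gap_triangle[OF m F' F' G'])
    finally have "sq_gap m (G i) (G j) \<le> 2 * sq_gap m (F i) (G i) + 2 * (2 * sq_gap m (F i) (F j) + 2 * sq_gap m (F j) (G j))"
      by (simp add: add_left_mono mult_left_mono)
    also have "\<dots> \<le> 2 * ennreal (e / 16) + 2 * (2 * ennreal (e / 16) + 2 * ennreal (e / 16))"
      using N1[of i] N1[of j] N2[of i j] ij by (intro add_mono mult_left_mono) (auto simp: less_imp_le)
    also have "\<dots> = ennreal (10 * (e / 16))"
      using e by (simp add: ennreal_mult'[symmetric] ennreal_plus[symmetric] ennreal_numeral[symmetric] del: ennreal_plus ennreal_numeral)
    also have "\<dots> < ennreal e" using e by (intro ennreal_lessI) auto
    finally show ?thesis .
  qed
  then show "\<exists>N. \<forall>i\<ge>N. \<forall>j\<ge>N. sq_gap m (G i) (G j) < ennreal e" by blast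
qed

text \<open>A pointwise criterion through which the three calculus rules obtain their convergence:
  coefficients that are uniformly close to their limits make the gap at most \<open>e\<close> times
  one fixed L^2 function.\<close>

lemma null_gapI:
  assumes F: "\<And>n. F n \<in> families m" and G: "\<And>n. G n \<in> families m"
    and K: "K \<in> borel_measurable m" "(\<integral>\<^sup>+x. ennreal ((K x)\<^sup>2) \<partial>m) < \<infinity>"
    and le: "\<And>e. 0 < e \<Longrightarrow> \<forall>\<^sub>F n in sequentially. AE x in m. family_gap m (F n) (G n) x \<le> e * K x"
  shows "null_gap F G"
  unfolding null_gap_def
proof (rule order_tendstoI)
  fix a :: ennreal assume a: "0 < a"
  obtain I where I: "(\<integral>\<^sup>+x. ennreal ((K x)\<^sup>2) \<partial>m) = ennreal I" "0 \<le> I" using K(2) by (cases "\<integral>\<^sup>+x. ennreal ((K x)\<^sup>2) \<partial>m") auto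
  obtain r where r: "0 < r" "ennreal r < a"
  proof (cases a)
    case (real b)
    with a that[of "b / 2"] show ?thesis by (auto simp: ennreal_less_iff)
  next
    case top
    with that[of 1] show ?thesis by simp
  qed
  \<comment> \<open>Then \<open>2 * e\<^sup>2 * I\<close> equals \<open>r * I / (I + 1)\<close>,
    which is at most \<open>r\<close>; the added 1 covers \<open>I = 0\<close>.\<close>
  define e where "e = sqrt (r / (2 * (I + 1)))"
  have e: "0 < e" using r I by (simp add: e_def)
  have e2: "2 * e\<^sup>2 * I \<le> r"
    using r(1) I(2) by (simp add: e_def divide_simps mult_le_cancel_left)
  from le[OF e] show "\<forall>\<^sub>F n in sequentially. sq_gap m (F n) (G n) < a"
  proof eventually_elim
    case (elim n)
    have "AE x in m. \<bar>family_gap m (F n) (G n) x\<bar> \<le> e * K x + 0 * K x"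
      using elim by eventually_elim
        (use family_gap_nonneg[OF m families_partition[OF m F] families_partition[OF m G]] in simp)
    then have "sq_gap m (F n) (G n) \<le> ennreal (2 * e\<^sup>2) * ennreal I + ennreal (2 * 0\<^sup>2) * ennreal I"
      unfolding sq_gap_def I(1)[symmetric] by (rule nn_integral_square_le[OF K(1) K(1)])
    also have "\<dots> = ennreal (2 * e\<^sup>2 * I)" using I(2) by (simp add: ennreal_mult)
    also have "\<dots> \<le> ennreal r" using e2 by (rule ennreal_leI)
    also have "\<dots> < a" by (rule r(2))
    finally show ?case .
  qed
qed simp

section \<open>Multiplication by essentially bounded functions\<close>

definition approximates :: "(nat \<Rightarrow> 'a \<Rightarrow> real) \<Rightarrow> ('a \<Rightarrow> real) \<Rightarrow> bool" where
  "approximates h g \<longleftrightarrow> (\<forall>n. simple_function m (h n)) \<and>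
     (\<forall>e>0. \<forall>\<^sub>F n in sequentially. AE x in m. \<bar>h n x - g x\<bar> < e)"

lemma approximatesD:
  "approximates h g \<Longrightarrow> 0 < e \<Longrightarrow> \<forall>\<^sub>F n in sequentially. AE x in m. \<bar>h n x - g x\<bar> < e"
  by (simp only: approximates_def)

lemma space_m: "space m = UNIV"
  using m by (metis sets_eq_imp_space_eq space_borel)

lemma approximates_simple:
  assumes "approximates h g"
  shows "h n \<in> borel_measurable borel" "finite (range (h n))"
proof -
  have "simple_function m (h n)" using assms by (simp add: approximates_def)
  then show "h n \<in> borel_measurable borel" "finite (range (h n))"
    using m by (auto dest: borel_measurable_simple_function simple_functionD(1) simp: space_m cong: measurable_cong_sets)
qed

text \<open>Truncate at an essential bound, then round down to multiples of
  \<open>1 / Suc n\<close>. Truncation changes \<open>g\<close> on a null set only and leaves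
  finitely many values after rounding.\<close>

lemma approximates_exists:
  assumes g: "g \<in> Linf m"
  obtains h where "approximates h g"
proof -
  have gm: "g \<in> borel_measurable m" using g by (simp add: Linf_def)
  obtain C where C: "AE x in m. \<bar>g x\<bar> \<le> C" using g by (auto simp: Linf_def)
  \<comment> \<open>The absolute value keeps the interval nonempty: over the zero measure an
    essential bound may be negative.\<close>
  define c where "c x = max (- \<bar>C\<bar>) (min \<bar>C\<bar> (g x))" for x
  define h where "h n x = of_int \<lfloor>real (Suc n) * c x\<rfloor> / real (Suc n)" for n x
  have cm [measurable]: "c \<in> borel_measurable m" unfolding c_def[abs_def] using gm by measurable
  have "approximates h g" unfolding approximates_def
  proof (intro conjI allI impI)
    fix n
    have "h n \<in> borel_measurable m" unfolding h_def[abs_def] by measurable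
    moreover have "h n ` space m \<subseteq> (\<lambda>i. of_int i / real (Suc n)) ` {\<lfloor>- (real (Suc n) * \<bar>C\<bar>)\<rfloor>..\<lfloor>real (Suc n) * \<bar>C\<bar>\<rfloor>}"
    proof
      fix y assume "y \<in> h n ` space m"
      then obtain x where y: "y = h n x" by blast
      have "- \<bar>C\<bar> \<le> c x" "c x \<le> \<bar>C\<bar>" by (auto simp: c_def)
      then have "- (real (Suc n) * \<bar>C\<bar>) \<le> real (Suc n) * c x" "real (Suc n) * c x \<le> real (Suc n) * \<bar>C\<bar>"
        using mult_left_mono[of "- \<bar>C\<bar>" "c x" "real (Suc n)"] mult_left_mono[of "c x" "\<bar>C\<bar>" "real (Suc n)"] by simp_all
      then have "\<lfloor>real (Suc n) * c x\<rfloor> \<in> {\<lfloor>- (real (Suc n) * \<bar>C\<bar>)\<rfloor>..\<lfloor>real (Suc n) * \<bar>C\<bar>\<rfloor>}"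
        by (simp only: atLeastAtMost_iff floor_mono simp_thms)
      then show "y \<in> (\<lambda>i. of_int i / real (Suc n)) ` {\<lfloor>- (real (Suc n) * \<bar>C\<bar>)\<rfloor>..\<lfloor>real (Suc n) * \<bar>C\<bar>\<rfloor>}"
        unfolding y h_def by (rule image_eqI[rotated]) simp
    qed
    then have "finite (h n ` space m)" by (rule finite_subset) simp
    ultimately show "simple_function m (h n)" by (simp add: simple_function_borel_measurable)
  next
    fix e :: real assume e: "0 < e"
    have "\<forall>\<^sub>F n in sequentially. 1 / real (Suc n) < e"
      using order_tendstoD(2)[OF LIMSEQ_inverse_real_of_nat e] by (simp add: inverse_eq_divide)
    then show "\<forall>\<^sub>F n in sequentially. AE x in m. \<bar>h n x - g x\<bar> < e"
    proof eventually_elim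
      case (elim n)
      from C show ?case
      proof eventually_elim
        fix x assume "\<bar>g x\<bar> \<le> C"
        then have "c x = g x" by (auto simp: c_def)
        have "real (Suc n) * g x - 1 < of_int \<lfloor>real (Suc n) * g x\<rfloor>" "of_int \<lfloor>real (Suc n) * g x\<rfloor> \<le> real (Suc n) * g x"
          by linarith+
        from divide_strict_right_mono[OF this(1), of "real (Suc n)"] divide_right_mono[OF this(2), of "real (Suc n)"]
        have "g x - 1 / real (Suc n) < h n x" "h n x \<le> g x"
          by (simp_all add: h_def \<open>c x = g x\<close> diff_divide_distrib del: of_nat_Suc)
        then show "\<bar>h n x - g x\<bar> < e" using elim by linarith
      qed
    qed
  qed
  then show ?thesis by (rule that)
qed

lemma approximates_bounded:
  assumes h: "approximates h g" and g: "g \<in> Linf m"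
  obtains C where "0 \<le> C" "\<forall>\<^sub>F n in sequentially. AE x in m. \<bar>h n x\<bar> \<le> C"
proof -
  obtain C where C: "AE x in m. \<bar>g x\<bar> \<le> C" using g by (auto simp: Linf_def)
  have "\<forall>\<^sub>F n in sequentially. AE x in m. \<bar>h n x - g x\<bar> < 1" using h by (simp add: approximates_def)
  then have "\<forall>\<^sub>F n in sequentially. AE x in m. \<bar>h n x\<bar> \<le> \<bar>C\<bar> + 1"
  proof eventually_elim
    case (elim n)
    from elim C show ?case by eventually_elim linarith
  qed
  then show ?thesis by (intro that[of "\<bar>C\<bar> + 1"]) auto
qed

text \<open>Two legs: with \<open>h\<close> kept, its eventual essential bound transports the
  convergence of the families; with \<open>G\<close> kept, \<open>h\<close> and \<open>k\<close> are
  uniformly close to each other.\<close>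

lemma null_gap_mult:
  assumes h: "approximates h g" and k: "approximates k g" and g: "g \<in> Linf m"
    and F: "\<And>n. F n \<in> families m" and G: "G \<in> families m" and gap: "null_gap F (\<lambda>_. G)"
  shows "null_gap (\<lambda>n. family_mult (h n) (F n)) (\<lambda>n. family_mult (k n) G)"
proof -
  note F' = families_partition[OF m F] and G' = families_partition[OF m G]
  obtain C where C: "0 \<le> C" "\<forall>\<^sub>F n in sequentially. AE x in m. \<bar>h n x\<bar> \<le> C"
    using approximates_bounded[OF h g] by blast
  have 1: "(\<lambda>n. sq_gap m (family_mult (h n) (F n)) (family_mult (h n) G)) \<longlonglongrightarrow> 0"
  proof (rule tendsto_sandwich[where f = "\<lambda>_. 0" and h = "\<lambda>n. ennreal (2 * C\<^sup>2) * sq_gap m (F n) G"])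
    have "(\<lambda>n. ennreal (2 * C\<^sup>2) * sq_gap m (F n) G) \<longlonglongrightarrow> ennreal (2 * C\<^sup>2) * 0"
      using gap unfolding null_gap_def by (intro ennreal_tendsto_cmult) simp_all
    then show "(\<lambda>n. ennreal (2 * C\<^sup>2) * sq_gap m (F n) G) \<longlonglongrightarrow> 0" by simp
    show "\<forall>\<^sub>F n in sequentially. sq_gap m (family_mult (h n) (F n)) (family_mult (h n) G) \<le> ennreal (2 * C\<^sup>2) * sq_gap m (F n) G"
      using C(2)
    proof eventually_elim
      case (elim n)
      have "sq_gap m (family_mult (h n) (F n)) (family_mult (h n) G)
        \<le> ennreal (2 * C\<^sup>2) * sq_gap m (F n) G + ennreal (2 * 0\<^sup>2) * sq_norm m G"
        by (rule sq_gap_mult_le[OF m F' G']) (use elim approximates_simple[OF h] in simp_all)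
      then show ?case by simp
    qed
  qed (auto intro: tendsto_const)
  have 2: "null_gap (\<lambda>n. family_mult (h n) G) (\<lambda>n. family_mult (k n) G)"
  proof (rule null_gapI)
    show "family_mult (h n) G \<in> families m" "family_mult (k n) G \<in> families m" for n
      using approximates_simple[OF h] approximates_simple[OF k] by (simp_all add: families_mult[OF m G])
    show "family_pnorm m G \<in> borel_measurable m" by (rule family_pnorm_measurable[OF m G'])
    show "(\<integral>\<^sup>+x. ennreal ((family_pnorm m G x)\<^sup>2) \<partial>m) < \<infinity>" using sq_norm_finite[OF m G] by (simp add: sq_norm_def)
    fix e :: real assume "0 < e"
    then have "0 < e / 2" by simp
    then have "\<forall>\<^sub>F n in sequentially. AE x in m. \<bar>h n x - g x\<bar> < e / 2" "\<forall>\<^sub>F n in sequentially. AE x in m. \<bar>k n x - g x\<bar> < e / 2"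
      using h k unfolding approximates_def by blast+
    then show "\<forall>\<^sub>F n in sequentially. AE x in m. family_gap m (family_mult (h n) G) (family_mult (k n) G) x \<le> e * family_pnorm m G x"
    proof eventually_elim
      case (elim n)
      \<comment> \<open>Both products carry the same function at x, so their difference is that
        function times a difference of values, of which there are finitely many.\<close>
      have "AE x in m. \<forall>c\<in>(\<lambda>(a, b). a - b) ` (range (h n) \<times> range (k n)). min_wug m (\<lambda>y. c * family_at G x y) x \<le> \<bar>c\<bar> * min_wug m (family_at G x) x"
        by (rule AE_family_at[OF G'])
           (intro AE_finite_allI min_wug_scale(2)[OF m] finite_imageI finite_cartesian_product approximates_simple[OF h] approximates_simple[OF k])
      with elim show ?case
      proof eventually_elim
        case (elim x)
        have "family_gap m (family_mult (h n) G) (family_mult (k n) G) x = min_wug m (\<lambda>y. (h n x - k n x) * family_at G x y) x"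
          by (simp add: family_gap_def borel_partition_mult(2)[OF m G' approximates_simple[OF h]]
              borel_partition_mult(2)[OF m G' approximates_simple[OF k]] left_diff_distrib)
        also have "\<dots> \<le> \<bar>h n x - k n x\<bar> * family_pnorm m G x"
          using elim(3) by (force simp: family_pnorm_at)
        also have "\<dots> \<le> e * family_pnorm m G x"
        proof (rule mult_right_mono[OF _ family_pnorm_nonneg[OF m G']])
          show "\<bar>h n x - k n x\<bar> \<le> e" using elim(1,2) by linarith
        qed
        finally show ?case .
      qed
    qed
  qed
  show ?thesis
    unfolding null_gap_def
  proof (rule tendsto_0_two_sum[OF 1 2[unfolded null_gap_def]])
    fix n
    show "sq_gap m (family_mult (h n) (F n)) (family_mult (k n) G)
      \<le> 2 * sq_gap m (family_mult (h n) (F n)) (family_mult (h n) G) + 2 * sq_gap m (family_mult (h n) G) (family_mult (k n) G)"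
      by (intro sq_gap_triangle[OF m] families_partition[OF m] families_mult[OF m] F G approximates_simple[OF h] approximates_simple[OF k])
  qed
qed

lemma cauchy_families_mult:
  assumes h: "approximates h g" and F: "F \<in> families m"
  shows "cauchy_families (\<lambda>n. family_mult (h n) F)"
  unfolding cauchy_families_def
proof (intro conjI allI impI)
  show "family_mult (h n) F \<in> families m" for n by (intro families_mult[OF m F] approximates_simple[OF h])
  note F' = families_partition[OF m F]
  fix e :: real assume e: "0 < e"
  obtain I where I: "sq_norm m F = ennreal I" "0 \<le> I" using sq_norm_finite[OF m F] by (cases "sq_norm m F") auto
  \<comment> \<open>Makes \<open>2 * d\<^sup>2 * I\<close> equal to
    \<open>e / 2 * (I / (I + 1))\<close>, which is below \<open>e\<close>.\<close>
  define d where "d = sqrt (e / (4 * (I + 1)))"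
  have d: "0 < d" using e I by (simp add: d_def)
  have d2: "2 * d\<^sup>2 * I < e"
    using e I(2) by (auto simp: d_def field_simps intro!: add_pos_nonneg)
  have "\<forall>\<^sub>F n in sequentially. AE x in m. \<bar>h n x - g x\<bar> < d / 2" using d by (intro approximatesD[OF h]) simp
  then obtain N where N: "\<And>n. n \<ge> N \<Longrightarrow> AE x in m. \<bar>h n x - g x\<bar> < d / 2" by (auto simp: eventually_sequentially)
  have "sq_gap m (family_mult (h i) F) (family_mult (h j) F) < ennreal e" if "i \<ge> N" "j \<ge> N" for i j
  proof -
    \<comment> \<open>This bound may depend on \<open>i\<close>, since it multiplies
      \<open>sq_gap m F F\<close>, which is 0.\<close>
    obtain C where C: "\<And>x. \<bar>h i x\<bar> \<le> C"
      using finite_imp_bounded[OF approximates_simple(2)[OF h, of i]] unfolding bounded_iff by auto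
    have "AE x in m. \<bar>h i x - h j x\<bar> \<le> d"
      using N[OF that(1)] N[OF that(2)] by eventually_elim linarith
    then have "sq_gap m (family_mult (h i) F) (family_mult (h j) F) \<le> ennreal (2 * C\<^sup>2) * sq_gap m F F + ennreal (2 * d\<^sup>2) * sq_norm m F"
      using C by (intro sq_gap_mult_le[OF m F' F'] approximates_simple[OF h]) auto
    also have "\<dots> = ennreal (2 * d\<^sup>2 * I)" using I by (simp add: sq_gap_self[OF m F'] ennreal_mult)
    also have "\<dots> < ennreal e" using d2 e by (intro ennreal_lessI) auto
    finally show ?thesis .
  qed
  then show "\<exists>N. \<forall>i\<ge>N. \<forall>j\<ge>N. sq_gap m (family_mult (h i) F) (family_mult (h j) F) < ennreal e" by blast
qed

text \<open>The union in \<open>cot_mult\<close> runs over all representing sequences and all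
  approximations of \<open>g\<close>; each choice leads to the class computed from the constant
  sequence and the approximation \<open>k\<close>. Differentials are represented by constant
  sequences, so they are covered.\<close>

lemma cot_mult_const_class:
  assumes F: "F \<in> families m" and g: "g \<in> Linf m" and k: "approximates k g"
  shows "cot_mult m g (cot_class (\<lambda>_. F)) = cot_class (\<lambda>n. family_mult (k n) F)"
proof -
  have *: "cot_rel m `` {\<lambda>n. precot_mult m (h n) (X n)} = cot_class (\<lambda>n. family_mult (k n) F)"
    if X: "X \<in> cot_class (\<lambda>_. F)" and h: "approximates h g" for X h
  proof -
    obtain G where G: "cauchy_families G" "null_gap G (\<lambda>_. F)" "X = (\<lambda>n. precot_class m (G n))"
      by (rule cot_classE[OF cauchy_families_const[OF F] X])
    note G' = cauchy_familiesD[OF G(1)]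
    have eq: "(\<lambda>n. precot_mult m (h n) (X n)) = (\<lambda>n. precot_class m (family_mult (h n) (G n)))"
      unfolding G(3) by (rule ext) (rule precot_mult_class[OF m G' approximates_simple[OF h]])
    have gap: "null_gap (\<lambda>n. family_mult (h n) (G n)) (\<lambda>n. family_mult (k n) F)"
      by (rule null_gap_mult[OF h k g G' F G(2)])
    have fm: "family_mult (h n) (G n) \<in> families m" "family_mult (k n) F \<in> families m" for n
      by (intro families_mult[OF m] G' F approximates_simple[OF h] approximates_simple[OF k])+
    have ck: "cauchy_families (\<lambda>n. family_mult (k n) F)" by (rule cauchy_families_mult[OF k F])
    have "cauchy_families (\<lambda>n. family_mult (h n) (G n))"
      by (rule cauchy_families_null_gap[OF ck fm(1) null_gap_sym[OF fm gap]])
    from cot_class_eq[OF this ck gap] show ?thesis by (simp only: eq cot_class_def)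
  qed
  have "cot_mult m g (cot_class (\<lambda>_. F)) = (\<Union>X\<in>cot_class (\<lambda>_. F). \<Union>h\<in>{h. approximates h g}. cot_class (\<lambda>n. family_mult (k n) F))"
    unfolding cot_mult_def approximates_def[symmetric] by (intro SUP_cong refl *) simp_all
  also have "\<dots> = cot_class (\<lambda>n. family_mult (k n) F)"
  proof -
    have "{h. approximates h g} \<noteq> {}" using k by blast
    then show ?thesis using cot_class_nonempty[OF cauchy_families_const[OF F]] by simp
  qed
  finally show ?thesis .
qed

lemma null_gap_add:
  assumes F: "\<And>n. F n \<in> families m" "\<And>n. F' n \<in> families m" "null_gap F F'"
    and G: "\<And>n. G n \<in> families m" "\<And>n. G' n \<in> families m" "null_gap G G'"
  shows "null_gap (\<lambda>n. family_add (F n) (G n)) (\<lambda>n. family_add (F' n) (G' n))"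
  using F(3) G(3) unfolding null_gap_def
  by (rule tendsto_0_two_sum) (intro sq_gap_add_le[OF m] families_partition[OF m] F G)

lemma cot_add_class:
  assumes F: "cauchy_families F" and G: "cauchy_families G" and FG: "cauchy_families (\<lambda>n. family_add (F n) (G n))"
  shows "cot_add m (cot_class F) (cot_class G) = cot_class (\<lambda>n. family_add (F n) (G n))"
proof -
  have *: "cot_rel m `` {\<lambda>n. precot_add m (X n) (Y n)} = cot_class (\<lambda>n. family_add (F n) (G n))"
    if X: "X \<in> cot_class F" and Y: "Y \<in> cot_class G" for X Y
  proof -
    obtain F' where F': "cauchy_families F'" "null_gap F' F" "X = (\<lambda>n. precot_class m (F' n))"
      by (rule cot_classE[OF F X])
    obtain G' where G': "cauchy_families G'" "null_gap G' G" "Y = (\<lambda>n. precot_class m (G' n))"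
      by (rule cot_classE[OF G Y])
    note fam = cauchy_familiesD[OF F] cauchy_familiesD[OF G] cauchy_familiesD[OF F'(1)] cauchy_familiesD[OF G'(1)]
    have eq: "(\<lambda>n. precot_add m (X n) (Y n)) = (\<lambda>n. precot_class m (family_add (F' n) (G' n)))"
      unfolding F'(3) G'(3) by (rule ext) (intro precot_add_class[OF m] fam)
    have gap: "null_gap (\<lambda>n. family_add (F' n) (G' n)) (\<lambda>n. family_add (F n) (G n))"
      by (intro null_gap_add fam F'(2) G'(2))
    have fa: "family_add (F' n) (G' n) \<in> families m" "family_add (F n) (G n) \<in> families m" for n
      by (intro families_add[OF m] fam)+
    have "cauchy_families (\<lambda>n. family_add (F' n) (G' n))"
      by (rule cauchy_families_null_gap[OF FG fa(1) null_gap_sym[OF fa gap]])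
    from cot_class_eq[OF this FG gap] show ?thesis by (simp only: eq cot_class_def)
  qed
  have "cot_add m (cot_class F) (cot_class G) = (\<Union>X\<in>cot_class F. \<Union>Y\<in>cot_class G. cot_class (\<lambda>n. family_add (F n) (G n)))"
    unfolding cot_add_def by (intro SUP_cong refl *)
  also have "\<dots> = cot_class (\<lambda>n. family_add (F n) (G n))"
    using cot_class_nonempty[OF F] cot_class_nonempty[OF G] by simp
  finally show ?thesis .
qed

lemma differential_eq: "differential m f = cot_class (\<lambda>_. {(f, UNIV)})"
  by (simp add: differential_def cot_embed_def cot_class_def)

lemma cot_zero_eq: "cot_zero m = cot_class (\<lambda>_. {(\<lambda>x. 0, UNIV)})"
  by (simp add: cot_zero_def cot_embed_def cot_class_def)

end

section \<open>Leibniz rule, locality and chain rule for differentials\<close>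

context
  fixes m :: "'a::{metric_space, second_countable_topology} measure"
  assumes m: "sets m = sets borel"
begin

lemma Linf_diff_const: "f \<in> Linf m \<Longrightarrow> (\<lambda>x. f x - c) \<in> Linf m"
proof -
  assume f: "f \<in> Linf m"
  then obtain C where C: "AE x in m. \<bar>f x\<bar> \<le> C" by (auto simp: Linf_def)
  then have "AE x in m. \<bar>f x - c\<bar> \<le> C + \<bar>c\<bar>" by eventually_elim linarith
  moreover have "f \<in> borel_measurable m" using f by (simp add: Linf_def)
  then have "(\<lambda>x. f x - c) \<in> borel_measurable m" by measurable
  ultimately show ?thesis unfolding Linf_def by blast
qed

lemma min_wug_diff_const:
  assumes f: "f \<in> S2 m"
  shows "(\<lambda>x. f x - c) \<in> S2 m" "AE x in m. min_wug m (\<lambda>x. f x - c) x \<le> min_wug m f x"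
proof -
  note d = S2_diff[OF m f min_wug_const(1)[OF m, of c]]
  show "(\<lambda>x. f x - c) \<in> S2 m" by (rule d)
  show "AE x in m. min_wug m (\<lambda>x. f x - c) x \<le> min_wug m f x"
    using d(2) min_wug_const(2)[OF m, of c] by eventually_elim simp
qed

lemma min_wug_const_diff:
  assumes f: "f \<in> S2 m"
  shows "AE x in m. min_wug m (\<lambda>x. c - f x) x \<le> min_wug m f x"
  using S2_diff(2)[OF m min_wug_const(1)[OF m, of c] f] min_wug_const(2)[OF m, of c]
  by eventually_elim simp

text \<open>Up to the constant \<open>ab\<close>, the error of the Leibniz rule with frozen coefficients is the
  product \<open>(f - b) (g - a)\<close>.\<close>

lemma min_wug_leibniz_frozen:
  assumes f: "f \<in> S2 m \<inter> Linf m" and g: "g \<in> S2 m \<inter> Linf m"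
  shows "AE x in m. min_wug m (\<lambda>y. a * f y + b * g y - f y * g y) x
    \<le> \<bar>f x - b\<bar> * min_wug m g x + \<bar>g x - a\<bar> * min_wug m f x"
proof -
  have fS: "f \<in> S2 m" and gS: "g \<in> S2 m" using f g by auto
  note fb = min_wug_diff_const[OF fS, of b] and ga = min_wug_diff_const[OF gS, of a]
  have fb': "(\<lambda>x. f x - b) \<in> S2 m \<inter> Linf m" and ga': "(\<lambda>x. g x - a) \<in> S2 m \<inter> Linf m"
    using fb(1) ga(1) f g by (auto intro: Linf_diff_const)
  note p = min_wug_mult[OF m fb' ga']
  have eq: "(\<lambda>y. a * b - (f y - b) * (g y - a)) = (\<lambda>y. a * f y + b * g y - f y * g y)"
    by (simp add: algebra_simps)
  show ?thesis
    using min_wug_const_diff[OF p(1), of "a * b", unfolded eq] p(2) fb(2) ga(2)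
  proof eventually_elim
    case (elim x)
    then show ?case
      using mult_left_mono[OF elim(4), of "\<bar>f x - b\<bar>"] mult_left_mono[OF elim(3), of "\<bar>g x - a\<bar>"] by linarith
  qed
qed

theorem differential_mult:
  assumes f: "f \<in> S2 m \<inter> Linf m" and g: "g \<in> S2 m \<inter> Linf m"
  shows "differential m (\<lambda>x. f x * g x) =
    cot_add m (cot_mult m g (differential m f)) (cot_mult m f (differential m g))"
proof -
  have fS: "f \<in> S2 m" and gS: "g \<in> S2 m" using f g by auto
  have fL: "f \<in> Linf m" and gL: "g \<in> Linf m" using f g by auto
  obtain h where h: "approximates m h g" by (rule approximates_exists[OF m gL])
  obtain k where k: "approximates m k f" by (rule approximates_exists[OF m fL])
  note hs = approximates_simple[OF m h] and ks = approximates_simple[OF m k]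
  note fF = families_singleton[OF m fS] and gF = families_singleton[OF m gS]
  note pF = families_singleton[OF m min_wug_mult(1)[OF m f g]]
  note fP = families_partition[OF m fF] and gP = families_partition[OF m gF]
  let ?F = "\<lambda>n. family_mult (h n) {(f, UNIV)}" and ?G = "\<lambda>n. family_mult (k n) {(g, UNIV)}"
  note FP = borel_partition_mult[OF m fP hs] and GP = borel_partition_mult[OF m gP ks]
  have add: "family_add (?F n) (?G n) \<in> families m" for n
    by (intro families_add[OF m] families_mult[OF m] fF gF hs ks)
  have gap: "null_gap m (\<lambda>n. family_add (?F n) (?G n)) (\<lambda>_. {(\<lambda>x. f x * g x, UNIV)})"
  proof (rule null_gapI[OF m add pF min_wug_sum_L2[OF m fS gS]])
    fix e :: real assume e: "0 < e"
    from approximatesD[OF m h e] approximatesD[OF m k e]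
    show "\<forall>\<^sub>F n in sequentially. AE x in m. family_gap m (family_add (?F n) (?G n)) {(\<lambda>x. f x * g x, UNIV)} x
      \<le> e * (min_wug m f x + min_wug m g x)"
    proof eventually_elim
      case (elim n)
      \<comment> \<open>Quantifying over the finite ranges under one null set allows the constants
        to be the values at x afterwards.\<close>
      have "AE x in m. \<forall>a\<in>range (h n). \<forall>b\<in>range (k n). min_wug m (\<lambda>y. a * f y + b * g y - f y * g y) x
        \<le> \<bar>f x - b\<bar> * min_wug m g x + \<bar>g x - a\<bar> * min_wug m f x"
        by (intro AE_finite_allI hs(2) ks(2) min_wug_leibniz_frozen f g)
      with elim show ?case
      proof eventually_elim
        case (elim x)
        have "family_gap m (family_add (?F n) (?G n)) {(\<lambda>x. f x * g x, UNIV)} x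
          = min_wug m (\<lambda>y. h n x * f y + k n x * g y - f y * g y) x"
          by (simp add: family_gap_def borel_partition_add(2)[OF m FP(1) GP(1)] FP(2) GP(2))
        also have "\<dots> \<le> \<bar>f x - k n x\<bar> * min_wug m g x + \<bar>g x - h n x\<bar> * min_wug m f x"
          using elim(3) by blast
        also have "\<dots> \<le> e * min_wug m g x + e * min_wug m f x"
          using elim(1,2) min_wug_props(2)[OF m fS] min_wug_props(2)[OF m gS]
          by (intro add_mono mult_right_mono) (auto simp: abs_minus_commute)
        finally show ?case by (simp add: algebra_simps)
      qed
    qed
  qed
  \<comment> \<open>Cauchy because its distance to a constant sequence vanishes.\<close>
  have c: "cauchy_families m (\<lambda>n. family_add (?F n) (?G n))"
    by (rule cauchy_families_null_gap[OF m cauchy_families_const[OF m pF] add null_gap_sym[OF m add pF gap]])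
  have "cot_add m (cot_mult m g (differential m f)) (cot_mult m f (differential m g))
    = cot_class m (\<lambda>n. family_add (?F n) (?G n))"
    unfolding differential_eq[OF m] cot_mult_const_class[OF m fF gL h] cot_mult_const_class[OF m gF fL k]
    by (rule cot_add_class[OF m cauchy_families_mult[OF m h fF] cauchy_families_mult[OF m k gF] c])
  also have "\<dots> = differential m (\<lambda>x. f x * g x)"
    unfolding differential_eq[OF m] by (rule cot_class_eq[OF m c cauchy_families_const[OF m pF] gap])
  finally show ?thesis by simp
qed

text \<open>Where f x lies in \<open>N\<close> the minimal gradient vanishes; elsewhere the
  approximations of the indicator are small. Either way the gap to zero is at most \<open>e\<close>
  times the minimal gradient.\<close>

theorem differential_locality:
  assumes f: "f \<in> S2 m" and N: "N \<in> null_sets lborel"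
  shows "cot_zero_on m (differential m f) (f -` N)"
proof -
  have fm: "f \<in> borel_measurable borel" by (rule measurable_S2[OF m f])
  have "f -` N \<in> sets borel"
    using measurable_sets[OF fm, of N] N by auto
  then have ind: "indicator (f -` N) \<in> Linf m"
    using m by (auto simp: Linf_def intro!: exI[of _ 1] split: split_indicator)
  obtain h where h: "approximates m h (indicator (f -` N))" by (rule approximates_exists[OF m ind])
  note hs = approximates_simple[OF m h]
  note fF = families_singleton[OF m f] and zF = families_singleton[OF m min_wug_const(1)[OF m, of 0]]
  note fP = families_partition[OF m fF]
  have fam: "family_mult (h n) {(f, UNIV)} \<in> families m" for n by (rule families_mult[OF m fF hs])
  have gap: "null_gap m (\<lambda>n. family_mult (h n) {(f, UNIV)}) (\<lambda>_. {(\<lambda>x. 0, UNIV)})"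
  proof (rule null_gapI[OF m fam zF min_wug_measurable[OF m f] min_wug_props(3)[OF m f]])
    fix e :: real assume e: "0 < e"
    from approximatesD[OF m h e]
    show "\<forall>\<^sub>F n in sequentially. AE x in m. family_gap m (family_mult (h n) {(f, UNIV)}) {(\<lambda>x. 0, UNIV)} x \<le> e * min_wug m f x"
    proof eventually_elim
      case (elim n)
      have "AE x in m. \<forall>a\<in>range (h n). min_wug m (\<lambda>y. a * f y) x \<le> \<bar>a\<bar> * min_wug m f x"
        by (intro AE_finite_allI hs(2) min_wug_scale(2)[OF m f])
      with elim min_wug_locality[OF m f N] show ?case
      proof eventually_elim
        case (elim x)
        have "family_gap m (family_mult (h n) {(f, UNIV)}) {(\<lambda>x. 0, UNIV)} x = min_wug m (\<lambda>y. h n x * f y) x"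
          by (simp add: family_gap_def borel_partition_mult(2)[OF m fP hs])
        also have "\<dots> \<le> \<bar>h n x\<bar> * min_wug m f x" using elim(3) by blast
        also have "\<dots> \<le> e * min_wug m f x"
        proof (cases "f x \<in> N")
          case False
          then show ?thesis using elim(1) min_wug_props(2)[OF m f, of x] by (intro mult_right_mono) auto
        qed (use elim(2) in simp)
        finally show ?case .
      qed
    qed
  qed
  show ?thesis
    unfolding cot_zero_on_def differential_eq[OF m] cot_zero_eq[OF m] cot_mult_const_class[OF m fF ind h]
    by (rule cot_class_eq[OF m cauchy_families_mult[OF m h fF] cauchy_families_const[OF m zF] gap])
qed

text \<open>The Lipschitz bound applied to y |-> a y - \<phi> y, which is differentiable exactly
  where \<phi> is. At the other values the bound is 0 for every constant \<open>a\<close>.\<close>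

lemma min_wug_chain_frozen:
  fixes \<phi> :: "real \<Rightarrow> real"
  assumes f: "f \<in> S2 m" and lip: "L-lipschitz_on UNIV \<phi>"
  shows "AE x in m. min_wug m (\<lambda>y. a * f y - \<phi> (f y)) x
    \<le> (if \<phi> differentiable (at (f x)) then \<bar>a - deriv \<phi> (f x)\<bar> * min_wug m f x else 0)"
proof -
  define \<psi> where "\<psi> y = a * y - \<phi> y" for y
  have L: "0 \<le> L" using lip by (simp add: lipschitz_on_def)
  have lip': "(\<bar>a\<bar> + L)-lipschitz_on UNIV \<psi>"
  proof (rule lipschitz_onI)
    fix x y :: real
    have "\<psi> x - \<psi> y = a * (x - y) - (\<phi> x - \<phi> y)" by (simp add: \<psi>_def algebra_simps)
    then have "\<bar>\<psi> x - \<psi> y\<bar> \<le> \<bar>a\<bar> * \<bar>x - y\<bar> + \<bar>\<phi> x - \<phi> y\<bar>"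
      by (metis abs_mult abs_triangle_ineq4)
    also have "\<bar>\<phi> x - \<phi> y\<bar> \<le> L * \<bar>x - y\<bar>" using lipschitz_onD[OF lip, of x y] by (simp add: dist_real_def)
    finally show "dist (\<psi> x) (\<psi> y) \<le> (\<bar>a\<bar> + L) * dist x y" by (simp add: dist_real_def algebra_simps)
  qed (use L in simp)
  \<comment> \<open>Read contrapositively: where \<phi> has no derivative, neither has \<psi>, and
    the Lipschitz bound for \<psi> is 0 there.\<close>
  have \<phi>_diff: "\<phi> differentiable (at y)" if "\<psi> differentiable (at y)" for y
  proof -
    have "(\<lambda>z. a * z - \<psi> z) differentiable (at y)" using that by (intro derivative_intros)
    then show ?thesis by (simp add: \<psi>_def)
  qed
  have deriv_\<psi>: "deriv \<psi> y = a - deriv \<phi> y" if "\<phi> differentiable (at y)" for y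
  proof (rule DERIV_imp_deriv)
    have "(\<phi> has_real_derivative deriv \<phi> y) (at y)" using that by (simp add: DERIV_deriv_iff_real_differentiable)
    then show "(\<psi> has_real_derivative a - deriv \<phi> y) (at y)"
      unfolding \<psi>_def[abs_def] by (auto intro!: derivative_eq_intros)
  qed
  from min_wug_lipschitz(2)[OF m f lip']
  have "AE x in m. min_wug m (\<lambda>y. \<psi> (f y)) x
    \<le> (if \<phi> differentiable (at (f x)) then \<bar>a - deriv \<phi> (f x)\<bar> * min_wug m f x else 0)"
  proof eventually_elim
    case (elim x)
    have "0 \<le> \<bar>a - deriv \<phi> (f x)\<bar> * min_wug m f x"
      by (intro mult_nonneg_nonneg abs_ge_zero min_wug_props(2)[OF m f])
    then show ?case
      using elim \<phi>_diff[of "f x"] deriv_\<psi>[of "f x"] by (simp split: if_splits)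
  qed
  then show ?thesis by (simp add: \<psi>_def)
qed

theorem differential_chain:
  fixes \<phi> :: "real \<Rightarrow> real"
  assumes f: "f \<in> S2 m" and lip: "L-lipschitz_on UNIV \<phi>" and c: "c \<in> Linf m"
  defines "g \<equiv> (\<lambda>x. if \<phi> differentiable at (f x) then deriv \<phi> (f x) else c x)"
  shows "differential m (\<phi> \<circ> f) = cot_mult m g (differential m f)"
proof -
  have fm [measurable]: "f \<in> borel_measurable m" using f by (simp add: S2_def)
  have cm [measurable]: "c \<in> borel_measurable m" using c by (simp add: Linf_def)
  note [measurable] = Borel_differentiable[OF lipschitz_on_continuous_on[OF lip]]
  \<comment> \<open>Extended by 0, the derivative is Borel and bounded; \<open>g\<close> inherits
    measurability and an essential bound from it and from \<open>c\<close>.\<close>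
  define d where "d y = (if \<phi> differentiable (at y) then deriv \<phi> y else 0)" for y
  have [measurable]: "d \<in> borel_measurable borel" unfolding d_def[abs_def] by measurable
  have L: "0 \<le> L" using lip by (simp add: lipschitz_on_def)
  have d: "\<bar>d y\<bar> \<le> L" for y
    using lipschitz_abs_deriv_le[OF lip, of _ y] L by (auto simp: d_def DERIV_deriv_iff_real_differentiable)
  have g_eq: "g = (\<lambda>x. if \<phi> differentiable at (f x) then d (f x) else c x)"
    by (auto simp: g_def d_def)
  have "g \<in> borel_measurable m" unfolding g_eq by measurable
  moreover obtain C where "AE x in m. \<bar>c x\<bar> \<le> C" using c by (auto simp: Linf_def)
  then have "AE x in m. \<bar>g x\<bar> \<le> max L C" by eventually_elim (use d in \<open>auto simp: g_eq le_max_iff_disj\<close>)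
  ultimately have g: "g \<in> Linf m" unfolding Linf_def by blast
  obtain h where h: "approximates m h g" by (rule approximates_exists[OF m g])
  note hs = approximates_simple[OF m h]
  note fF = families_singleton[OF m f] and pF = families_singleton[OF m min_wug_lipschitz(1)[OF m f lip]]
  note fP = families_partition[OF m fF]
  have fam: "family_mult (h n) {(f, UNIV)} \<in> families m" for n by (rule families_mult[OF m fF hs])
  have gap: "null_gap m (\<lambda>n. family_mult (h n) {(f, UNIV)}) (\<lambda>_. {(\<lambda>x. \<phi> (f x), UNIV)})"
  proof (rule null_gapI[OF m fam pF min_wug_measurable[OF m f] min_wug_props(3)[OF m f]])
    fix e :: real assume e: "0 < e"
    from approximatesD[OF m h e]
    show "\<forall>\<^sub>F n in sequentially. AE x in m. family_gap m (family_mult (h n) {(f, UNIV)}) {(\<lambda>x. \<phi> (f x), UNIV)} x \<le> e * min_wug m f x"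
    proof eventually_elim
      case (elim n)
      have "AE x in m. \<forall>a\<in>range (h n). min_wug m (\<lambda>y. a * f y - \<phi> (f y)) x
        \<le> (if \<phi> differentiable (at (f x)) then \<bar>a - deriv \<phi> (f x)\<bar> * min_wug m f x else 0)"
        by (intro AE_finite_allI hs(2) min_wug_chain_frozen[OF f lip])
      with elim show ?case
      proof eventually_elim
        case (elim x)
        have nn: "0 \<le> min_wug m f x" by (rule min_wug_props(2)[OF m f])
        have "family_gap m (family_mult (h n) {(f, UNIV)}) {(\<lambda>x. \<phi> (f x), UNIV)} x = min_wug m (\<lambda>y. h n x * f y - \<phi> (f y)) x"
          by (simp add: family_gap_def borel_partition_mult(2)[OF m fP hs])
        also have "\<dots> \<le> (if \<phi> differentiable (at (f x)) then \<bar>h n x - deriv \<phi> (f x)\<bar> * min_wug m f x else 0)"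
          using elim(2) by blast
        also have "\<dots> \<le> e * min_wug m f x"
        proof (cases "\<phi> differentiable (at (f x))")
          case True
          then have "\<bar>h n x - deriv \<phi> (f x)\<bar> \<le> e" using elim(1) by (simp add: g_def)
          then show ?thesis using True nn by (simp add: mult_right_mono)
        qed (use e nn in simp)
        finally show ?case .
      qed
    qed
  qed
  have "cot_mult m g (differential m f) = cot_class m (\<lambda>n. family_mult (h n) {(f, UNIV)})"
    unfolding differential_eq[OF m] by (rule cot_mult_const_class[OF m fF g h])
  also have "\<dots> = differential m (\<lambda>x. \<phi> (f x))"
    unfolding differential_eq[OF m]
    by (rule cot_class_eq[OF m cauchy_families_mult[OF m h fF] cauchy_families_const[OF m pF] gap])
  finally show ?thesis by (simp add: comp_def)
qed

end

theorem corollary2p2p8: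
  fixes m :: "'a::polish_space measure"
  assumes "radon_measure m"
  shows
    "(\<forall>f \<in> S2 m \<inter> Linf m. \<forall>g \<in> S2 m \<inter> Linf m.
        differential m (\<lambda>x. f x * g x) =
          cot_add m (cot_mult m g (differential m f)) (cot_mult m f (differential m g)))
     \<and> (\<forall>f \<in> S2 m. \<forall>N \<in> null_sets (lborel :: real measure).
        cot_zero_on m (differential m f) (f -` N))
     \<and> (\<forall>f \<in> S2 m. \<forall>\<phi> :: real \<Rightarrow> real. (\<exists>L. L-lipschitz_on UNIV \<phi>) \<longrightarrow>
        (\<forall>c \<in> Linf m.
          differential m (\<phi> \<circ> f) =
            cot_mult m (\<lambda>x. if \<phi> differentiable at (f x) then deriv \<phi> (f x) else c x)
              (differential m f)))"
proof -
  have m: "sets m = sets borel" using assms by (simp add: radon_measure_def)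
  show ?thesis
    by (intro conjI ballI allI impI; (elim exE)?)
      (assumption | rule differential_mult[OF m] differential_locality[OF m] differential_chain[OF m])+
qed

end
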